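(* Let $q\in\mathcal Z\setminus\{0\}$ and $h\in\mathcal H_{\mathbb R}$. In the right GNS representation on $\mathcal F_q(\mathcal H)$ one may decompose $$W((0)(1)\otimes h)=T((0)(1)\otimes h)=a^+_{(0)(1)}(h)+a^-_{(0)(1)}(h),$$ where, for $\alpha\in S_0(n)$ and $F\in\mathcal H_{\mathbb R}^{\odot n}$, $$a^+_{(0)(1)}(h)(\alpha\otimes F)=\alpha\otimes r^+(h)F$$ (with $\alpha$ on the right regarded as an element of $S_0(n+1)$ fixing $n+1$) and $$a^-_{(0)(1)}(h)(\alpha\otimes F)=\sum_{k:\,(k)\in\alpha}P^{[0,n]\setminus\{k\}}_{[0,n-1]}\alpha|_{\{k\}^c}\otimes r_k^-(h)F+q\sum_{k:\,(k)\notin\alpha}P^{[0,n]\setminus\{k\}}_{[0,n-1]}\alpha|_{\{k\}^c}\otimes r_k^-(h)F,$$ the sums being over $k\in\{1,\dots,n\}$, and $(k)\in\alpha$ meaning that $k$ is a fixed point of $\alpha$. These operators are adjoints of each other. The distribution of $W((0)(1)\otimes h)$ (with respect to $\varphi$) is Gaussian with mean $0$ and variance $\|h\|^2$.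
   Context: Permutations. $[n]=\{1,\dots,n\}$, $[0,n]=\{0,\dots,n\}$; $S(n)$, $S_0(n)$ are the permutation groups of $[n]$, $[0,n]$, with $S(n)\subset S_0(n)$ the permutations fixing $0$; products are composed right to left; for $m>n$, $S_0(n)\subset S_0(m)$ by fixing $n+1,\dots,m$. $\mathrm{cyc}_0(\alpha)$ is the number of cycles of $\alpha\in S_0(n)$ (fixed points are cycles) not containing $0$; $|\alpha|=n-\mathrm{cyc}_0(\alpha)$; $\chi_q$ is the linear extension of $\chi_q(\alpha)=q^{|\alpha|}$. $\mathcal Z=\{0\}\cup\{\pm1/N:N\in\mathbb N\}$. $(0)(1)$ is the identity of $S_0(1)$, $(0)$ the identity of $S_0(0)$. For $\alpha\in S_0(n)$, $\beta\in S_0(k)$, $\alpha\cup\beta=\beta'\alpha\in S_0(n+k)$, where $\beta'$ fixes $[n]$ and is obtained from $\beta$ by replacing each $j\in[k]$ by $n+j$ ($0$ unchanged). For $S\subset[n]$, $\alpha|_{S^c}$ is the permutation of $[0,n]\setminus S$, $x\mapsto\alpha^m(x)$, $m=\min\{j>0:\alpha^j(x)\notin S\}$. $P^A_B$ transports permutations of $A$ to permutations of $B$ along the order-preserving bijection $A\to B$. Contractions. $\mathcal P_{1,2}(n)$: partitions $\pi$ of $[n]$ into blocks of size 1 and 2, identified with involutions; $|\pi|$ number of pairs, $\mathrm{supp}(\pi)$ their union. With $\ell=|\pi|$, $C_\pi(\alpha)=q^{\mathrm{cyc}_0((\pi\alpha)|_{\mathrm{supp}(\pi)^c})-\mathrm{cyc}_0(\pi\alpha)+\ell}P^{[0,n]\setminus\mathrm{supp}(\pi)}_{[0,n-2\ell]}(\pi\alpha)|_{\mathrm{supp}(\pi)^c}$;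 $C_\pi(h_1\otimes\dots\otimes h_n)=\prod_{\{i,j\}\text{ pair}}\langle h_i,h_j\rangle\bigotimes_{k\text{ singleton}}h_k$ (increasing order). $r^+(h)F=F\otimes h$ and $r_k^-(h)F=C_{(k\ n+1)}(F\otimes h)$, i.e. $r_k^-(h)(h_1\otimes\dots\otimes h_n)=\langle h_k,h\rangle h_1\otimes\dots\otimes\hat h_k\otimes\dots\otimes h_n$. Algebra and Fock space. $\mathcal H_{\mathbb R}$ is a real Hilbert space, $\mathcal H$ its complexification. $U_\sigma(h_1\otimes\dots\otimes h_n)=h_{\sigma^{-1}(1)}\otimes\dots\otimes h_{\sigma^{-1}(n)}$, $\alpha\otimes_sF=\frac1{n!}\sum_{\sigma\in S(n)}\sigma\alpha\sigma^{-1}\otimes U_\sigma F$. $\mathcal{TP}(\mathcal H_{\mathbb R})=\bigoplus_{n}\mathbb C[S_0(n)]\otimes_s\mathcal H_{\mathbb R}^{\odot n}$ (complex span of $\alpha\otimes_sF$; $\odot$ is the algebraic tensor power); the algebra element corresponding to $\xi$ is $W(\xi)$ ($W(\alpha\otimes F)=W(\alpha\otimes_sF)$); $T(\alpha\otimes F)=\sum_{\pi\in\mathcal P_{1,2}(n)}W(C_\pi(\alpha)\otimes C_\pi(F))$; product $T(\alpha\otimes_sF)T(\beta\otimes_sG)=T((\alpha\cup\beta)\otimes_s(F\otimes G))$; adjoint the antilinear extension of $T(\alpha\otimes_sF)^*=T(\alpha^{-1}\otimes_sF)$. $\varphi$ is the functional with $\varphi[W((0))]=1$, $\varphi[W(\alpha\otimes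 F)]=0$ for $n\ge1$; for $q\in\mathcal Z\setminus\{0\}$ it is a tracial state with $\varphi[W(\zeta)^*W(\xi)]=\langle\xi,\zeta\rangle_q$, where $\langle\alpha\otimes F,\beta\otimes G\rangle_q=\delta_{n=k}\sum_{\sigma\in S(n)}\chi_q(\alpha\sigma\beta^{-1}\sigma^{-1})\langle F,U_\sigma G\rangle$. The GNS Hilbert space is $\mathcal F_q(\mathcal H)$, the completion of $\mathcal{TP}(\mathcal H_{\mathbb R})$ modulo the kernel of $\langle\cdot,\cdot\rangle_q$, with $W(\xi)$ corresponding to the vector $\xi$. In the right GNS representation $A$ acts (on the dense image of $\mathcal{TP}(\mathcal H_{\mathbb R})$) by right multiplication: it sends the vector of $W(\xi)$ to the vector of $W(\xi)A$. Here $\alpha\otimes F$ denotes the class of $\alpha\otimes_sF$. The distribution of a self-adjoint $A$ is the one with moments $\varphi[A^m]$. *)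

theory Defs
  imports
    "HOL-Probability.Probability"
    "HOL-Combinatorics.Orbits"
    "HOL-Library.Poly_Mapping"
begin

class complex_vector = ab_group_add +
  fixes scaleC :: "complex \<Rightarrow> 'a \<Rightarrow> 'a"  (infixr \<open>*\<^sub>C\<close> 75)
  assumes scaleC_add_right: "a *\<^sub>C (x + y) = a *\<^sub>C x + a *\<^sub>C y"
    and scaleC_add_left: "(a + b) *\<^sub>C x = a *\<^sub>C x + b *\<^sub>C x"
    and scaleC_scaleC: "a *\<^sub>C b *\<^sub>C x = (a * b) *\<^sub>C x"
    and scaleC_one: "1 *\<^sub>C x = x"

global_interpretation complex_vector:
    vector_space "scaleC :: complex \<Rightarrow> 'a \<Rightarrow> 'a::complex_vector"
  defines cspan = complex_vector.span
  by unfold_locales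
    (simp_all add: scaleC_add_right scaleC_add_left scaleC_scaleC scaleC_one)

instantiation complex :: complex_vector
begin
definition "scaleC_complex = ((*) :: complex \<Rightarrow> complex \<Rightarrow> complex)"
instance
  by standard (simp_all add: scaleC_complex_def algebra_simps)
end

text \<open>For a label type \<open>'l\<close> and a real vector space \<open>'a\<close>, the type \<open>('l, 'a) tens\<close> is
  the direct sum over all \<open>n\<close> of \<open>\<complex>[L] \<otimes> (n-th algebraic tensor power of 'a over \<real>)\<close>, where
  \<open>\<complex>[L]\<close> is the complex vector space with basis \<open>'l\<close>. It is the free complex vector space on
  the pairs \<open>(l, [h\<^sub>1, \<dots>, h\<^sub>n])\<close>, divided by real linearity in every slot; the complex
  coefficients account for the complexification of the tensors.\<close>

type_synonym ('l, 'a) formal = "('l \<times> 'a list) \<Rightarrow>\<^sub>0 complex"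

inductive_set multilin_rel :: "('l, 'a::real_vector) formal set" where
  zero: "0 \<in> multilin_rel"
| add: "x \<in> multilin_rel \<Longrightarrow> y \<in> multilin_rel \<Longrightarrow> x + y \<in> multilin_rel"
| slot: "Poly_Mapping.single (l, xs @ (a *\<^sub>R u + b *\<^sub>R v) # ys) c
     - Poly_Mapping.single (l, xs @ u # ys) (c * of_real a)
     - Poly_Mapping.single (l, xs @ v # ys) (c * of_real b) \<in> multilin_rel"

definition formal_scale :: "complex \<Rightarrow> ('l, 'a) formal \<Rightarrow> ('l, 'a) formal" where
  "formal_scale c x = Poly_Mapping.map (\<lambda>z. c * z) x"

lemma lookup_formal_scale [simp]:
  "Poly_Mapping.lookup (formal_scale c x) k = c * Poly_Mapping.lookup x k"
  by (simp add: formal_scale_def Poly_Mapping.map.rep_eq when_def)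

lemma formal_scale_zero: "formal_scale c 0 = 0"
  by (rule poly_mapping_eqI) simp

lemma formal_scale_single:
  "formal_scale c (Poly_Mapping.single k d) = Poly_Mapping.single k (c * d)"
  by (rule poly_mapping_eqI) (simp add: lookup_single when_def)

lemma formal_scale_add: "formal_scale c (x + y) = formal_scale c x + formal_scale c y"
  by (rule poly_mapping_eqI) (simp add: lookup_add algebra_simps)

lemma formal_scale_diff: "formal_scale c (x - y) = formal_scale c x - formal_scale c y"
  by (rule poly_mapping_eqI) (simp add: lookup_minus algebra_simps)

lemma multilin_rel_scale:
  assumes "x \<in> multilin_rel" shows "formal_scale c x \<in> multilin_rel"
  using assms
proof induction
  case zero
  show ?case by (simp add: formal_scale_zero multilin_rel.zero)
next
  case (add x y)
  then show ?case by (simp add: formal_scale_add multilin_rel.add)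
next
  case (slot l xs a u b v ys d)
  show ?case
    using multilin_rel.slot[of l xs a u b v ys "c * d"]
    by (simp add: formal_scale_diff formal_scale_single mult.assoc)
qed

lemma formal_scale_minus_one: "formal_scale (- 1) x = - x"
  by (rule poly_mapping_eqI) simp

lemma multilin_rel_uminus: "x \<in> multilin_rel \<Longrightarrow> - x \<in> multilin_rel"
  using multilin_rel_scale[of x "- 1"] by (simp add: formal_scale_minus_one)

quotient_type (overloaded) ('l, 'a) tens = "('l, 'a::real_vector) formal" /
  "\<lambda>x y. x - y \<in> multilin_rel"
  morphisms rep_tens abs_tens
proof (rule equivpI)
  show "reflp (\<lambda>x y :: ('l, 'a) formal. x - y \<in> multilin_rel)"
    by (simp add: reflp_def multilin_rel.zero)
  show "symp (\<lambda>x y :: ('l, 'a) formal. x - y \<in> multilin_rel)"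
  proof (rule sympI)
    fix x y :: "('l, 'a) formal"
    assume "x - y \<in> multilin_rel"
    from multilin_rel_uminus[OF this] show "y - x \<in> multilin_rel" by simp
  qed
  show "transp (\<lambda>x y :: ('l, 'a) formal. x - y \<in> multilin_rel)"
  proof (rule transpI)
    fix x y z :: "('l, 'a) formal"
    assume "x - y \<in> multilin_rel" "y - z \<in> multilin_rel"
    then have "(x - y) + (y - z) \<in> multilin_rel" by (rule multilin_rel.add)
    then show "x - z \<in> multilin_rel" by simp
  qed
qed

instantiation tens :: (type, real_vector) ab_group_add
begin

lift_definition zero_tens :: "('a, 'b) tens" is 0 .

lift_definition plus_tens :: "('a, 'b) tens \<Rightarrow> ('a, 'b) tens \<Rightarrow> ('a, 'b) tens" is "(+)"
proof -
  fix x y z w :: "('a, 'b) formal"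
  assume *: "x - y \<in> multilin_rel" "z - w \<in> multilin_rel"
  have "(x - y) + (z - w) \<in> multilin_rel"
    using * by (rule multilin_rel.add)
  then show "x + z - (y + w) \<in> multilin_rel" by (simp add: algebra_simps)
qed

lift_definition uminus_tens :: "('a, 'b) tens \<Rightarrow> ('a, 'b) tens" is uminus
proof -
  fix x y :: "('a, 'b) formal"
  assume "x - y \<in> multilin_rel"
  from multilin_rel_uminus[OF this] show "- x - - y \<in> multilin_rel" by simp
qed

lift_definition minus_tens :: "('a, 'b) tens \<Rightarrow> ('a, 'b) tens \<Rightarrow> ('a, 'b) tens" is "(-)"
proof -
  fix x y z w :: "('a, 'b) formal"
  assume *: "x - y \<in> multilin_rel" "z - w \<in> multilin_rel"
  have "(x - y) + - (z - w) \<in> multilin_rel"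
    using * by (intro multilin_rel.add multilin_rel_uminus)
  then show "x - z - (y - w) \<in> multilin_rel" by (simp add: algebra_simps)
qed

instance
  by standard (transfer, simp add: algebra_simps multilin_rel.zero)+

end

instantiation tens :: (type, real_vector) complex_vector
begin

lift_definition scaleC_tens :: "complex \<Rightarrow> ('a, 'b) tens \<Rightarrow> ('a, 'b) tens" is formal_scale
proof -
  fix c and x y :: "('a, 'b) formal"
  assume "x - y \<in> multilin_rel"
  from multilin_rel_scale[OF this, of c]
  show "formal_scale c x - formal_scale c y \<in> multilin_rel"
    by (simp add: formal_scale_diff)
qed

instance
proof
  fix a b :: complex and x y :: "('a, 'b) tens"
  show "a *\<^sub>C (x + y) = a *\<^sub>C x + a *\<^sub>C y"
    by transfer (simp add: formal_scale_add multilin_rel.zero)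
  show "(a + b) *\<^sub>C x = a *\<^sub>C x + b *\<^sub>C x"
  proof transfer
    fix a b :: complex and x :: "('a, 'b) formal"
    have "formal_scale (a + b) x = formal_scale a x + formal_scale b x"
      by (rule poly_mapping_eqI) (simp add: lookup_add algebra_simps)
    then show "formal_scale (a + b) x - (formal_scale a x + formal_scale b x) \<in> multilin_rel"
      by (simp add: multilin_rel.zero)
  qed
  show "a *\<^sub>C b *\<^sub>C x = (a * b) *\<^sub>C x"
  proof transfer
    fix a b :: complex and x :: "('a, 'b) formal"
    have "formal_scale a (formal_scale b x) = formal_scale (a * b) x"
      by (rule poly_mapping_eqI) simp
    then show "formal_scale a (formal_scale b x) - formal_scale (a * b) x \<in> multilin_rel"
      by (simp add: multilin_rel.zero)
  qed
  show "1 *\<^sub>C x = x"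
  proof transfer
    fix x :: "('a, 'b) formal"
    have "formal_scale 1 x = x"
      by (rule poly_mapping_eqI) simp
    then show "formal_scale 1 x - x \<in> multilin_rel"
      by (simp add: multilin_rel.zero)
  qed
qed

end

definition elem :: "'l \<Rightarrow> 'a list \<Rightarrow> ('l, 'a::real_vector) tens" where
  "elem l hs = abs_tens (Poly_Mapping.single (l, hs) 1)"

definition multilinear :: "('l \<Rightarrow> 'a::real_vector list \<Rightarrow> 'b::complex_vector) \<Rightarrow> bool" where
  "multilinear f \<longleftrightarrow> (\<forall>l xs ys u v a b. f l (xs @ (a *\<^sub>R u + b *\<^sub>R v) # ys) =
     of_real a *\<^sub>C f l (xs @ u # ys) + of_real b *\<^sub>C f l (xs @ v # ys))"

text \<open>Linear extension from elementary tensors. It is evaluated on a chosen representative;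
  for multilinear \<open>f\<close> the choice does not matter (lemma \<open>lin_ext_abs_tens\<close>).
  The antilinear variant conjugates the coefficients.\<close>

definition formal_ext ::
    "('l \<Rightarrow> 'a list \<Rightarrow> 'b) \<Rightarrow> ('l, 'a) formal \<Rightarrow> 'b::complex_vector" where
  "formal_ext f v =
     (\<Sum>b\<in>Poly_Mapping.keys v. Poly_Mapping.lookup v b *\<^sub>C f (fst b) (snd b))"

definition lin_ext ::
    "('l \<Rightarrow> 'a list \<Rightarrow> 'b) \<Rightarrow> ('l, 'a::real_vector) tens \<Rightarrow> 'b::complex_vector" where
  "lin_ext f x = formal_ext f (rep_tens x)"

definition antilin_ext ::
    "('l \<Rightarrow> 'a list \<Rightarrow> 'b) \<Rightarrow> ('l, 'a::real_vector) tens \<Rightarrow> 'b::complex_vector" where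
  "antilin_ext f x = (\<Sum>b\<in>Poly_Mapping.keys (rep_tens x).
     cnj (Poly_Mapping.lookup (rep_tens x) b) *\<^sub>C f (fst b) (snd b))"

lemma formal_ext_superset:
  assumes "finite A" "Poly_Mapping.keys v \<subseteq> A"
  shows "formal_ext f v = (\<Sum>b\<in>A. Poly_Mapping.lookup v b *\<^sub>C f (fst b) (snd b))"
  unfolding formal_ext_def
  by (rule sum.mono_neutral_left) (use assms in \<open>auto simp: in_keys_iff\<close>)

lemma formal_ext_add: "formal_ext f (v + w) = formal_ext f v + formal_ext f w"
proof -
  let ?A = "Poly_Mapping.keys v \<union> Poly_Mapping.keys w"
  have "Poly_Mapping.keys (v + w) \<subseteq> ?A" by (rule keys_add)
  then show ?thesis
    by (simp add: formal_ext_superset[of ?A] lookup_add scaleC_add_left sum.distrib)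
qed

lemma formal_ext_single: "formal_ext f (Poly_Mapping.single (l, hs) c) = c *\<^sub>C f l hs"
  by (simp add: formal_ext_def)

lemma formal_ext_zero: "formal_ext f 0 = 0"
  by (simp add: formal_ext_def)

lemma formal_ext_diff: "formal_ext f (v - w) = formal_ext f v - formal_ext f w"
  using formal_ext_add[of f "v - w" w] by (simp add: algebra_simps)

lemma formal_ext_multilin_rel:
  assumes "multilinear f" "v \<in> multilin_rel"
  shows "formal_ext f v = 0"
  using assms(2)
proof induction
  case (slot l xs a u b v ys c)
  then show ?case
    using assms(1)
    by (simp add: formal_ext_diff formal_ext_single multilinear_def scaleC_scaleC
        scaleC_add_right)
qed (simp_all add: formal_ext_zero formal_ext_add)

lemma lin_ext_abs_tens:
  assumes "multilinear f"
  shows "lin_ext f (abs_tens v) = formal_ext f v"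
proof -
  have "v - v \<in> multilin_rel"
    by (simp add: multilin_rel.zero)
  then have "rep_tens (abs_tens v) - v \<in> multilin_rel"
    by (rule rep_abs_rsp_left[OF Quotient3_tens])
  from formal_ext_multilin_rel[OF assms this] show ?thesis
    by (simp add: lin_ext_def formal_ext_diff)
qed

lemma lin_ext_elem:
  assumes "multilinear f"
  shows "lin_ext f (elem l hs) = f l hs"
  by (simp add: elem_def lin_ext_abs_tens[OF assms] formal_ext_single)

text \<open>Unlabelled tensors: the (complexified) algebraic tensor algebra.
  Permutation-labelled tensors: \<open>\<alpha> \<otimes> F\<close> with \<open>\<alpha>\<close> a permutation of \<open>[0,n]\<close>, encoded as a
  function \<open>nat \<Rightarrow> nat\<close> that is the identity outside; this encoding makes
  \<open>S\<^sub>0(n) \<subseteq> S\<^sub>0(m)\<close> literal, while the degree \<open>n\<close> is recorded by the length of the tensors.\<close>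

type_synonym 'a tensor = "(unit, 'a) tens"
type_synonym 'a ptens = "(nat \<Rightarrow> nat, 'a) tens"

definition tensor_power :: "nat \<Rightarrow> 'a::real_vector tensor set" where
  "tensor_power n =
     {\<Sum>j\<in>J. of_real (c j) *\<^sub>C elem () (f j) |(J :: nat set) c f.
        finite J \<and> (\<forall>j\<in>J. length (f j) = n)}"

definition ot :: "(nat \<Rightarrow> nat) \<Rightarrow> 'a::real_vector tensor \<Rightarrow> 'a ptens" where
  "ot \<alpha> F = lin_ext (\<lambda>_ hs. elem \<alpha> hs) F"

definition Z_set :: "real set" where
  "Z_set = {0} \<union> {1 / real N |N. 1 \<le> N} \<union> {- (1 / real N) |N. 1 \<le> N}"

definition S0 :: "nat \<Rightarrow> (nat \<Rightarrow> nat) set" where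
  "S0 n = {\<alpha>. \<alpha> permutes {0..n}}"

definition Sn :: "nat \<Rightarrow> (nat \<Rightarrow> nat) set" where
  "Sn n = {\<sigma>. \<sigma> permutes {1..n}}"

text \<open>The argument \<open>A\<close> is the finite set permuted by \<open>\<alpha>\<close>; orbits of such permutations are
  their cycles, fixed points included.\<close>

definition cyc0 :: "nat set \<Rightarrow> (nat \<Rightarrow> nat) \<Rightarrow> nat" where
  "cyc0 A \<alpha> = card {c \<in> orbit \<alpha> ` A. 0 \<notin> c}"

definition perm_len :: "nat \<Rightarrow> (nat \<Rightarrow> nat) \<Rightarrow> nat" where
  "perm_len n \<alpha> = n - cyc0 {0..n} \<alpha>"

definition chi :: "real \<Rightarrow> nat \<Rightarrow> (nat \<Rightarrow> nat) \<Rightarrow> real" where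
  "chi q n \<alpha> = q ^ perm_len n \<alpha>"

text \<open>\<open>perm_cup n \<alpha> \<beta>\<close> is \<open>\<alpha> \<union> \<beta> = \<beta>' \<alpha>\<close>, where \<open>j \<mapsto> n + j\<close> (\<open>j > 0\<close>), \<open>0 \<mapsto> 0\<close> relabels \<open>\<beta>\<close>.\<close>

definition perm_shift :: "nat \<Rightarrow> (nat \<Rightarrow> nat) \<Rightarrow> nat \<Rightarrow> nat" where
  "perm_shift n \<beta> x =
     (let up = (\<lambda>j. if j = 0 then 0 else n + j)
      in if x = 0 then up (\<beta> 0) else if x \<le> n then x else up (\<beta> (x - n)))"

definition perm_cup :: "nat \<Rightarrow> (nat \<Rightarrow> nat) \<Rightarrow> (nat \<Rightarrow> nat) \<Rightarrow> nat \<Rightarrow> nat" where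
  "perm_cup n \<alpha> \<beta> = perm_shift n \<beta> \<circ> \<alpha>"

text \<open>\<open>perm_del X \<alpha>\<close> is the first-return permutation on the complement of \<open>X\<close>, extended by
  the identity on \<open>X\<close>.\<close>

definition perm_del :: "nat set \<Rightarrow> (nat \<Rightarrow> nat) \<Rightarrow> nat \<Rightarrow> nat" where
  "perm_del X \<alpha> x =
     (if x \<in> X then x else (\<alpha> ^^ (LEAST j. 0 < j \<and> (\<alpha> ^^ j) x \<notin> X)) x)"

text \<open>For finite \<open>A\<close>, \<open>B\<close> of equal size, \<open>ord_bij A B\<close> is the order-preserving bijection from
  \<open>A\<close> to \<open>B\<close>, with inverse \<open>ord_bij B A\<close>.\<close>

definition ord_bij :: "nat set \<Rightarrow> nat set \<Rightarrow> nat \<Rightarrow> nat" where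
  "ord_bij A B x = sorted_list_of_set B ! card {y \<in> A. y < x}"

definition transport :: "nat set \<Rightarrow> nat set \<Rightarrow> (nat \<Rightarrow> nat) \<Rightarrow> nat \<Rightarrow> nat" where
  "transport A B \<alpha> x = (if x \<in> B then ord_bij A B (\<alpha> (ord_bij B A x)) else x)"

definition P12 :: "nat \<Rightarrow> (nat \<Rightarrow> nat) set" where
  "P12 n = {\<pi>. \<pi> permutes {1..n} \<and> \<pi> \<circ> \<pi> = id}"

definition supp :: "(nat \<Rightarrow> nat) \<Rightarrow> nat set" where
  "supp \<pi> = {x. \<pi> x \<noteq> x}"

definition npairs :: "(nat \<Rightarrow> nat) \<Rightarrow> nat" where
  "npairs \<pi> = card (supp \<pi>) div 2"

text \<open>\<open>C\<^sub>\<pi>(\<alpha>)\<close> is the scalar \<open>perm_contr_coeff\<close> times the permutation \<open>perm_contr\<close>.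
  The exponent can be negative.\<close>

definition perm_contr_coeff :: "real \<Rightarrow> nat \<Rightarrow> (nat \<Rightarrow> nat) \<Rightarrow> (nat \<Rightarrow> nat) \<Rightarrow> real" where
  "perm_contr_coeff q n \<pi> \<alpha> =
     q powi (int (cyc0 ({0..n} - supp \<pi>) (perm_del (supp \<pi>) (\<pi> \<circ> \<alpha>)))
             - int (cyc0 {0..n} (\<pi> \<circ> \<alpha>)) + int (npairs \<pi>))"

definition perm_contr :: "nat \<Rightarrow> (nat \<Rightarrow> nat) \<Rightarrow> (nat \<Rightarrow> nat) \<Rightarrow> nat \<Rightarrow> nat" where
  "perm_contr n \<pi> \<alpha> =
     transport ({0..n} - supp \<pi>) {0..n - 2 * npairs \<pi>} (perm_del (supp \<pi>) (\<pi> \<circ> \<alpha>))"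

text \<open>Tensor slots are numbered from 1, list positions from 0. The maps \<open>tens_contr n\<close> and
  \<open>U_perm n\<close> act on the degree \<open>n\<close> component and kill the others: without the guard their
  generators would not be multilinear in the other degrees.\<close>

definition tens_contr :: "nat \<Rightarrow> (nat \<Rightarrow> nat) \<Rightarrow> 'a::real_inner tensor \<Rightarrow> 'a tensor" where
  "tens_contr n \<pi> = lin_ext (\<lambda>_ hs. if length hs = n then
     of_real (\<Prod>i\<in>{i \<in> {1..n}. i < \<pi> i}. inner (hs ! (i - 1)) (hs ! (\<pi> i - 1)))
       *\<^sub>C elem () (nths hs {j. Suc j \<notin> supp \<pi>}) else 0)"

definition r_plus :: "'a::real_inner \<Rightarrow> 'a tensor \<Rightarrow> 'a tensor" where
  "r_plus h = lin_ext (\<lambda>_ hs. elem () (hs @ [h]))"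

definition r_minus :: "nat \<Rightarrow> 'a::real_inner \<Rightarrow> 'a tensor \<Rightarrow> 'a tensor" where
  "r_minus k h = lin_ext (\<lambda>_ hs.
     of_real (inner (hs ! (k - 1)) h) *\<^sub>C elem () (take (k - 1) hs @ drop k hs))"

definition U_perm :: "nat \<Rightarrow> (nat \<Rightarrow> nat) \<Rightarrow> 'a::real_inner tensor \<Rightarrow> 'a tensor" where
  "U_perm n \<sigma> = lin_ext (\<lambda>_ hs. if length hs = n then
     elem () (map (\<lambda>i. hs ! (inv \<sigma> i - 1)) [1..<Suc n]) else 0)"

text \<open>Inner product on the complexified tensor algebra, antilinear in the second argument;
  different degrees are orthogonal.\<close>

definition tens_inner :: "'a::real_inner tensor \<Rightarrow> 'a tensor \<Rightarrow> complex" where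
  "tens_inner F G = lin_ext (\<lambda>_ hs. antilin_ext (\<lambda>_ gs.
     if length hs = length gs then of_real (\<Prod>i<length hs. inner (hs ! i) (gs ! i)) else 0) G) F"

definition symm :: "nat \<Rightarrow> (nat \<Rightarrow> nat) \<Rightarrow> 'a::real_inner tensor \<Rightarrow> 'a ptens" where
  "symm n \<alpha> F = (1 / fact n) *\<^sub>C (\<Sum>\<sigma>\<in>Sn n. ot (\<sigma> \<circ> \<alpha> \<circ> inv \<sigma>) (U_perm n \<sigma> F))"

definition TP :: "'a::real_inner ptens set" where
  "TP = cspan {symm n \<alpha> F |n \<alpha> F. \<alpha> \<in> S0 n \<and> F \<in> tensor_power n}"

text \<open>The underlying vector space of the algebra is \<open>TP\<close> itself, so that \<open>W(\<xi>)\<close> is \<open>\<xi>\<close> for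
  \<open>\<xi> \<in> TP\<close>; on all of \<open>ptens\<close>, \<open>W(\<alpha> \<otimes> F) = \<alpha> \<otimes>\<^sub>s F\<close>.\<close>

definition Wmap :: "'a::real_inner ptens \<Rightarrow> 'a ptens" where
  "Wmap = lin_ext (\<lambda>\<alpha> hs. symm (length hs) \<alpha> (elem () hs))"

definition Tmap :: "real \<Rightarrow> 'a::real_inner ptens \<Rightarrow> 'a ptens" where
  "Tmap q = lin_ext (\<lambda>\<alpha> hs. let n = length hs in
     \<Sum>\<pi>\<in>P12 n. of_real (perm_contr_coeff q n \<pi> \<alpha>) *\<^sub>C
       Wmap (ot (perm_contr n \<pi> \<alpha>) (tens_contr n \<pi> (elem () hs))))"

text \<open>Bilinear extension of \<open>(\<alpha> \<otimes> F, \<beta> \<otimes> G) \<mapsto> (\<alpha> \<union> \<beta>) \<otimes> (F \<otimes> G)\<close>.\<close>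

definition cup_tens :: "'a::real_inner ptens \<Rightarrow> 'a ptens \<Rightarrow> 'a ptens" where
  "cup_tens \<xi> \<zeta> = lin_ext (\<lambda>\<alpha> hs. lin_ext (\<lambda>\<beta> gs.
     elem (perm_cup (length hs) \<alpha> \<beta>) (hs @ gs)) \<zeta>) \<xi>"

text \<open>\<open>T\<close> restricts to a linear bijection of \<open>TP\<close> (the term for the trivial partition is the
  identity, all others lower the degree); product and adjoint are prescribed through it.\<close>

definition T_inv :: "real \<Rightarrow> 'a::real_inner ptens \<Rightarrow> 'a ptens" where
  "T_inv q = inv_into TP (Tmap q)"

definition tmult :: "real \<Rightarrow> 'a::real_inner ptens \<Rightarrow> 'a ptens \<Rightarrow> 'a ptens" where
  "tmult q A B = Tmap q (Wmap (cup_tens (T_inv q A) (T_inv q B)))"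

definition tadj :: "real \<Rightarrow> 'a::real_inner ptens \<Rightarrow> 'a ptens" where
  "tadj q A = Tmap q (Wmap (antilin_ext (\<lambda>\<alpha> hs. elem (inv \<alpha>) hs) (T_inv q A)))"

primrec tpow :: "real \<Rightarrow> 'a::real_inner ptens \<Rightarrow> nat \<Rightarrow> 'a ptens" where
  "tpow q A 0 = Wmap (elem id [])"
| "tpow q A (Suc m) = tmult q (tpow q A m) A"

text \<open>The only element of \<open>S\<^sub>0(0)\<close> is the identity, so only the degree matters.\<close>

definition phi :: "'a::real_inner ptens \<Rightarrow> complex" where
  "phi = lin_ext (\<lambda>\<alpha> hs. if hs = [] then 1 else 0)"

definition q_inner :: "real \<Rightarrow> 'a::real_inner ptens \<Rightarrow> 'a ptens \<Rightarrow> complex" where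
  "q_inner q \<xi> \<zeta> = lin_ext (\<lambda>\<alpha> hs. antilin_ext (\<lambda>\<beta> gs.
     if length hs = length gs
     then \<Sum>\<sigma>\<in>Sn (length hs).
       of_real (chi q (length hs) (\<alpha> \<circ> \<sigma> \<circ> inv \<beta> \<circ> inv \<sigma>)) *
       tens_inner (elem () hs) (U_perm (length hs) \<sigma> (elem () gs))
     else 0) \<zeta>) \<xi>"

definition q_norm :: "real \<Rightarrow> 'a::real_inner ptens \<Rightarrow> real" where
  "q_norm q \<xi> = sqrt (Re (q_inner q \<xi> \<xi>))"

text \<open>The completion of \<open>TP\<close> modulo the kernel of the seminorm: Cauchy sequences in \<open>TP\<close> modulo
  null sequences. The image of \<open>\<xi> \<in> TP\<close> is the class of the constant sequence.\<close>

definition q_cauchy :: "real \<Rightarrow> (nat \<Rightarrow> 'a::real_inner ptens) set" where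
  "q_cauchy q = {s. range s \<subseteq> TP \<and>
     (\<forall>e>0. \<exists>M. \<forall>m\<ge>M. \<forall>n\<ge>M. q_norm q (s m - s n) < e)}"

definition null_rel ::
    "real \<Rightarrow> ((nat \<Rightarrow> 'a::real_inner ptens) \<times> (nat \<Rightarrow> 'a ptens)) set" where
  "null_rel q = {(s, t). s \<in> q_cauchy q \<and> t \<in> q_cauchy q \<and>
     (\<lambda>n. q_norm q (s n - t n)) \<longlonglongrightarrow> 0}"

type_synonym 'a fock_vec = "(nat \<Rightarrow> 'a ptens) set"

definition fock :: "real \<Rightarrow> 'a::real_inner fock_vec set" where
  "fock q = q_cauchy q // null_rel q"

definition fock_cls :: "real \<Rightarrow> (nat \<Rightarrow> 'a::real_inner ptens) \<Rightarrow> 'a fock_vec" where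
  "fock_cls q s = null_rel q `` {s}"

definition fock_add ::
    "real \<Rightarrow> 'a::real_inner fock_vec \<Rightarrow> 'a fock_vec \<Rightarrow> 'a fock_vec" where
  "fock_add q x y = (\<Union>s\<in>x. \<Union>t\<in>y. fock_cls q (\<lambda>n. s n + t n))"

definition fock_scale :: "real \<Rightarrow> complex \<Rightarrow> 'a::real_inner fock_vec \<Rightarrow> 'a fock_vec" where
  "fock_scale q c x = (\<Union>s\<in>x. fock_cls q (\<lambda>n. c *\<^sub>C s n))"

definition fock_inner ::
    "real \<Rightarrow> 'a::real_inner fock_vec \<Rightarrow> 'a fock_vec \<Rightarrow> complex" where
  "fock_inner q x y =
     (THE z. \<forall>s\<in>x. \<forall>t\<in>y. (\<lambda>n. q_inner q (s n) (t n)) \<longlonglongrightarrow> z)"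

definition fvec :: "real \<Rightarrow> 'a::real_inner ptens \<Rightarrow> 'a fock_vec" where
  "fvec q \<xi> = fock_cls q (\<lambda>_. \<xi>)"

definition fock_dense :: "real \<Rightarrow> 'a::real_inner fock_vec set" where
  "fock_dense q = fvec q ` TP"

definition dense_operator ::
    "real \<Rightarrow> ('a::real_inner fock_vec \<Rightarrow> 'a fock_vec) \<Rightarrow> bool" where
  "dense_operator q A \<longleftrightarrow>
     A ` fock_dense q \<subseteq> fock_dense q \<and>
     (\<forall>x\<in>fock_dense q. \<forall>y\<in>fock_dense q. A (fock_add q x y) = fock_add q (A x) (A y)) \<and>
     (\<forall>c. \<forall>x\<in>fock_dense q. A (fock_scale q c x) = fock_scale q c (A x))"

definition adjoint_operators ::
    "real \<Rightarrow> ('a::real_inner fock_vec \<Rightarrow> 'a fock_vec) \<Rightarrow>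
      ('a fock_vec \<Rightarrow> 'a fock_vec) \<Rightarrow> bool" where
  "adjoint_operators q A B \<longleftrightarrow>
     (\<forall>x\<in>fock_dense q. \<forall>y\<in>fock_dense q.
        fock_inner q (A x) y = fock_inner q x (B y) \<and>
        fock_inner q (B x) y = fock_inner q x (A y))"

definition has_distribution ::
    "real \<Rightarrow> 'a::real_inner ptens \<Rightarrow> real measure \<Rightarrow> bool" where
  "has_distribution q A M \<longleftrightarrow>
     A \<in> TP \<and> tadj q A = A \<and> prob_space M \<and> sets M = sets borel \<and>
     (\<forall>m. integrable M (\<lambda>x. x ^ m) \<and>
          phi (tpow q A m) = of_real (\<integral>x. x ^ m \<partial>M))"

text \<open>The Gaussian law with mean \<open>\<mu>\<close> and standard deviation \<open>\<sigma>\<close>; a point mass if \<open>\<sigma> = 0\<close>.\<close>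

definition gaussian :: "real \<Rightarrow> real \<Rightarrow> real measure" where
  "gaussian \<mu> \<sigma> =
     (if \<sigma> = 0 then return borel \<mu> else density lborel (\<lambda>x. ennreal (normal_density \<mu> \<sigma> x)))"

end

theory Submission
  imports Defs
begin

text \<open>The theorem combines an exact identity between unsymmetrised tensors with a soft argument about
  the completion.

  Creation appends \<open>h\<close>, \<open>\<alpha> \<otimes> F \<mapsto> \<alpha> \<otimes> (F \<otimes> h)\<close>; annihilation removes a slot \<open>k\<close> of \<open>F\<close> by pairing it with
  \<open>h\<close> and the point \<open>k\<close> of \<open>\<alpha>\<close> by passing to first returns, with weight \<open>1\<close> if \<open>k\<close> is a fixed point of
  \<open>\<alpha>\<close> and \<open>q\<close> otherwise. The product of the algebra is concatenation in the coordinates given by \<open>T\<close>,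
  so right multiplication by \<open>W((0)(1) \<otimes> h)\<close> is \<open>T\<close> after creation after the inverse of \<open>T\<close>. In
  \<open>T(\<alpha> \<otimes> (F \<otimes> h))\<close> a pair partition of \<open>[n + 1]\<close> either leaves \<open>n + 1\<close> single or pairs it with a
  singleton \<open>k\<close> of a pair partition \<open>\<pi>\<close> of \<open>[n]\<close>. Points can be deleted from a permutation in stages, and
  deleting one point loses a cycle exactly when the point is fixed; hence contracting with the second
  kind of partition is contracting with \<open>\<pi>\<close> and then annihilating the slot \<open>k\<close>, powers of \<open>q\<close>
  included. This is the decomposition on tensors (\<open>paired_top\<close>, \<open>T_raw_creat\<close>). The inverse of \<open>T\<close>
  exists because \<open>T\<close> is the identity plus terms of lower degree, and \<open>T\<close> does not see symmetrisation
  because relabelling the slots only permutes the pair partitions (\<open>Tmap_conj\<close>, \<open>Tmap_diff_below\<close>).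

  Creation and annihilation are adjoint on tensors: the sum over \<open>S(n + 1)\<close> in the inner product
  is split according to the slot that is matched with \<open>h\<close> (\<open>kern_creat\<close>, \<open>q_inner_creat\<close>). For
  \<open>q = \<plusminus>1/N\<close> the inner product is positive: \<open>N\<close> to the number of cycles counts the colourings with
  \<open>N\<close> colours that are constant on cycles, which exhibits \<open>\<chi>\<^sub>q\<close> as a trace (twisted by the sign if
  \<open>q < 0\<close>) and the inner product as a Gram matrix (\<open>kern_q_gram\<close>). By the Cauchy-Schwarz inequality, maps
  that have an adjoint preserve vectors of norm zero, and symmetrisation changes a tensor by a vector
  of norm zero. So the identities on tensors descend to the Fock space although creation and
  annihilation are applied to unsymmetrised representatives.

  On the tensors \<open>id \<otimes> h\<^sup>m\<close> creation and annihilation act like the two terms of the recurrence of the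
  Hermite polynomials of variance \<open>\<parallel>h\<parallel>\<^sup>2\<close>. The vacuum coefficient of the \<open>m\<close>-th power is therefore the
  \<open>m\<close>-th moment of the Gaussian law (\<open>T_raw_field_power\<close>, \<open>gaussian_moments\<close>).\<close>

section \<open>First-return permutations\<close>

text \<open>The excursion into \<open>X\<close> that starts at \<open>y\<close> leaves \<open>X\<close> at \<open>z\<close>. Rule induction over excursions
  replaces reasoning about return times.\<close>

inductive first_exit :: "nat set \<Rightarrow> (nat \<Rightarrow> nat) \<Rightarrow> nat \<Rightarrow> nat \<Rightarrow> bool" for X \<alpha> where
  stop: "y \<notin> X \<Longrightarrow> first_exit X \<alpha> y y"
| pass: "y \<in> X \<Longrightarrow> first_exit X \<alpha> (\<alpha> y) z \<Longrightarrow> first_exit X \<alpha> y z"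

lemma first_exit_funpow:
  "first_exit X \<alpha> y z \<Longrightarrow> \<exists>m. z = (\<alpha> ^^ m) y \<and> z \<notin> X \<and> (\<forall>j<m. (\<alpha> ^^ j) y \<in> X)"
proof (induction rule: first_exit.induct)
  case (stop y)
  then show ?case by (intro exI[of _ 0]) auto
next
  case (pass y z)
  then obtain m where m: "z = (\<alpha> ^^ m) (\<alpha> y)" "z \<notin> X" "\<forall>j<m. (\<alpha> ^^ j) (\<alpha> y) \<in> X"
    by blast
  have "(\<alpha> ^^ j) y \<in> X" if "j < Suc m" for j
    using that m(3) pass(1) by (cases j) (auto simp: funpow_swap1)
  with m show ?case
    by (intro exI[of _ "Suc m"]) (auto simp: funpow_swap1)
qed

lemma perm_del_eqI:
  assumes "x \<notin> X" "first_exit X \<alpha> (\<alpha> x) z"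
  shows "perm_del X \<alpha> x = z"
proof -
  obtain m where m: "z = (\<alpha> ^^ m) (\<alpha> x)" "z \<notin> X" "\<forall>j<m. (\<alpha> ^^ j) (\<alpha> x) \<in> X"
    using first_exit_funpow[OF assms(2)] by blast
  have "(LEAST j. 0 < j \<and> (\<alpha> ^^ j) x \<notin> X) = Suc m"
  proof (rule Least_equality)
    show "0 < Suc m \<and> (\<alpha> ^^ Suc m) x \<notin> X"
      using m by (simp add: funpow_swap1)
  next
    fix j assume j: "0 < j \<and> (\<alpha> ^^ j) x \<notin> X"
    then obtain i where i: "j = Suc i" by (cases j) auto
    then have "(\<alpha> ^^ i) (\<alpha> x) \<notin> X" using j by (simp add: funpow_swap1)
    then have "\<not> i < m" using m(3) by blast
    then show "Suc m \<le> j" using i by simp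
  qed
  then show ?thesis
    using assms(1) m by (simp add: perm_del_def funpow_swap1)
qed

lemma first_exit_exists: "(\<alpha> ^^ m) y \<notin> X \<Longrightarrow> \<exists>z. first_exit X \<alpha> y z"
proof (induction m arbitrary: y)
  case 0
  then show ?case by (auto intro: first_exit.stop)
next
  case (Suc m)
  from Suc.prems have "(\<alpha> ^^ m) (\<alpha> y) \<notin> X" by (simp add: funpow_swap1)
  then show ?case using Suc.IH[of "\<alpha> y"] by (metis first_exit.pass first_exit.stop)
qed

lemma perm_del_first_exit:
  assumes "\<alpha> permutes A" "finite A" "x \<notin> X"
  shows "first_exit X \<alpha> (\<alpha> x) (perm_del X \<alpha> x)"
proof -
  have "permutation \<alpha>" using assms by (auto simp: permutation_permutes)
  then have "x \<in> orbit \<alpha> x" by (rule permutation_self_in_orbit)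
  then obtain n where n: "0 < n" "(\<alpha> ^^ n) x = x" unfolding orbit_altdef by auto
  then obtain m where "n = Suc m" by (cases n) auto
  then have "(\<alpha> ^^ m) (\<alpha> x) \<notin> X" using n assms(3) by (simp add: funpow_swap1)
  then obtain z where "first_exit X \<alpha> (\<alpha> x) z" using first_exit_exists by blast
  then show ?thesis using perm_del_eqI[OF assms(3)] by metis
qed

lemma perm_del_in: "x \<in> X \<Longrightarrow> perm_del X \<alpha> x = x"
  by (simp add: perm_del_def)

lemma perm_del_outside: "x \<notin> X \<Longrightarrow> \<alpha> x \<notin> X \<Longrightarrow> perm_del X \<alpha> x = \<alpha> x"
  by (rule perm_del_eqI) (auto intro: first_exit.stop)

lemma perm_del_empty [simp]: "perm_del {} \<alpha> = \<alpha>"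
  by (rule ext) (simp add: perm_del_outside)

text \<open>As a product with a transposition, the deletion of one point is compatible with signs, inverses and
  products, and deletions of several points reduce to it.\<close>

lemma perm_del_single:
  assumes "inj \<alpha>"
  shows "perm_del {x} \<alpha> = Transposition.transpose x (\<alpha> x) \<circ> \<alpha>"
proof
  fix y
  consider "y = x" | "y \<noteq> x" "\<alpha> y \<noteq> x" | "y \<noteq> x" "\<alpha> y = x" by blast
  then show "perm_del {x} \<alpha> y = (Transposition.transpose x (\<alpha> x) \<circ> \<alpha>) y"
  proof cases
    case 1
    then show ?thesis by (simp add: perm_del_in)
  next
    case 2
    have "\<alpha> y \<noteq> \<alpha> x" using 2 assms by (auto dest: injD)
    then show ?thesis using 2 by (simp add: perm_del_outside)
  next
    case 3
    have "\<alpha> x \<noteq> x" using 3 injD[OF assms, of y x] by auto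
    then have "first_exit {x} \<alpha> (\<alpha> y) (\<alpha> x)"
      using 3 by (intro first_exit.pass[of "\<alpha> y"]) (auto intro: first_exit.stop)
    then have "perm_del {x} \<alpha> y = \<alpha> x" using 3 by (intro perm_del_eqI) auto
    then show ?thesis using 3 by simp
  qed
qed

lemma perm_del_single_apply:
  assumes "inj \<alpha>"
  shows "perm_del {x} \<alpha> z = (if z = x then x else if \<alpha> z = x then \<alpha> x else \<alpha> z)"
  using injD[OF assms, of z x] by (auto simp: perm_del_single[OF assms] Transposition.transpose_def)

lemma perm_del_single_permutes:
  assumes "\<alpha> permutes A"
  shows "perm_del {x} \<alpha> permutes (A - {x})"
proof (cases "x \<in> A")
  case True
  have "Transposition.transpose x (\<alpha> x) permutes A"
    using True assms by (intro permutes_swap_id) (simp_all add: permutes_in_image)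
  then have "perm_del {x} \<alpha> permutes A"
    unfolding perm_del_single[OF permutes_inj[OF assms]]
    by (intro permutes_compose[OF assms])
  moreover have "perm_del {x} \<alpha> x = x" by (simp add: perm_del_in)
  ultimately show ?thesis by (auto intro: permutes_superset[of _ A])
next
  case False
  then have "\<alpha> x = x" using assms by (simp add: permutes_not_in)
  then show ?thesis
    using False assms by (simp add: perm_del_single[OF permutes_inj[OF assms]])
qed

lemma first_exit_trans:
  assumes "first_exit X \<alpha> y w" "first_exit (X \<union> Y) \<alpha> w z"
  shows "first_exit (X \<union> Y) \<alpha> y z"
  using assms
proof induction
  case (pass y z)
  then show ?case by (metis UnI1 first_exit.pass)
qed simp

text \<open>A first return to the complement of \<open>X \<union> Y\<close> is a chain of first returns to the complement
  of \<open>X\<close> that runs through \<open>Y\<close>.\<close>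

lemma perm_del_Un:
  assumes \<alpha>: "\<alpha> permutes A" "finite A"
    and \<delta>: "perm_del X \<alpha> permutes B" "finite B"
  shows "perm_del (X \<union> Y) \<alpha> = perm_del Y (perm_del X \<alpha>)"
proof
  fix x
  let ?\<delta> = "perm_del X \<alpha>"
  have chain: "first_exit Y ?\<delta> w z \<Longrightarrow> w \<notin> X \<Longrightarrow> first_exit (X \<union> Y) \<alpha> w z" for w z
  proof (induction rule: first_exit.induct)
    case (stop y)
    then show ?case by (intro first_exit.stop) auto
  next
    case (pass y z)
    have fe: "first_exit X \<alpha> (\<alpha> y) (?\<delta> y)" by (rule perm_del_first_exit[OF \<alpha> pass.prems])
    then have "?\<delta> y \<notin> X" using first_exit_funpow by blast
    with pass.IH have "first_exit (X \<union> Y) \<alpha> (?\<delta> y) z" by blast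
    with fe have "first_exit (X \<union> Y) \<alpha> (\<alpha> y) z" by (rule first_exit_trans)
    then show ?case using pass.hyps by (intro first_exit.pass[of y]) auto
  qed
  show "perm_del (X \<union> Y) \<alpha> x = perm_del Y ?\<delta> x"
  proof (cases "x \<in> X \<union> Y")
    case True
    then consider "x \<in> Y" | "x \<in> X" "x \<notin> Y" by blast
    then show ?thesis
      using True by cases (auto simp: perm_del_in perm_del_outside)
  next
    case False
    have fe: "first_exit X \<alpha> (\<alpha> x) (?\<delta> x)" using False by (intro perm_del_first_exit[OF \<alpha>]) auto
    then have "?\<delta> x \<notin> X" using first_exit_funpow by blast
    moreover have "first_exit Y ?\<delta> (?\<delta> x) (perm_del Y ?\<delta> x)"
      using False by (intro perm_del_first_exit[OF \<delta>]) auto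
    ultimately have "first_exit (X \<union> Y) \<alpha> (?\<delta> x) (perm_del Y ?\<delta> x)" using chain by blast
    then show ?thesis using fe False
      by (intro perm_del_eqI) (auto intro: first_exit_trans)
  qed
qed

lemma perm_del_permutes:
  assumes "finite X" "\<alpha> permutes A" "finite A"
  shows "perm_del X \<alpha> permutes (A - X)"
  using assms(1)
proof induction
  case empty
  then show ?case using assms by simp
next
  case (insert x X)
  have "perm_del (X \<union> {x}) \<alpha> = perm_del {x} (perm_del X \<alpha>)"
    using insert assms by (intro perm_del_Un[where A = A and B = "A - X"]) auto
  moreover have "perm_del {x} (perm_del X \<alpha>) permutes (A - X - {x})"
    using insert by (intro perm_del_single_permutes)
  moreover have "X \<union> {x} = insert x X" "A - X - {x} = A - insert x X" by auto
  ultimately show ?case by simp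
qed

lemma perm_del_conj:
  assumes \<alpha>: "\<alpha> permutes A" "finite A" and \<sigma>: "bij \<sigma>"
  shows "perm_del (\<sigma> ` X) (\<sigma> \<circ> \<alpha> \<circ> inv \<sigma>) = \<sigma> \<circ> perm_del X \<alpha> \<circ> inv \<sigma>"
proof
  fix y
  define x where "x = inv \<sigma> y"
  have y: "y = \<sigma> x" using \<sigma> by (simp add: x_def bij_is_surj surj_f_inv_f)
  have inv: "inv \<sigma> (\<sigma> z) = z" for z using \<sigma> by (simp add: bij_is_inj)
  have mem: "\<sigma> z \<in> \<sigma> ` X \<longleftrightarrow> z \<in> X" for z
    using \<sigma> by (simp add: bij_is_inj inj_image_mem_iff)
  have fe: "first_exit X \<alpha> y z \<Longrightarrow> first_exit (\<sigma> ` X) (\<sigma> \<circ> \<alpha> \<circ> inv \<sigma>) (\<sigma> y) (\<sigma> z)" for y z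
  proof (induction rule: first_exit.induct)
    case (stop y)
    then show ?case by (intro first_exit.stop) (simp add: mem)
  next
    case (pass y z)
    then show ?case by (intro first_exit.pass[of "\<sigma> y"]) (simp_all add: mem inv)
  qed
  show "perm_del (\<sigma> ` X) (\<sigma> \<circ> \<alpha> \<circ> inv \<sigma>) y = (\<sigma> \<circ> perm_del X \<alpha> \<circ> inv \<sigma>) y"
  proof (cases "x \<in> X")
    case True
    then show ?thesis by (simp add: y inv perm_del_in mem)
  next
    case False
    then show ?thesis
      using fe[OF perm_del_first_exit[OF \<alpha> False]]
      by (intro perm_del_eqI) (simp_all add: y inv mem)
  qed
qed

text \<open>Left multiplication by a permutation that is trivial on \<open>X\<close> does not change the
  excursions into \<open>X\<close>.\<close>

lemma perm_del_comp_left: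
  assumes \<alpha>: "\<alpha> permutes A" "finite A" and \<tau>: "inj \<tau>" "\<And>x. x \<in> X \<Longrightarrow> \<tau> x = x"
  shows "perm_del X (\<tau> \<circ> \<alpha>) = \<tau> \<circ> perm_del X \<alpha>"
proof
  fix x
  have fe: "first_exit X \<alpha> y z \<Longrightarrow> first_exit X (\<tau> \<circ> \<alpha>) (\<tau> y) (\<tau> z)" for y z
  proof (induction rule: first_exit.induct)
    case (stop y)
    then have "\<tau> y \<notin> X" using \<tau>(2)[of "\<tau> y"] injD[OF \<tau>(1), of "\<tau> y" y] by auto
    then show ?case by (intro first_exit.stop)
  next
    case (pass y z)
    then show ?case by (intro first_exit.pass[of "\<tau> y"]) (simp_all add: \<tau>)
  qed
  show "perm_del X (\<tau> \<circ> \<alpha>) x = (\<tau> \<circ> perm_del X \<alpha>) x"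
  proof (cases "x \<in> X")
    case True
    then show ?thesis by (simp add: perm_del_in \<tau>)
  next
    case False
    show ?thesis
      using fe[OF perm_del_first_exit[OF \<alpha> False]] False
      by (intro perm_del_eqI) simp_all
  qed
qed

lemma perm_del_comp_fix:
  assumes "inj \<alpha>" "inj \<gamma>" "\<alpha> x = x"
  shows "perm_del {x} (\<alpha> \<circ> \<gamma>) = \<alpha> \<circ> perm_del {x} \<gamma>"
proof
  fix y
  have "inj (\<alpha> \<circ> \<gamma>)" using assms by (simp add: inj_compose)
  then show "perm_del {x} (\<alpha> \<circ> \<gamma>) y = (\<alpha> \<circ> perm_del {x} \<gamma>) y"
    using assms injD[OF assms(1), of "\<gamma> y" x] injD[OF assms(1), of "\<gamma> x" x]
    by (auto simp: perm_del_single_apply)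
qed

lemma perm_del_comp_fix_right:
  assumes "inj \<alpha>" "inj \<gamma>" "\<alpha> x = x"
  shows "perm_del {x} (\<gamma> \<circ> \<alpha>) = perm_del {x} \<gamma> \<circ> \<alpha>"
proof
  fix y
  have "inj (\<gamma> \<circ> \<alpha>)" using assms by (simp add: inj_compose)
  then show "perm_del {x} (\<gamma> \<circ> \<alpha>) y = (perm_del {x} \<gamma> \<circ> \<alpha>) y"
    using assms injD[OF assms(1), of y x] by (auto simp: perm_del_single_apply)
qed

lemma perm_del_inv:
  assumes "bij \<gamma>"
  shows "perm_del {x} (inv \<gamma>) = inv (perm_del {x} \<gamma>)"
proof -
  have b: "inj \<gamma>" "inj (inv \<gamma>)" "bij (inv \<gamma>)"
    using assms by (simp_all add: bij_is_inj bij_imp_bij_inv)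
  have i: "inv \<gamma> (\<gamma> z) = z" "\<gamma> (inv \<gamma> z) = z" for z
    using assms by (simp_all add: bij_is_inj bij_is_surj surj_f_inv_f)
  have "inv (Transposition.transpose x (\<gamma> x) \<circ> \<gamma>) = inv \<gamma> \<circ> Transposition.transpose x (\<gamma> x)"
    using assms by (simp add: o_inv_distrib)
  moreover have "inv \<gamma> \<circ> Transposition.transpose x (\<gamma> x) = Transposition.transpose x (inv \<gamma> x) \<circ> inv \<gamma>"
  proof
    fix y
    have "inv \<gamma> y = inv \<gamma> z \<longleftrightarrow> y = z" for z using b(2) by (auto dest: injD)
    from this[of x] this[of "\<gamma> x"]
    show "(inv \<gamma> \<circ> Transposition.transpose x (\<gamma> x)) y = (Transposition.transpose x (inv \<gamma> x) \<circ> inv \<gamma>) y"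
      by (auto simp: Transposition.transpose_def i)
  qed
  ultimately show ?thesis by (simp add: perm_del_single b)
qed

section \<open>Counting cycles\<close>

lemma orbit_perm_del_single:
  assumes "\<alpha> permutes A" "finite A" "y \<noteq> x"
  shows "orbit (perm_del {x} \<alpha>) y = orbit \<alpha> y - {x}"
proof
  let ?\<beta> = "perm_del {x} \<alpha>"
  have inj: "inj \<alpha>" using assms by (simp add: permutes_inj)
  have \<beta>: "?\<beta> z = (if z = x then x else if \<alpha> z = x then \<alpha> x else \<alpha> z)" for z
    using inj by (rule perm_del_single_apply)
  have nx: "\<alpha> z = x \<Longrightarrow> z \<noteq> x \<Longrightarrow> \<alpha> x \<noteq> x" for z using injD[OF inj, of z x] by auto
  show "orbit ?\<beta> y \<subseteq> orbit \<alpha> y - {x}"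
  proof
    fix z assume "z \<in> orbit ?\<beta> y"
    then show "z \<in> orbit \<alpha> y - {x}"
    proof induction
      case base
      show ?case
      proof (cases "\<alpha> y = x")
        case True
        then have "\<alpha> x \<in> orbit \<alpha> y" by (metis orbit.base orbit.step)
        then show ?thesis using True nx assms(3) by (auto simp: \<beta>)
      qed (use assms(3) in \<open>auto simp: \<beta> intro: orbit.base\<close>)
    next
      case (step z)
      show ?case
      proof (cases "\<alpha> z = x")
        case True
        then have "\<alpha> x \<in> orbit \<alpha> y" using step by (metis Diff_iff orbit.step)
        then show ?thesis using True nx step by (auto simp: \<beta>)
      qed (use step in \<open>auto simp: \<beta> intro: orbit.step\<close>)
    qed
  qed
  have "if z = x then \<alpha> x = x \<or> \<alpha> x \<in> orbit ?\<beta> y else z \<in> orbit ?\<beta> y" if "z \<in> orbit \<alpha> y" for z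
    using that
  proof induction
    case base
    show ?case using orbit.base[of ?\<beta> y] \<beta>[of y] assms(3) by (auto split: if_splits)
  next
    case (step z)
    then show ?case using orbit.step[of z ?\<beta> y] \<beta>[of z] by (auto split: if_splits)
  qed
  then show "orbit \<alpha> y - {x} \<subseteq> orbit ?\<beta> y" by (metis Diff_iff singletonI subsetI)
qed

lemma orbit_eq_or_disjoint:
  assumes "permutation \<alpha>" "z \<in> orbit \<alpha> y" "z \<in> orbit \<alpha> y'"
  shows "orbit \<alpha> y = orbit \<alpha> y'"
  using assms by (metis orbit_cyclic_eq3 cyclic_on_orbit')

text \<open>A cycle loses the deleted point and survives, unless it consists of that point alone.\<close>

lemma cyc0_del:
  assumes \<alpha>: "\<alpha> permutes A" and fin: "finite A" and x: "x \<in> A" "x \<noteq> 0"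
  shows "cyc0 A \<alpha> = cyc0 (A - {x}) (perm_del {x} \<alpha>) + (if \<alpha> x = x then 1 else 0)"
proof -
  let ?\<beta> = "perm_del {x} \<alpha>"
  have perm: "permutation \<alpha>" using \<alpha> fin by (auto simp: permutation_permutes)
  have orb: "orbit ?\<beta> y = orbit \<alpha> y - {x}" if "y \<noteq> x" for y
    using orbit_perm_del_single[OF \<alpha> fin that] .
  let ?C = "{c \<in> orbit \<alpha> ` A. 0 \<notin> c}" and ?D = "{c \<in> orbit ?\<beta> ` (A - {x}). 0 \<notin> c}"
  have self: "y \<in> orbit \<alpha> y" for y using perm by (rule permutation_self_in_orbit)
  show ?thesis
  proof (cases "\<alpha> x = x")
    case True
    have ox: "orbit \<alpha> x = {x}" using True by (simp add: orbit_eq_singleton_iff)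
    have nin: "x \<notin> orbit \<alpha> y" if "y \<noteq> x" for y
    proof
      assume "x \<in> orbit \<alpha> y"
      then have "orbit \<alpha> x = orbit \<alpha> y" using orbit_eq_or_disjoint[OF perm self] by blast
      then show False using self[of y] ox that by auto
    qed
    have "orbit ?\<beta> ` (A - {x}) = orbit \<alpha> ` (A - {x})"
      using nin by (intro image_cong) (auto simp: orb)
    moreover have "orbit \<alpha> ` A = insert {x} (orbit \<alpha> ` (A - {x}))" using x ox by auto
    ultimately have "?C = insert {x} ?D" using x by auto
    moreover have "{x} \<notin> ?D" using orb by auto
    moreover have "finite ?D" using fin by simp
    ultimately show ?thesis using True by (simp add: cyc0_def)
  next
    case False
    have ex: "\<exists>y\<in>A - {x}. orbit \<alpha> x = orbit \<alpha> y"
      using False x \<alpha> by (intro bexI[of _ "\<alpha> x"])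
        (auto simp: permutes_in_image perm intro!: orbit_eq_or_disjoint[OF perm orbit.base]
          self)
    then have im: "orbit \<alpha> ` A = orbit \<alpha> ` (A - {x})" by auto
    have ne: "\<exists>w. w \<in> orbit \<alpha> y \<and> w \<noteq> x" if "y \<noteq> x" for y using self that by blast
    have "?D = (\<lambda>c. c - {x}) ` ?C"
      unfolding im using x by (auto simp: orb image_iff)
    moreover have "inj_on (\<lambda>c. c - {x}) ?C"
    proof (rule inj_onI)
      fix c d assume "c \<in> ?C" "d \<in> ?C" and eq: "c - {x} = d - {x}"
      then obtain y z where yz: "c = orbit \<alpha> y" "d = orbit \<alpha> z" "y \<noteq> x" "z \<noteq> x"
        unfolding im by auto
      then have "y \<in> d" using eq self[of y] by auto
      then show "c = d" using yz orbit_eq_or_disjoint[OF perm self[of y]] by auto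
    qed
    ultimately have "card ?D = card ?C" by (simp add: card_image)
    then show ?thesis using False by (simp add: cyc0_def)
  qed
qed

lemma cyc0_conj:
  assumes \<sigma>: "bij \<sigma>" "\<sigma> 0 = 0"
  shows "cyc0 (\<sigma> ` A) (\<sigma> \<circ> \<alpha> \<circ> inv \<sigma>) = cyc0 A \<alpha>"
proof -
  have inv: "inv \<sigma> (\<sigma> z) = z" for z using \<sigma> by (simp add: bij_is_inj)
  have pow: "((\<sigma> \<circ> \<alpha> \<circ> inv \<sigma>) ^^ n) (\<sigma> y) = \<sigma> ((\<alpha> ^^ n) y)" for n y
    by (induction n) (simp_all add: inv)
  have orb: "orbit (\<sigma> \<circ> \<alpha> \<circ> inv \<sigma>) (\<sigma> y) = \<sigma> ` orbit \<alpha> y" for y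
    unfolding orbit_altdef by (auto simp: pow)
  have mem: "0 \<in> \<sigma> ` c \<longleftrightarrow> 0 \<in> c" for c
    using \<sigma> by (metis bij_is_inj inj_image_mem_iff)
  then have mem': "\<sigma> x = 0 \<longleftrightarrow> x = 0" for x using \<sigma> by (metis inv)
  have "{c \<in> orbit (\<sigma> \<circ> \<alpha> \<circ> inv \<sigma>) ` \<sigma> ` A. 0 \<notin> c} = (`) \<sigma> ` {c \<in> orbit \<alpha> ` A. 0 \<notin> c}"
    by (auto simp: orb image_image mem')
  moreover have "inj ((`) \<sigma>)" by (rule injI) (use \<sigma> in \<open>simp add: bij_is_inj inj_image_eq_iff\<close>)
  ultimately show ?thesis
    by (simp add: cyc0_def card_image inj_on_subset)
qed

text \<open>Deleting points other than \<open>0\<close> ends with the trivial permutation of \<open>{0}\<close>. The cycle count, the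
  sign and the number of invariant colourings change in a controlled way at each step.\<close>

lemma permutes_zero_induct [consumes 3, case_names base step]:
  assumes "finite A" "0 \<in> A" "\<alpha> permutes A"
    and "P {0} id"
    and "\<And>A x \<alpha>. \<lbrakk>finite A; 0 \<in> A; x \<in> A; x \<noteq> 0; \<alpha> permutes A;
          P (A - {x}) (perm_del {x} \<alpha>)\<rbrakk> \<Longrightarrow> P A \<alpha>"
  shows "P A \<alpha>"
  using assms(1-3)
proof (induction "card A" arbitrary: A \<alpha> rule: less_induct)
  case less
  show ?case
  proof (cases "A = {0}")
    case True
    then show ?thesis using less.prems assms(4) by simp
  next
    case False
    then obtain x where x: "x \<in> A" "x \<noteq> 0" using less.prems by auto
    then have "card (A - {x}) < card A" using less.prems by (intro card_Diff1_less) auto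
    then have "P (A - {x}) (perm_del {x} \<alpha>)"
      using less.prems x by (intro less.hyps) (auto intro: perm_del_single_permutes)
    then show ?thesis by (intro assms(5)[OF less.prems(1,2) x less.prems(3)])
  qed
qed

lemma cyc0_singleton [simp]: "cyc0 {0} (\<lambda>x. x) = 0"
proof -
  have "(0::nat) \<in> orbit (\<lambda>x. x) 0" by (rule permutation_self_in_orbit) simp
  then show ?thesis by (simp add: cyc0_def)
qed

lemma cyc0_less:
  assumes "finite A" "0 \<in> A" "\<alpha> permutes A"
  shows "cyc0 A \<alpha> < card A"
  using assms
proof (induction rule: permutes_zero_induct)
  case base
  then show ?case by (simp add: id_def)
next
  case (step A x \<alpha>)
  moreover have "card A = Suc (card (A - {x}))" using step by (metis card_Suc_Diff1)
  ultimately show ?case by (auto simp: cyc0_del[of \<alpha> A x] simp del: card_Diff_insert)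
qed

lemma sign_cyc0:
  assumes "finite A" "0 \<in> A" "\<alpha> permutes A"
  shows "sign \<alpha> = (- 1) ^ (card A - 1 - cyc0 A \<alpha>)"
  using assms
proof (induction rule: permutes_zero_induct)
  case base
  then show ?case by (simp add: id_def)
next
  case (step A x \<alpha>)
  have perm: "permutation \<alpha>" using step by (auto simp: permutation_permutes)
  have "sign (perm_del {x} \<alpha>) = sign (Transposition.transpose x (\<alpha> x)) * sign \<alpha>"
    using step perm by (simp add: perm_del_single permutes_inj sign_compose permutation_swap_id)
  then have s: "sign \<alpha> = (if \<alpha> x = x then 1 else - 1) * sign (perm_del {x} \<alpha>)"
    by (simp add: sign_swap_id)
  have del: "perm_del {x} \<alpha> permutes A - {x}" using step by (intro perm_del_single_permutes)
  have "cyc0 (A - {x}) (perm_del {x} \<alpha>) < card (A - {x})"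
    using step del by (intro cyc0_less) auto
  moreover have "card A = Suc (card (A - {x}))" using step by (metis card_Suc_Diff1)
  ultimately show ?case
    using step
    by (auto simp: s cyc0_del[of \<alpha> A x] Suc_diff_Suc[symmetric] simp del: card_Diff_insert)
qed

text \<open>Colourings are the basis vectors of a tensor power of \<open>\<complex>\<^sup>N\<close>, and the colour of the point \<open>0\<close> is
  prescribed because cycles through \<open>0\<close> are not counted.\<close>

definition colourings :: "nat \<Rightarrow> nat set \<Rightarrow> (nat \<Rightarrow> nat) set" where
  "colourings N A = {c \<in> A \<rightarrow>\<^sub>E {..<N}. c 0 = 0}"

lemma finite_colourings: "finite A \<Longrightarrow> finite (colourings N A)"
  unfolding colourings_def by (rule finite_subset[OF _ finite_PiE[of A "\<lambda>_. {..<N}"]]) auto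

text \<open>A colouring that is constant on the cycles and has a prescribed colour on the cycle of
  \<open>0\<close> is a free choice of a colour for each of the other cycles.\<close>

lemma card_invariant_colourings:
  assumes "finite A" "0 \<in> A" "\<alpha> permutes A" and N: "0 < N"
  shows "card {c \<in> colourings N A. \<forall>y\<in>A. c (\<alpha> y) = c y} = N ^ cyc0 A \<alpha>"
  using assms(1-3)
proof (induction rule: permutes_zero_induct)
  case base
  have "{c \<in> colourings N {0}. \<forall>y\<in>{0}. c (id y) = c y} = {\<lambda>x\<in>{0}. 0}"
    using N by (auto simp: colourings_def PiE_iff extensional_def)
  then show ?case by (simp add: id_def del: One_nat_def)
next
  case (step A x \<alpha>)
  let ?\<beta> = "perm_del {x} \<alpha>"
  let ?C = "{c \<in> colourings N A. \<forall>y\<in>A. c (\<alpha> y) = c y}"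
  let ?D = "{c \<in> colourings N (A - {x}). \<forall>y\<in>A - {x}. c (?\<beta> y) = c y}"
  have inj: "inj \<alpha>" using step by (simp add: permutes_inj)
  have in_A: "\<alpha> y \<in> A" if "y \<in> A" for y using step that by (simp add: permutes_in_image)
  have \<beta>: "?\<beta> z = (if z = x then x else if \<alpha> z = x then \<alpha> x else \<alpha> z)" for z
    using inj by (rule perm_del_single_apply)
  show ?case
  proof (cases "\<alpha> x = x")
    case True
    have ne: "\<alpha> y \<noteq> x" if "y \<noteq> x" for y using True that injD[OF inj, of y x] by auto
    have "bij_betw (\<lambda>(v, c). c(x := v)) ({..<N} \<times> ?D) ?C"
    proof (rule bij_betw_byWitness[where f' = "\<lambda>c. (c x, restrict c (A - {x}))"])
      show "\<forall>a\<in>{..<N} \<times> ?D.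
          (\<lambda>c. (c x, restrict c (A - {x}))) ((\<lambda>(v, c). c(x := v)) a) = a"
        by (auto simp: colourings_def PiE_iff extensional_def fun_eq_iff)
      show "\<forall>a'\<in>?C. (\<lambda>(v, c). c(x := v)) ((\<lambda>c. (c x, restrict c (A - {x}))) a') = a'"
        by (auto simp: colourings_def PiE_iff extensional_def fun_eq_iff)
      show "(\<lambda>(v, c). c(x := v)) ` ({..<N} \<times> ?D) \<subseteq> ?C"
        using step.hyps True ne by (auto simp: colourings_def PiE_iff extensional_def \<beta>)
      show "(\<lambda>c. (c x, restrict c (A - {x}))) ` ?C \<subseteq> {..<N} \<times> ?D"
      proof (rule image_subsetI)
        fix c assume c: "c \<in> ?C"
        then have "c x < N" using step.hyps by (auto simp: colourings_def PiE_iff)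
        moreover have "restrict c (A - {x}) \<in> colourings N (A - {x})"
          using c step.hyps by (auto simp: colourings_def)
        moreover have "restrict c (A - {x}) (?\<beta> y) = restrict c (A - {x}) y" if "y \<in> A - {x}" for y
          using c that ne[of y] in_A[of y] by (auto simp: \<beta>)
        ultimately show "(c x, restrict c (A - {x})) \<in> {..<N} \<times> ?D" by simp
      qed
    qed
    then have "card ?C = card ({..<N} \<times> ?D)" by (rule bij_betw_same_card[symmetric])
    then have "card ?C = N * card ?D" by (simp only: card_cartesian_product card_lessThan)
    then show ?thesis using step True by (simp add: cyc0_del[of \<alpha> A x])
  next
    case False
    have "bij_betw (\<lambda>c. c(x := c (\<alpha> x))) ?D ?C"
    proof (rule bij_betw_byWitness[where f' = "\<lambda>c. restrict c (A - {x})"])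
      show "\<forall>c\<in>?D. restrict (c(x := c (\<alpha> x))) (A - {x}) = c"
        by (auto simp: colourings_def PiE_iff extensional_def fun_eq_iff)
      show "\<forall>c\<in>?C. (restrict c (A - {x}))(x := restrict c (A - {x}) (\<alpha> x)) = c"
        using step False in_A by (auto simp: colourings_def PiE_iff extensional_def fun_eq_iff)
      show "(\<lambda>c. c(x := c (\<alpha> x))) ` ?D \<subseteq> ?C"
      proof (rule image_subsetI)
        fix c assume c: "c \<in> ?D"
        then have inv: "c (?\<beta> y) = c y" if "y \<in> A - {x}" for y using that by blast
        have "(c(x := c (\<alpha> x))) (\<alpha> y) = (c(x := c (\<alpha> x))) y" if "y \<in> A" for y
          using inv[of y] that False by (auto simp: \<beta>)
        moreover have "c(x := c (\<alpha> x)) \<in> colourings N A"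
          using c step False in_A by (auto simp: colourings_def PiE_iff extensional_def)
        ultimately show "c(x := c (\<alpha> x)) \<in> ?C" by blast
      qed
      show "(\<lambda>c. restrict c (A - {x})) ` ?C \<subseteq> ?D"
      proof (rule image_subsetI)
        fix c assume c: "c \<in> ?C"
        then have "restrict c (A - {x}) \<in> colourings N (A - {x})"
          using step.hyps by (auto simp: colourings_def)
        moreover have "restrict c (A - {x}) (?\<beta> y) = restrict c (A - {x}) y" if "y \<in> A - {x}" for y
        proof -
          have "c (\<alpha> y) = c y" "c (\<alpha> x) = c x" using c that step.hyps by auto
          then show ?thesis
            using that False in_A[of y] in_A[of x] step.hyps by (auto simp: \<beta>)
        qed
        ultimately show "restrict c (A - {x}) \<in> ?D" by simp
      qed
    qed
    then have "card ?C = card ?D" by (rule bij_betw_same_card[symmetric])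
    then show ?thesis using step False by (simp add: cyc0_del[of \<alpha> A x])
  qed
qed

section \<open>The length function of a permutation\<close>

lemma Sn_permutes: "\<sigma> \<in> Sn n \<Longrightarrow> \<sigma> permutes {1..n}"
  by (simp add: Sn_def)

lemma Sn_subset_S0: "Sn n \<subseteq> S0 n"
  unfolding Sn_def S0_def by (auto intro: permutes_subset)

lemma S0_permutes: "\<alpha> \<in> S0 n \<Longrightarrow> \<alpha> permutes {0..n}"
  by (simp add: S0_def)

lemma S0_bij: "\<alpha> \<in> S0 n \<Longrightarrow> bij \<alpha>"
  unfolding S0_def by (auto intro: permutes_bij)

lemma Sn_bij: "\<sigma> \<in> Sn n \<Longrightarrow> bij \<sigma>"
  unfolding Sn_def by (auto intro: permutes_bij)

lemma Sn_zero: "\<sigma> \<in> Sn n \<Longrightarrow> \<sigma> 0 = 0"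
  unfolding Sn_def by (auto intro: permutes_not_in)

lemma S0_mono: "n \<le> m \<Longrightarrow> S0 n \<subseteq> S0 m"
  unfolding S0_def by (auto intro: permutes_subset)

lemma S0_comp: "\<alpha> \<in> S0 n \<Longrightarrow> \<beta> \<in> S0 n \<Longrightarrow> \<alpha> \<circ> \<beta> \<in> S0 n"
  unfolding S0_def by (auto intro: permutes_compose)

lemma S0_inv: "\<alpha> \<in> S0 n \<Longrightarrow> inv \<alpha> \<in> S0 n"
  unfolding S0_def by (auto intro: permutes_inv)

lemma Sn_comp: "\<alpha> \<in> Sn n \<Longrightarrow> \<beta> \<in> Sn n \<Longrightarrow> \<alpha> \<circ> \<beta> \<in> Sn n"
  unfolding Sn_def by (auto intro: permutes_compose)

lemma Sn_inv: "\<alpha> \<in> Sn n \<Longrightarrow> inv \<alpha> \<in> Sn n"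
  unfolding Sn_def by (auto intro: permutes_inv)

lemma S0_conj: "\<alpha> \<in> S0 n \<Longrightarrow> \<sigma> \<in> Sn n \<Longrightarrow> \<sigma> \<circ> \<alpha> \<circ> inv \<sigma> \<in> S0 n"
  using Sn_subset_S0 by (intro S0_comp S0_inv) auto

lemma Sn_image: "\<sigma> \<in> Sn n \<Longrightarrow> \<sigma> ` {0..n} = {0..n}"
  using Sn_subset_S0 by (auto intro!: permutes_image dest!: S0_permutes)

lemma card_Sn: "card (Sn n) = fact n"
  unfolding Sn_def by (simp add: card_permutations)

lemma inv_comp_assoc: "bij \<sigma> \<Longrightarrow> bij \<tau> \<Longrightarrow>
    \<sigma> \<circ> (\<tau> \<circ> \<alpha> \<circ> inv \<tau>) \<circ> inv \<sigma> = (\<sigma> \<circ> \<tau>) \<circ> \<alpha> \<circ> inv (\<sigma> \<circ> \<tau>)"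
  by (simp add: o_inv_distrib comp_assoc)

lemma Sn_inv_apply: "\<sigma> \<in> Sn n \<Longrightarrow> inv \<sigma> (\<sigma> x) = x" "\<sigma> \<in> Sn n \<Longrightarrow> \<sigma> (inv \<sigma> x) = x"
  unfolding Sn_def by (simp_all add: permutes_inverses)

lemma Sn_in: "\<sigma> \<in> Sn n \<Longrightarrow> \<sigma> i \<in> {1..n} \<longleftrightarrow> i \<in> {1..n}"
  unfolding Sn_def by (simp only: mem_Collect_eq permutes_in_image)

lemma cyc0_le: "\<alpha> \<in> S0 n \<Longrightarrow> cyc0 {0..n} \<alpha> \<le> n"
  using cyc0_less[of "{0..n}" \<alpha>] by (simp add: S0_def)

lemma chi_conj:
  assumes "\<sigma> \<in> Sn n"
  shows "chi q n (\<sigma> \<circ> \<alpha> \<circ> inv \<sigma>) = chi q n \<alpha>"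
  using cyc0_conj[of \<sigma> "{0..n}" \<alpha>] assms
  by (simp add: chi_def perm_len_def Sn_image Sn_bij Sn_zero)

text \<open>Deleting \<open>n + 1\<close> lowers \<open>|\<gamma>|\<close> by one, except when \<open>n + 1\<close> is a cycle of its own, which is then
  lost together with the point. This is the source of the weights \<open>1\<close> and \<open>q\<close> of the annihilation
  operator.\<close>

lemma chi_del:
  assumes "\<gamma> \<in> S0 (Suc n)"
  shows "chi q (Suc n) \<gamma> =
    (if \<gamma> (Suc n) = Suc n then 1 else q) * chi q n (perm_del {Suc n} \<gamma>)"
proof -
  have A: "{0..Suc n} - {Suc n} = {0..n}" by auto
  have "perm_del {Suc n} \<gamma> permutes {0..n}"
    using perm_del_single_permutes[of \<gamma> "{0..Suc n}" "Suc n"] assms by (simp add: S0_def A)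
  then have "cyc0 {0..n} (perm_del {Suc n} \<gamma>) \<le> n" by (intro cyc0_le) (simp add: S0_def)
  moreover have "cyc0 {0..Suc n} \<gamma> = cyc0 {0..n} (perm_del {Suc n} \<gamma>) +
      (if \<gamma> (Suc n) = Suc n then 1 else 0)"
    using cyc0_del[of \<gamma> "{0..Suc n}" "Suc n"] assms by (simp add: S0_def A)
  ultimately show ?thesis by (simp add: chi_def perm_len_def Suc_diff_le)
qed

text \<open>For \<open>q = \<plusminus>1/N\<close> the function \<open>\<chi>\<^sub>q\<close> is a normalised trace: invariant colourings are the fixed
  basis vectors of the permutation action on a tensor power of \<open>\<complex>\<^sup>N\<close>, and a negative \<open>q\<close> twists
  the action by the sign.\<close>

lemma chi_colourings:
  assumes \<alpha>: "\<alpha> \<in> S0 n" and N: "0 < N" and s: "s = 1 \<or> s = - 1" and q: "q = s / real N"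
  shows "chi q n \<alpha> = (if s = 1 then 1 else of_int (sign \<alpha>)) *
    real (card {c \<in> colourings N {0..n}. \<forall>y\<in>{0..n}. c (\<alpha> y) = c y}) / real N ^ n"
proof -
  have p: "\<alpha> permutes {0..n}" using \<alpha> by (simp add: S0_def)
  have le: "cyc0 {0..n} \<alpha> \<le> n" using \<alpha> by (rule cyc0_le)
  have "of_int (sign \<alpha>) = (- 1 :: real) ^ (n - cyc0 {0..n} \<alpha>)"
    using sign_cyc0[OF _ _ p] by simp
  then have sg: "s ^ (n - cyc0 {0..n} \<alpha>) = (if s = 1 then 1 else of_int (sign \<alpha>))"
    using s by auto
  have "card {c \<in> colourings N {0..n}. \<forall>y\<in>{0..n}. c (\<alpha> y) = c y} = N ^ cyc0 {0..n} \<alpha>"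
    by (rule card_invariant_colourings[OF _ _ p N]) auto
  moreover have "real N ^ n = real N ^ (n - cyc0 {0..n} \<alpha>) * real N ^ cyc0 {0..n} \<alpha>"
    using le by (simp flip: power_add)
  ultimately show ?thesis
    using N by (simp add: chi_def perm_len_def q power_divide sg)
qed

section \<open>Order-preserving relabelling\<close>

lemma sorted_list_of_set_nth_card:
  assumes "finite B" "z \<in> B"
  shows "sorted_list_of_set B ! card {y \<in> B. y < z} = (z :: nat)"
proof -
  let ?L = "sorted_list_of_set B"
  have "z \<in> set ?L" using assms by simp
  then obtain i where i: "i < length ?L" "?L ! i = z" by (auto simp: in_set_conv_nth)
  have sorted: "sorted_wrt (<) ?L" by simp
  have less: "?L ! j < ?L ! k \<longleftrightarrow> j < k" if "j < length ?L" "k < length ?L" for j k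
    using sorted_wrt_nth_less[OF sorted] that by (metis less_irrefl less_trans nat_neq_iff)
  have "{y \<in> B. y < z} = (!) ?L ` {..<i}"
  proof
    show "{y \<in> B. y < z} \<subseteq> (!) ?L ` {..<i}"
    proof
      fix y assume y: "y \<in> {y \<in> B. y < z}"
      then have "y \<in> set ?L" using assms by simp
      then obtain j where "j < length ?L" "?L ! j = y" by (auto simp: in_set_conv_nth)
      then show "y \<in> (!) ?L ` {..<i}" using y i less by auto
    qed
    show "(!) ?L ` {..<i} \<subseteq> {y \<in> B. y < z}"
    proof
      fix y assume "y \<in> (!) ?L ` {..<i}"
      then obtain j where j: "j < i" "y = ?L ! j" by auto
      then have "?L ! j \<in> set ?L" using i by (intro nth_mem) simp
      moreover have "?L ! j < ?L ! i" using less[of j i] i(1) j(1) by simp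
      ultimately show "y \<in> {y \<in> B. y < z}" using j i assms by simp
    qed
  qed
  moreover have "inj_on ((!) ?L) {..<i}"
    using i by (intro inj_on_nth) auto
  ultimately have "card {y \<in> B. y < z} = i" by (simp add: card_image)
  then show ?thesis using i by simp
qed

lemma card_below_image:
  fixes f :: "nat \<Rightarrow> nat"
  assumes "strict_mono_on A f" "f ` A = B" "x \<in> A"
  shows "card {y \<in> B. y < f x} = card {y \<in> A. y < x}"
proof -
  have "f y < f x \<longleftrightarrow> y < x" if "y \<in> A" for y
    using assms that by (metis linorder_neqE_nat not_less_iff_gr_or_eq strict_mono_onD)
  then have "{y \<in> B. y < f x} = f ` {y \<in> A. y < x}" using assms(2) by auto
  moreover have "inj_on f {y \<in> A. y < x}"
    using assms(1) by (metis (no_types, lifting) inj_on_subset mem_Collect_eq strict_mono_on_imp_inj_on subsetI)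
  ultimately show ?thesis by (simp add: card_image)
qed

text \<open>Order-preserving bijections between finite sets are unique, so that composites of them need not
  be computed.\<close>

lemma ord_bij_eqI:
  assumes "finite B" "strict_mono_on A f" "f ` A = B" "x \<in> A"
  shows "ord_bij A B x = f x"
proof -
  have "f x \<in> B" using assms by auto
  then show ?thesis
    using sorted_list_of_set_nth_card[OF assms(1), of "f x"] card_below_image[OF assms(2-4)]
    by (simp add: ord_bij_def)
qed

lemma ord_bij_strict_mono:
  assumes "finite A" "finite B" "card A = card B"
  shows "strict_mono_on A (ord_bij A B)"
proof (rule strict_mono_onI)
  fix x y assume xy: "x \<in> A" "y \<in> A" "x < y"
  have "{z \<in> A. z < x} \<subset> {z \<in> A. z < y}" "{z \<in> A. z < y} \<subset> A" using xy by auto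
  then have "card {z \<in> A. z < x} < card {z \<in> A. z < y}" "card {z \<in> A. z < y} < card A"
    using assms(1) by (auto intro: psubset_card_mono)
  moreover have "sorted_wrt (<) (sorted_list_of_set B)" by simp
  ultimately show "ord_bij A B x < ord_bij A B y"
    using sorted_wrt_nth_less[of "(<)" "sorted_list_of_set B"] assms by (simp add: ord_bij_def)
qed

lemma ord_bij_image:
  assumes "finite A" "finite B" "card A = card B"
  shows "ord_bij A B ` A = B"
proof (rule card_subset_eq[OF assms(2)])
  show "ord_bij A B ` A \<subseteq> B"
  proof (rule image_subsetI)
    fix x assume "x \<in> A"
    then have "{z \<in> A. z < x} \<subset> A" by auto
    then have "card {z \<in> A. z < x} < card B"
      using assms by (metis psubset_card_mono)
    then have "ord_bij A B x \<in> set (sorted_list_of_set B)"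
      using assms(2) unfolding ord_bij_def by (intro nth_mem) simp
    then show "ord_bij A B x \<in> B" using assms(2) by simp
  qed
  show "card (ord_bij A B ` A) = card B"
    using ord_bij_strict_mono[OF assms] assms(3)
    by (simp add: card_image strict_mono_on_imp_inj_on)
qed

lemma ord_bij_in: "\<lbrakk>finite A; finite B; card A = card B; x \<in> A\<rbrakk> \<Longrightarrow> ord_bij A B x \<in> B"
  using ord_bij_image by blast

lemma ord_bij_inverse:
  assumes "finite A" "finite B" "card A = card B" "x \<in> A"
  shows "ord_bij B A (ord_bij A B x) = x"
  using card_below_image[OF ord_bij_strict_mono ord_bij_image, OF assms(1-3) assms(1-4)]
    sorted_list_of_set_nth_card[OF assms(1,4)]
  by (simp add: ord_bij_def)

lemma ord_bij_0:
  assumes "finite B" "0 \<in> B"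
  shows "ord_bij A B 0 = 0"
  using sorted_list_of_set_nth_card[OF assms] by (simp add: ord_bij_def)

lemma ord_bij_self: "finite B \<Longrightarrow> x \<in> B \<Longrightarrow> ord_bij B B x = x"
  using ord_bij_eqI[of B B "\<lambda>x. x" x] by (simp add: strict_mono_on_def)

lemma ord_bij_eq_0_iff:
  assumes "finite A" "finite B" "card A = card B" "x \<in> A" "0 \<in> A" "0 \<in> B"
  shows "ord_bij A B x = 0 \<longleftrightarrow> x = 0"
  using assms ord_bij_inverse[OF assms(1-4)] by (auto simp: ord_bij_0)

lemma transport_apply:
  assumes "finite A" "finite B" "card A = card B" "x \<in> A"
  shows "transport A B \<alpha> (ord_bij A B x) = ord_bij A B (\<alpha> x)"
  using assms by (simp add: transport_def ord_bij_in ord_bij_inverse)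

lemma transport_permutes:
  assumes "finite A" "finite B" "card A = card B" "\<alpha> permutes A"
  shows "transport A B \<alpha> permutes B"
proof (rule bij_imp_permutes)
  have bij: "bij_betw (ord_bij A B) A B" "bij_betw (ord_bij B A) B A"
    using assms by (simp_all add: bij_betw_def ord_bij_image ord_bij_strict_mono
        strict_mono_on_imp_inj_on)
  have "bij_betw (ord_bij A B \<circ> (\<alpha> \<circ> ord_bij B A)) B B"
    using bij permutes_imp_bij[OF assms(4)] by (intro bij_betw_trans) auto
  moreover have "bij_betw (transport A B \<alpha>) B B \<longleftrightarrow> bij_betw (ord_bij A B \<circ> (\<alpha> \<circ> ord_bij B A)) B B"
    by (rule bij_betw_cong) (simp add: transport_def)
  ultimately show "bij_betw (transport A B \<alpha>) B B" by blast
qed (simp add: transport_def)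

lemma transport_eqI:
  assumes "finite A" "finite B" "card A = card B" "g permutes B"
    "\<And>x. x \<in> A \<Longrightarrow> g (ord_bij A B x) = ord_bij A B (\<alpha> x)"
  shows "transport A B \<alpha> = g"
proof
  fix y
  show "transport A B \<alpha> y = g y"
  proof (cases "y \<in> B")
    case True
    then obtain x where "x \<in> A" "y = ord_bij A B x" using ord_bij_image[OF assms(1-3)] by auto
    then show ?thesis using transport_apply[OF assms(1-3)] assms(5) by simp
  next
    case False
    then show ?thesis using assms(4) by (simp add: transport_def permutes_not_in)
  qed
qed

lemma transport_self: "finite B \<Longrightarrow> \<alpha> permutes B \<Longrightarrow> transport B B \<alpha> = \<alpha>"
  by (rule transport_eqI) (auto simp: ord_bij_self permutes_in_image)

text \<open>Relabelling and then deleting a point is deleting the point and then relabelling, because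
  the order-preserving bijections compose.\<close>

lemma ord_bij_del:
  assumes fin: "finite A" "finite B" "finite C" "card A = card B" "card A = Suc (card C)"
    and k: "k \<in> A" and x: "x \<in> A - {k}"
  shows "ord_bij (B - {ord_bij A B k}) C (ord_bij A B x) = ord_bij (A - {k}) C x"
proof -
  let ?e = "ord_bij A B"
  let ?B = "B - {?e k}"
  have eA: "?e ` (A - {k}) = ?B"
    using ord_bij_image[OF fin(1,2,4)] ord_bij_strict_mono[OF fin(1,2,4)] k
    by (subst inj_on_image_set_diff[of ?e A]) (auto simp: strict_mono_on_imp_inj_on)
  have "?e k \<in> B" using fin k by (simp add: ord_bij_in)
  then have cards: "card ?B = card C" "card (A - {k}) = card C" using fin k by simp_all
  have m1: "strict_mono_on A ?e" using fin by (intro ord_bij_strict_mono)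
  have m2: "strict_mono_on ?B (ord_bij ?B C)" using fin cards by (intro ord_bij_strict_mono) auto
  have "strict_mono_on (A - {k}) (\<lambda>x. ord_bij ?B C (?e x))"
  proof (rule strict_mono_onI)
    fix x y assume xy: "x \<in> A - {k}" "y \<in> A - {k}" "x < y"
    then have "?e x \<in> ?B" "?e y \<in> ?B" using eA by blast+
    moreover have "?e x < ?e y" using xy m1 by (auto dest: strict_mono_onD)
    ultimately show "ord_bij ?B C (?e x) < ord_bij ?B C (?e y)"
      using m2 by (auto dest: strict_mono_onD)
  qed
  moreover have "(\<lambda>x. ord_bij ?B C (?e x)) ` (A - {k}) = C"
    using ord_bij_image[OF _ fin(3) cards(1)] fin by (simp add: image_image flip: eA)
  ultimately have "ord_bij (A - {k}) C x = ord_bij ?B C (?e x)"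
    using x by (rule ord_bij_eqI[OF fin(3)])
  then show ?thesis by (rule sym)
qed

lemma transport_del:
  assumes fin: "finite A" "finite B" "finite C" "card A = card B" "card A = Suc (card C)"
    and k: "k \<in> A" and \<gamma>: "\<gamma> permutes A"
  shows "transport (B - {ord_bij A B k}) C (perm_del {ord_bij A B k} (transport A B \<gamma>)) =
    transport (A - {k}) C (perm_del {k} \<gamma>)"
proof -
  let ?e = "ord_bij A B"
  let ?B = "B - {?e k}"
  let ?\<gamma> = "transport A B \<gamma>"
  have p: "?\<gamma> permutes B" using fin \<gamma> by (intro transport_permutes)
  have ek: "?e k \<in> B" using fin k by (simp add: ord_bij_in)
  have cards: "card ?B = card C" "card (A - {k}) = card C" using fin k ek by simp_all
  have d: "perm_del {?e k} ?\<gamma> permutes ?B" using p by (rule perm_del_single_permutes)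
  have d': "perm_del {k} \<gamma> permutes (A - {k})" using \<gamma> by (rule perm_del_single_permutes)
  have inj: "?e x = ?e y \<longleftrightarrow> x = y" if "x \<in> A" "y \<in> A" for x y
    using that ord_bij_inverse[OF fin(1,2,4)] by metis
  have \<gamma>A: "\<gamma> x \<in> A" if "x \<in> A" for x using \<gamma> that by (simp add: permutes_in_image)
  have del: "perm_del {?e k} ?\<gamma> (?e x) = ?e (perm_del {k} \<gamma> x)" if "x \<in> A" for x
    using that k \<gamma>A \<gamma> p
    by (simp add: perm_del_single_apply permutes_inj transport_apply fin inj)
  have "transport (A - {k}) C (perm_del {k} \<gamma>) = transport ?B C (perm_del {?e k} ?\<gamma>)"
  proof (rule transport_eqI)
    fix x assume x: "x \<in> A - {k}"
    then have y: "perm_del {k} \<gamma> x \<in> A - {k}" using permutes_in_image[OF d'] by blast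
    have "?e x \<in> ?B" using x fin inj k by (simp add: ord_bij_in)
    then have "transport ?B C (perm_del {?e k} ?\<gamma>) (ord_bij ?B C (?e x)) =
        ord_bij ?B C (perm_del {?e k} ?\<gamma> (?e x))"
      using fin cards by (intro transport_apply) auto
    also have "\<dots> = ord_bij ?B C (?e (perm_del {k} \<gamma> x))" using x by (simp add: del)
    finally show "transport ?B C (perm_del {?e k} ?\<gamma>) (ord_bij (A - {k}) C x) =
        ord_bij (A - {k}) C (perm_del {k} \<gamma> x)"
      using ord_bij_del[OF fin k x] ord_bij_del[OF fin k y] by simp
  qed (use fin cards d in \<open>auto intro: transport_permutes\<close>)
  then show ?thesis by simp
qed

section \<open>Lists of tensor slots\<close>

text \<open>The set \<open>A\<close> is a set of points \<open>0, \<dots>, n\<close> of a permutation; the slots are numbered from \<open>1\<close>, so the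
  same \<open>A\<close> describes the surviving points of \<open>\<alpha>\<close> and the surviving slots of \<open>F\<close> in \<open>\<alpha> \<otimes> F\<close>.\<close>

definition restr :: "nat set \<Rightarrow> 'a list \<Rightarrow> 'a list" where
  "restr A hs = nths hs {j. Suc j \<in> A}"

definition perm_list :: "(nat \<Rightarrow> nat) \<Rightarrow> 'a list \<Rightarrow> 'a list" where
  "perm_list \<sigma> hs = map (\<lambda>i. hs ! (inv \<sigma> i - 1)) [1..<Suc (length hs)]"

lemma slots_eqI:
  assumes "length xs = length ys" "\<And>i. i \<in> {1..length ys} \<Longrightarrow> xs ! (i - 1) = ys ! (i - 1)"
  shows "xs = ys"
proof (rule nth_equalityI[OF assms(1)])
  fix j assume "j < length xs"
  then show "xs ! j = ys ! j" using assms(1) assms(2)[of "Suc j"] by simp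
qed

lemma nths_conv_map: "nths xs I = map ((!) xs) (filter (\<lambda>j. j \<in> I) [0..<length xs])"
  by (induction xs rule: rev_induct) (auto simp: nths_append nth_append intro: map_cong)

text \<open>The surviving slots are renumbered by the same order-preserving bijection that transports the
  permutation.\<close>

lemma restr_conv:
  assumes "A \<subseteq> {0..length hs}" "0 \<in> A"
  shows "restr A hs = map (\<lambda>i. hs ! (ord_bij {0..card A - 1} A i - 1)) [1..<card A]"
proof -
  define js where "js = filter (\<lambda>j. Suc j \<in> A) [0..<length hs]"
  have fin: "finite A" using assms finite_subset by blast
  have "A = set (0 # map Suc js)"
  proof
    show "A \<subseteq> set (0 # map Suc js)"
    proof
      fix x assume "x \<in> A"
      then show "x \<in> set (0 # map Suc js)" using assms by (cases x) (auto simp: js_def)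
    qed
  qed (use assms in \<open>auto simp: js_def\<close>)
  moreover have "sorted_wrt (<) (0 # map Suc js)"
    by (auto simp: js_def sorted_wrt_map intro: sorted_wrt_filter)
  ultimately have L: "sorted_list_of_set A = 0 # map Suc js"
    by (metis strict_sorted_iff sorted_list_of_set.idem_if_sorted_distinct)
  have "card A = length (sorted_list_of_set A)" by simp
  then have card: "card A = Suc (length js)" by (simp add: L)
  have "hs ! (ord_bij {0..card A - 1} A i - 1) = hs ! (js ! (i - 1))" if "i \<in> {1..<card A}" for i
  proof -
    have "{y \<in> {0..card A - 1}. y < i} = {0..<i}" using that by auto
    moreover have "i - 1 < length js" using that card by auto
    ultimately show ?thesis using that by (auto simp: ord_bij_def L nth_Cons')
  qed
  then have "map (\<lambda>i. hs ! (ord_bij {0..card A - 1} A i - 1)) [1..<card A] =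
      map (\<lambda>i. hs ! (js ! (i - 1))) [1..<card A]"
    by (intro map_cong) auto
  also have "\<dots> = map ((!) hs) js"
    by (rule nth_equalityI) (auto simp: card simp del: upt_Suc)
  finally show ?thesis by (simp add: restr_def nths_conv_map js_def)
qed

lemma length_restr:
  assumes "A \<subseteq> {0..length hs}" "0 \<in> A"
  shows "length (restr A hs) = card A - 1"
  by (simp add: restr_conv[OF assms])

lemma restr_nth:
  assumes "A \<subseteq> {0..length hs}" "0 \<in> A" "i \<in> {1..card A - 1}"
  shows "restr A hs ! (i - 1) = hs ! (ord_bij {0..card A - 1} A i - 1)"
  using assms(3) by (auto simp: restr_conv[OF assms(1,2)])

lemma length_perm_list [simp]: "length (perm_list \<sigma> hs) = length hs"
  by (simp add: perm_list_def del: upt_Suc)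

lemma perm_list_nth:
  "i \<in> {1..length hs} \<Longrightarrow> perm_list \<sigma> hs ! (i - 1) = hs ! (inv \<sigma> i - 1)"
  by (auto simp: perm_list_def simp del: upt_Suc)

lemma perm_list_comp:
  assumes "\<sigma> \<in> Sn (length hs)" "\<tau> \<in> Sn (length hs)"
  shows "perm_list \<sigma> (perm_list \<tau> hs) = perm_list (\<sigma> \<circ> \<tau>) hs"
proof (rule slots_eqI)
  fix i assume "i \<in> {1..length (perm_list (\<sigma> \<circ> \<tau>) hs)}"
  then have i: "i \<in> {1..length hs}" by simp
  then have "inv \<sigma> i \<in> {1..length hs}" using Sn_in[OF Sn_inv[OF assms(1)]] by blast
  then show "perm_list \<sigma> (perm_list \<tau> hs) ! (i - 1) = perm_list (\<sigma> \<circ> \<tau>) hs ! (i - 1)"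
    using i assms by (simp only: perm_list_nth length_perm_list)
      (simp add: o_inv_distrib Sn_bij)
qed simp

text \<open>A permutation of the slots of a tensor descends to a permutation of the slots that survive
  a deletion.\<close>

lemma transport_relabel:
  assumes \<sigma>: "\<sigma> \<in> Sn (length hs)" and A: "A \<subseteq> {0..length hs}" "0 \<in> A"
    and m: "card A = Suc m" and \<delta>: "\<delta> permutes A"
  shows "\<exists>\<tau>\<in>Sn m. transport (\<sigma> ` A) {0..m} (\<sigma> \<circ> \<delta> \<circ> inv \<sigma>) =
      \<tau> \<circ> transport A {0..m} \<delta> \<circ> inv \<tau> \<and>
    restr (\<sigma> ` A) (perm_list \<sigma> hs) = perm_list \<tau> (restr A hs)"
proof -
  let ?n = "length hs"
  define A' where "A' = \<sigma> ` A"
  define B where "B = {0..m}"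
  have bij: "bij \<sigma>" using \<sigma> by (rule Sn_bij)
  have inv: "inv \<sigma> (\<sigma> x) = x" "\<sigma> (inv \<sigma> x) = x" for x using \<sigma> by (simp_all add: Sn_inv_apply)
  have fin: "finite A" "finite A'" "finite B" using A finite_subset by (auto simp: A'_def B_def)
  have c1: "card A = card B" using m by (simp add: B_def)
  have c2: "card A' = card B"
    using bij c1 by (simp add: A'_def card_image[OF inj_on_subset[OF bij_is_inj]])
  have z: "0 \<in> A'" "0 \<in> B" using A Sn_zero[OF \<sigma>] by (force simp: A'_def B_def)+
  have A'_sub: "A' \<subseteq> {0..?n}" using Sn_image[OF \<sigma>] A by (auto simp: A'_def)
  have inA': "\<sigma> x \<in> A' \<longleftrightarrow> x \<in> A" for x
    using bij by (auto simp: A'_def bij_is_inj inj_image_mem_iff)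
  note r = ord_bij_in[OF fin(1,3) c1] ord_bij_in[OF fin(3,1) c1[symmetric]]
    ord_bij_in[OF fin(2,3) c2] ord_bij_in[OF fin(3,2) c2[symmetric]]
    ord_bij_inverse[OF fin(1,3) c1] ord_bij_inverse[OF fin(3,1) c1[symmetric]]
    ord_bij_inverse[OF fin(2,3) c2] ord_bij_inverse[OF fin(3,2) c2[symmetric]]
  define t where "t i = (if i \<in> B then ord_bij A' B (\<sigma> (ord_bij B A i)) else i)" for i
  define u where "u i = (if i \<in> B then ord_bij A B (inv \<sigma> (ord_bij B A' i)) else i)" for i
  have inA: "inv \<sigma> y \<in> A" if "y \<in> A'" for y using inA'[of "inv \<sigma> y"] that by (simp add: inv)
  have tu: "t (u i) = i" and ut: "u (t i) = i" for i
    by (auto simp: t_def u_def r inv inA' inA)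
  have "bij t" using tu ut by (intro o_bij[of u]) (auto simp: fun_eq_iff)
  moreover have "t i = i" if "i \<notin> B" for i using that by (simp add: t_def)
  ultimately have "t permutes B" by (simp add: permutes_def bij_iff)
  moreover have "t 0 = 0"
    using z A fin Sn_zero[OF \<sigma>] by (simp add: t_def ord_bij_0)
  ultimately have t: "t \<in> Sn m" unfolding Sn_def B_def
    by (auto intro!: permutes_superset[of t "{0..m}"] simp: not_less_eq_eq)
  have u: "inv t = u" using tu ut by (intro inv_unique_comp) (auto simp: fun_eq_iff)
  have p: "transport A B \<delta> permutes B" using fin c1 \<delta> by (intro transport_permutes)
  have tp: "t permutes B" by fact
  have "transport A' B (\<sigma> \<circ> \<delta> \<circ> inv \<sigma>) = t \<circ> transport A B \<delta> \<circ> inv t"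
  proof (rule transport_eqI[OF fin(2,3) c2])
    show "t \<circ> transport A B \<delta> \<circ> inv t permutes B"
      using p tp by (intro permutes_compose permutes_inv)
    fix x assume "x \<in> A'"
    then obtain y where y: "x = \<sigma> y" "y \<in> A" by (auto simp: A'_def)
    have "\<delta> y \<in> A" using y \<delta> by (simp add: permutes_in_image)
    then show "(t \<circ> transport A B \<delta> \<circ> inv t) (ord_bij A' B x) = ord_bij A' B ((\<sigma> \<circ> \<delta> \<circ> inv \<sigma>) x)"
      using y by (simp add: u u_def t_def r inv inA' transport_apply[OF fin(1,3) c1])
  qed
  moreover have "restr A' (perm_list \<sigma> hs) = perm_list t (restr A hs)"
  proof (rule slots_eqI)
    have lr: "length (restr A hs) = m" using length_restr[OF A] m by simp
    show "length (restr A' (perm_list \<sigma> hs)) = length (perm_list t (restr A hs))"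
      using length_restr[of A' "perm_list \<sigma> hs"] A'_sub z c1 c2 m lr by simp
    fix i assume "i \<in> {1..length (perm_list t (restr A hs))}"
    then have i: "i \<in> {1..m}" by (simp add: lr)
    then have iB: "i \<in> B" by (auto simp: B_def)
    have c2m: "card A' = Suc m" using c1 c2 m by simp
    have "restr A' (perm_list \<sigma> hs) ! (i - 1) = perm_list \<sigma> hs ! (ord_bij B A' i - 1)"
      using restr_nth[of A' "perm_list \<sigma> hs" i] A'_sub z(1) i by (simp add: c2m B_def)
    also have "ord_bij B A' i \<in> {1..?n}"
    proof -
      have "ord_bij B A' i \<in> A'" using iB by (simp add: r)
      moreover have "ord_bij B A' i \<noteq> 0"
        using iB i z by (subst ord_bij_eq_0_iff[OF fin(3,2) c2[symmetric]]) auto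
      ultimately show ?thesis using A'_sub by force
    qed
    then have "perm_list \<sigma> hs ! (ord_bij B A' i - 1) = hs ! (inv \<sigma> (ord_bij B A' i) - 1)"
      by (rule perm_list_nth)
    also have "inv \<sigma> (ord_bij B A' i) = ord_bij B A (u i)"
      using iB by (simp add: u_def r inA)
    also have "hs ! (ord_bij B A (u i) - 1) = restr A hs ! (u i - 1)"
    proof -
      have "u i \<in> {1..m}" using Sn_in[OF Sn_inv[OF t], of i] i by (simp add: u)
      then show ?thesis using restr_nth[OF A, of "u i"] m by (simp add: B_def)
    qed
    also have "\<dots> = perm_list t (restr A hs) ! (i - 1)"
      using i by (subst perm_list_nth) (simp_all add: lr u)
    finally show "restr A' (perm_list \<sigma> hs) ! (i - 1) = perm_list t (restr A hs) ! (i - 1)" .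
  qed
  ultimately show ?thesis using t unfolding A'_def B_def by blast
qed

section \<open>Linear maps on labelled tensors\<close>

definition clinear :: "('a::complex_vector \<Rightarrow> 'b::complex_vector) \<Rightarrow> bool" where
  "clinear f \<longleftrightarrow> (\<forall>x y. f (x + y) = f x + f y) \<and> (\<forall>c x. f (c *\<^sub>C x) = c *\<^sub>C f x)"

lemma clinear_add: "clinear f \<Longrightarrow> f (x + y) = f x + f y"
  and clinear_scale: "clinear f \<Longrightarrow> f (c *\<^sub>C x) = c *\<^sub>C f x"
  by (simp_all add: clinear_def)

lemma clinear_zero: "clinear f \<Longrightarrow> f 0 = 0"
  using clinear_add[of f 0 0] by simp

lemma clinear_diff: "clinear f \<Longrightarrow> f (x - y) = f x - f y"
  using clinear_add[of f "x - y" y] by (simp add: algebra_simps)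

lemma clinear_sum: "clinear f \<Longrightarrow> f (\<Sum>i\<in>I. x i) = (\<Sum>i\<in>I. f (x i))"
  by (induction I rule: infinite_finite_induct) (simp_all add: clinear_zero clinear_add)

lemma clinear_compose: "clinear f \<Longrightarrow> clinear g \<Longrightarrow> clinear (\<lambda>x. f (g x))"
  by (simp add: clinear_def)

lemma clinear_scaleC: "clinear f \<Longrightarrow> clinear (\<lambda>x. c *\<^sub>C f x)"
  by (simp add: clinear_def scaleC_add_right scaleC_scaleC mult.commute)

lemma clinear_plus: "clinear f \<Longrightarrow> clinear g \<Longrightarrow> clinear (\<lambda>x. f x + g x)"
  by (simp add: clinear_def scaleC_add_right algebra_simps)

lemma clinear_sum_fun: "(\<And>i. i \<in> I \<Longrightarrow> clinear (f i)) \<Longrightarrow> clinear (\<lambda>x. \<Sum>i\<in>I. f i x)"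
  by (simp add: clinear_def sum.distrib complex_vector.scale_sum_right)

lemma abs_tens_add: "abs_tens (v + w) = abs_tens v + abs_tens w"
  by (simp add: plus_tens.abs_eq)

lemma abs_tens_single: "abs_tens (Poly_Mapping.single (l, hs) c) = c *\<^sub>C elem l hs"
  by (simp add: elem_def scaleC_tens.abs_eq formal_scale_single)

lemma formal_scale_ext: "formal_ext f (formal_scale c v) = c *\<^sub>C formal_ext f v"
proof -
  have "Poly_Mapping.keys (formal_scale c v) \<subseteq> Poly_Mapping.keys v"
    by (auto simp: in_keys_iff)
  then show ?thesis
    by (simp add: formal_ext_superset[of "Poly_Mapping.keys v"] scaleC_scaleC
        complex_vector.scale_sum_right)
qed

lemma tens_cases: obtains v where "x = abs_tens v"
  using Quotient3_abs_rep[OF Quotient3_tens, of x] by metis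

lemma clinear_lin_ext:
  fixes f :: "'l \<Rightarrow> 'a::real_vector list \<Rightarrow> 'b::complex_vector"
  assumes "multilinear f"
  shows "clinear (lin_ext f)"
  unfolding clinear_def
proof (intro conjI allI)
  fix x y :: "('l, 'a) tens" and c
  obtain v w where x: "x = abs_tens v" and y: "y = abs_tens w"
    using tens_cases[of x] tens_cases[of y] by metis
  show "lin_ext f (x + y) = lin_ext f x + lin_ext f y"
    by (simp add: x y lin_ext_abs_tens[OF assms] formal_ext_add flip: abs_tens_add)
  show "lin_ext f (c *\<^sub>C x) = c *\<^sub>C lin_ext f x"
    by (simp add: x y lin_ext_abs_tens[OF assms] scaleC_tens.abs_eq formal_scale_ext)
qed

lemma tens_sum_elem:
  "\<exists>v. x = (\<Sum>b\<in>Poly_Mapping.keys v. Poly_Mapping.lookup v b *\<^sub>C elem (fst b) (snd b))"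
proof -
  obtain v where x: "x = abs_tens v" by (rule tens_cases)
  have "abs_tens (\<Sum>b\<in>B. Poly_Mapping.single b (Poly_Mapping.lookup v b)) =
      (\<Sum>b\<in>B. Poly_Mapping.lookup v b *\<^sub>C elem (fst b) (snd b))" for B
  proof (induction B rule: infinite_finite_induct)
    case (insert b B)
    then show ?case by (cases b) (simp add: abs_tens_add abs_tens_single)
  qed (simp_all add: zero_tens.abs_eq)
  note * = this[of "Poly_Mapping.keys v"]
  have "(\<Sum>b\<in>Poly_Mapping.keys v. Poly_Mapping.single b (Poly_Mapping.lookup v b)) = v"
    by (rule poly_mapping_eqI)
      (auto simp: Poly_Mapping.lookup_sum lookup_single when_def in_keys_iff)
  with * show ?thesis unfolding x by (intro exI[of _ v]) simp
qed

lemma tens_induct [case_names zero add elem]: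
  assumes "P 0" "\<And>x y. P x \<Longrightarrow> P y \<Longrightarrow> P (x + y)" "\<And>c l hs. P (c *\<^sub>C elem l hs)"
  shows "P x"
proof -
  obtain v where x: "x = (\<Sum>b\<in>Poly_Mapping.keys v. Poly_Mapping.lookup v b *\<^sub>C elem (fst b) (snd b))"
    using tens_sum_elem by blast
  have "P (\<Sum>b\<in>B. Poly_Mapping.lookup v b *\<^sub>C elem (fst b) (snd b))" for B
    by (induction B rule: infinite_finite_induct) (auto intro: assms)
  then show ?thesis by (simp add: x)
qed

lemma clinear_eqI:
  assumes "clinear f" "clinear g" "\<And>l hs. f (elem l hs) = g (elem l hs)"
  shows "f x = g x"
  by (induction x rule: tens_induct)
    (simp_all add: assms clinear_zero clinear_add clinear_scale)

subsection \<open>Multilinearity\<close>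

lemma multilinearI:
  assumes "\<And>l hs p u v a b. p < length hs \<Longrightarrow> f l (hs[p := a *\<^sub>R u + b *\<^sub>R v]) =
     of_real a *\<^sub>C f l (hs[p := u]) + of_real b *\<^sub>C f l (hs[p := v])"
  shows "multilinear f"
  unfolding multilinear_def
proof (intro allI)
  fix l xs ys u v a b
  show "f l (xs @ (a *\<^sub>R u + b *\<^sub>R v) # ys) =
     of_real a *\<^sub>C f l (xs @ u # ys) + of_real b *\<^sub>C f l (xs @ v # ys)"
    using assms[of "length xs" "xs @ u # ys" l a u b v] by simp
qed

lemma multilinearD:
  assumes "multilinear f" "p < length hs"
  shows "f l (hs[p := a *\<^sub>R u + b *\<^sub>R v]) =
     of_real a *\<^sub>C f l (hs[p := u]) + of_real b *\<^sub>C f l (hs[p := v])"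
  using assms unfolding multilinear_def by (simp add: upd_conv_take_nth_drop)

lemma multilinear_elem: "multilinear (elem :: 'l \<Rightarrow> 'a::real_vector list \<Rightarrow> _)"
  unfolding multilinear_def
proof (intro allI)
  fix l :: 'l and xs ys :: "'a list" and u v a b
  have "abs_tens (Poly_Mapping.single (l, xs @ (a *\<^sub>R u + b *\<^sub>R v) # ys) 1) =
      abs_tens (Poly_Mapping.single (l, xs @ u # ys) (of_real a) +
        Poly_Mapping.single (l, xs @ v # ys) (of_real b))"
    using multilin_rel.slot[of l xs a u b v ys 1]
    by (simp add: tens.abs_eq_iff diff_diff_add)
  then show "elem l (xs @ (a *\<^sub>R u + b *\<^sub>R v) # ys) =
      of_real a *\<^sub>C elem l (xs @ u # ys) + of_real b *\<^sub>C elem l (xs @ v # ys)"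
    by (simp only: abs_tens_add abs_tens_single scaleC_one)
qed

lemma multilinear_relabel:
  assumes "multilinear f"
  shows "multilinear (\<lambda>l hs. f (r l (length hs)) hs)"
  by (rule multilinearI) (simp add: multilinearD[OF assms])

lemma multilinear_clinear:
  assumes "multilinear f" "\<And>l n. clinear (g l n)"
  shows "multilinear (\<lambda>l hs. g l (length hs) (f l hs))"
  by (rule multilinearI) (simp add: multilinearD[OF assms(1)] clinear_add clinear_scale assms(2))

text \<open>In each slot either the scalar or the remaining tensor depends on the vector, and does so
  linearly; this covers all slot permutations and contractions.\<close>

lemma multilinear_scaled_elem:
  fixes g :: "'l \<Rightarrow> 'a::real_vector list \<Rightarrow> 'a list"
  assumes "\<And>l hs p. P l (length hs) \<Longrightarrow> p < length hs \<Longrightarrow>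
     (\<exists>j<length (g l hs). \<forall>w. g l (hs[p := w]) = (g l hs)[j := w] \<and> c l (hs[p := w]) = c l hs) \<or>
     (\<forall>w. g l (hs[p := w]) = g l hs) \<and>
     (\<forall>u v a b. c l (hs[p := a *\<^sub>R u + b *\<^sub>R v]) = a * c l (hs[p := u]) + b * c l (hs[p := v]))"
  shows "multilinear (\<lambda>l hs. if P l (length hs)
    then of_real (c l hs) *\<^sub>C elem (r l (length hs)) (g l hs) else 0)"
proof (rule multilinearI)
  fix l p a b and hs :: "'a list" and u v :: 'a assume p: "p < length hs"
  let ?f = "\<lambda>l hs. if P l (length hs) then of_real (c l hs) *\<^sub>C elem (r l (length hs)) (g l hs) else 0"
  show "?f l (hs[p := a *\<^sub>R u + b *\<^sub>R v]) =
      of_real a *\<^sub>C ?f l (hs[p := u]) + of_real b *\<^sub>C ?f l (hs[p := v])"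
  proof (cases "P l (length hs)")
    case True
    from assms[OF True p] show ?thesis
    proof (elim disjE exE conjE)
      fix j assume "j < length (g l hs)"
        "\<forall>w. g l (hs[p := w]) = (g l hs)[j := w] \<and> c l (hs[p := w]) = c l hs"
      then show ?thesis using True
        by (simp add: multilinearD[OF multilinear_elem] scaleC_add_right scaleC_scaleC mult.commute)
    next
      assume "\<forall>w. g l (hs[p := w]) = g l hs"
        "\<forall>u v a b. c l (hs[p := a *\<^sub>R u + b *\<^sub>R v]) = a * c l (hs[p := u]) + b * c l (hs[p := v])"
      then show ?thesis using True
        by (simp add: scaleC_scaleC scaleC_add_left)
    qed
  qed simp
qed

lemma prod_linear_slot:
  fixes t :: "'i \<Rightarrow> 'a::real_vector \<Rightarrow> real"
  assumes "finite I" "i\<^sub>0 \<in> I" "\<And>i w. i \<in> I - {i\<^sub>0} \<Longrightarrow> t i w = s i"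
    "\<And>u v a b. t i\<^sub>0 (a *\<^sub>R u + b *\<^sub>R v) = a * t i\<^sub>0 u + b * t i\<^sub>0 v"
  shows "(\<Prod>i\<in>I. t i (a *\<^sub>R u + b *\<^sub>R v)) = a * (\<Prod>i\<in>I. t i u) + b * (\<Prod>i\<in>I. t i v)"
proof -
  have "(\<Prod>i\<in>I. t i w) = t i\<^sub>0 w * (\<Prod>i\<in>I - {i\<^sub>0}. s i)" for w
    using assms(1-3) by (simp add: prod.remove[of I i\<^sub>0])
  then show ?thesis by (simp add: assms(4) algebra_simps)
qed

lemma map_nth_update:
  assumes "distinct js" "j < length js" "js ! j = p" "p < length hs"
  shows "map ((!) (hs[p := w])) js = (map ((!) hs) js)[j := w]"
  using assms by (intro nth_equalityI) (auto simp: nth_list_update nth_eq_iff_index_eq)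

lemma map_nth_update_notin:
  "p \<notin> set js \<Longrightarrow> map ((!) (hs[p := w])) js = map ((!) hs) js"
  by (intro map_cong refl) (metis nth_list_update_neq)

lemma lookup_map_cnj:
  "Poly_Mapping.lookup (Poly_Mapping.map cnj v) k = cnj (Poly_Mapping.lookup v k)"
  by (simp add: Poly_Mapping.map.rep_eq when_def)

lemma antilin_ext_conv:
  "antilin_ext f x = formal_ext f (Poly_Mapping.map cnj (rep_tens x))"
proof -
  have "Poly_Mapping.keys (Poly_Mapping.map cnj (rep_tens x)) = Poly_Mapping.keys (rep_tens x)"
    by (auto simp: in_keys_iff lookup_map_cnj)
  then show ?thesis by (simp add: antilin_ext_def formal_ext_def lookup_map_cnj)
qed

lemma map_cnj_add: "Poly_Mapping.map cnj (v + w) = Poly_Mapping.map cnj v + Poly_Mapping.map cnj w"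
  by (rule poly_mapping_eqI) (simp add: lookup_map_cnj lookup_add)

lemma map_cnj_diff: "Poly_Mapping.map cnj (v - w) = Poly_Mapping.map cnj v - Poly_Mapping.map cnj w"
  by (rule poly_mapping_eqI) (simp add: lookup_map_cnj lookup_minus)

lemma map_cnj_single: "Poly_Mapping.map cnj (Poly_Mapping.single k c) = Poly_Mapping.single k (cnj c)"
  by (rule poly_mapping_eqI) (simp add: lookup_map_cnj lookup_single when_def)

lemma map_cnj_scale: "Poly_Mapping.map cnj (formal_scale c v) = formal_scale (cnj c) (Poly_Mapping.map cnj v)"
  by (rule poly_mapping_eqI) (simp add: lookup_map_cnj)

lemma multilin_rel_map_cnj: "v \<in> multilin_rel \<Longrightarrow> Poly_Mapping.map cnj v \<in> multilin_rel"
proof (induction rule: multilin_rel.induct)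
  case zero
  have "Poly_Mapping.map cnj 0 = (0 :: ('a, 'b) formal)"
    by (rule poly_mapping_eqI) (simp add: lookup_map_cnj)
  then show ?case by (simp add: multilin_rel.zero)
next
  case (add x y)
  then show ?case by (simp add: map_cnj_add multilin_rel.add)
next
  case (slot l xs a u b v ys c)
  show ?case using multilin_rel.slot[of l xs a u b v ys "cnj c"]
    by (simp add: map_cnj_diff map_cnj_single)
qed

lemma antilin_ext_abs_tens:
  assumes "multilinear f"
  shows "antilin_ext f (abs_tens v) = formal_ext f (Poly_Mapping.map cnj v)"
proof -
  have "v - v \<in> multilin_rel" by (simp add: multilin_rel.zero)
  then have "rep_tens (abs_tens v) - v \<in> multilin_rel"
    by (rule rep_abs_rsp_left[OF Quotient3_tens])
  from formal_ext_multilin_rel[OF assms multilin_rel_map_cnj[OF this]] show ?thesis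
    by (simp add: antilin_ext_conv map_cnj_diff formal_ext_diff)
qed

lemma antilin_ext_elem: "multilinear f \<Longrightarrow> antilin_ext f (elem l hs) = f l hs"
  by (simp add: elem_def antilin_ext_abs_tens map_cnj_single formal_ext_single scaleC_one)

lemma antilin_ext_add:
  assumes "multilinear f"
  shows "antilin_ext f (x + y) = antilin_ext f x + antilin_ext f y"
proof -
  obtain v w where x: "x = abs_tens v" and y: "y = abs_tens w"
    using tens_cases[of x] tens_cases[of y] by metis
  show ?thesis
    by (simp add: x y antilin_ext_abs_tens[OF assms] map_cnj_add formal_ext_add flip: abs_tens_add)
qed

lemma antilin_ext_scale:
  assumes "multilinear f"
  shows "antilin_ext f (c *\<^sub>C x) = cnj c *\<^sub>C antilin_ext f x"
proof -
  obtain v where x: "x = abs_tens v" by (rule tens_cases)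
  show ?thesis
    by (simp add: x antilin_ext_abs_tens[OF assms] map_cnj_scale formal_scale_ext scaleC_tens.abs_eq)
qed

section \<open>The structure maps on elementary tensors\<close>

lemma clinear_ot: "clinear (ot \<alpha>)"
  unfolding ot_def
  by (intro clinear_lin_ext multilinear_relabel[OF multilinear_elem, where r = "\<lambda>_ _. \<alpha>"])

lemma ot_elem [simp]: "ot \<alpha> (elem () hs) = elem \<alpha> hs"
  unfolding ot_def
  by (intro lin_ext_elem multilinear_relabel[OF multilinear_elem, where r = "\<lambda>_ _. \<alpha>"])

lemma multilinear_append:
  assumes "multilinear f"
  shows "multilinear (\<lambda>l hs. f l (hs @ ks))"
  by (rule multilinearI) (simp add: multilinearD[OF assms] flip: list_update_append1)

lemma multilinear_elem_append: "multilinear (\<lambda>l hs. elem (r l (length hs)) (hs @ ks))"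
proof -
  have "multilinear (\<lambda>l hs. elem (r l (length (hs @ ks) - length ks)) (hs @ ks))"
    by (rule multilinear_append[OF multilinear_relabel[OF multilinear_elem,
          where r = "\<lambda>l n. r l (n - length ks)"]])
  then show ?thesis by simp
qed

lemma clinear_r_plus: "clinear (r_plus h)"
  unfolding r_plus_def by (intro clinear_lin_ext multilinear_elem_append)

lemma r_plus_elem: "r_plus h (elem () hs) = elem () (hs @ [h])"
  unfolding r_plus_def by (intro lin_ext_elem multilinear_elem_append)

text \<open>The entry of a list at a position beyond its end is unspecified, but it does not depend on the
  entries; therefore the generator of the annihilation maps is multilinear also on tensors of too
  low degree.\<close>

lemma nth_beyond: "length xs \<le> i \<Longrightarrow> xs ! i = [] ! (i - length xs)"
proof (induction xs arbitrary: i)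
  case (Cons x xs)
  then show ?case by (cases i) auto
qed simp

lemma multilinear_r_minus:
  assumes "1 \<le> k"
  shows "multilinear (\<lambda>(_::unit) hs.
     of_real (inner (hs ! (k - 1)) h) *\<^sub>C elem () (take (k - 1) hs @ drop k hs))"
proof -
  have "multilinear (\<lambda>(l::unit) hs. if True
     then of_real (inner (hs ! (k - 1)) h) *\<^sub>C elem () (take (k - 1) hs @ drop k hs) else 0)"
  proof (rule multilinear_scaled_elem[where P = "\<lambda>_ _. True"], goal_cases)
    case (1 l hs p)
    show ?case
    proof (cases "p = k - 1")
      case True
      then show ?thesis using 1 assms by (auto simp: inner_add_left)
    next
      case False
      have c: "hs[p := w] ! (k - 1) = hs ! (k - 1)" for w
        using False nth_beyond[of "hs[p := w]" "k - 1"] nth_beyond[of hs "k - 1"]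
        by (cases "k - 1 < length hs") simp_all
      have "take (k - 1) (hs[p := w]) @ drop k (hs[p := w]) =
          (take (k - 1) hs @ drop k hs)[(if p < k - 1 then p else p - 1) := w]" for w
      proof (cases "p < k - 1")
        case True
        then show ?thesis using 1 by (simp add: take_update_swap list_update_append)
      next
        case F: False
        then have "k \<le> p" "k \<le> length hs" using False 1 assms by auto
        then show ?thesis using 1 assms by (simp add: drop_update_swap list_update_append min_def)
      qed
      moreover have "(if p < k - 1 then p else p - 1) < length (take (k - 1) hs @ drop k hs)"
        using 1 False assms by auto
      ultimately show ?thesis using c by metis
    qed
  qed
  then show ?thesis by simp
qed

lemma clinear_r_minus: "1 \<le> k \<Longrightarrow> clinear (r_minus k h)"
  unfolding r_minus_def by (intro clinear_lin_ext multilinear_r_minus)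

lemma restr_remove:
  assumes "k \<in> {1..length hs}"
  shows "restr ({0..length hs} - {k}) hs = take (k - 1) hs @ drop k hs"
proof -
  have k: "k - 1 < length hs" "Suc (k - 1) = k" using assms by auto
  have d: "nths (drop k hs) {j. Suc (j + k) \<le> length hs} = drop k hs"
    by (rule nths_all) auto
  have "nths hs {j. Suc j \<in> {0..length hs} - {k}} =
      nths (take (k - 1) hs @ hs ! (k - 1) # drop k hs) {j. Suc j \<in> {0..length hs} - {k}}"
    using id_take_nth_drop[OF k(1)] k(2) by simp
  also have "\<dots> = take (k - 1) hs @ drop k hs"
    using k d by (auto simp: nths_append nths_Cons nths_all min_def)
  finally show ?thesis by (simp add: restr_def)
qed

lemma r_minus_elem:
  assumes "k \<in> {1..length hs}"
  shows "r_minus k h (elem () hs) =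
    of_real (inner (hs ! (k - 1)) h) *\<^sub>C elem () (restr ({0..length hs} - {k}) hs)"
  unfolding r_minus_def restr_remove[OF assms]
  using assms by (intro lin_ext_elem[OF multilinear_r_minus]) auto

lemma multilinear_U_perm:
  assumes \<sigma>: "\<sigma> \<in> Sn n"
  shows "multilinear (\<lambda>(_::unit) hs. if length hs = n then
     elem () (map (\<lambda>i. hs ! (inv \<sigma> i - 1)) [1..<Suc n]) else 0)"
proof -
  let ?js = "map (\<lambda>i. inv \<sigma> i - 1) [1..<Suc n]"
  have i: "inv \<sigma> i \<in> {1..n}" if "i \<in> {1..n}" for i
    using that Sn_in[OF Sn_inv[OF \<sigma>]] by blast
  have "multilinear (\<lambda>(_::unit) hs. if length hs = n
     then of_real 1 *\<^sub>C elem () (map ((!) hs) ?js) else 0)"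
  proof (rule multilinear_scaled_elem[where P = "\<lambda>_ m. m = n"], goal_cases)
    case (1 l hs p)
    have "distinct ?js"
    proof (rule distinct_map[THEN iffD2], intro conjI inj_onI)
      fix x y assume xy: "x \<in> set [1..<Suc n]" "y \<in> set [1..<Suc n]" "inv \<sigma> x - 1 = inv \<sigma> y - 1"
      then have "inv \<sigma> x = inv \<sigma> y" using i[of x] i[of y] by auto
      then show "x = y" using Sn_inv_apply(2)[OF \<sigma>] by metis
    qed simp
    moreover have "\<exists>j<length ?js. ?js ! j = p"
    proof -
      have "\<sigma> (Suc p) \<in> {1..n}" using Sn_in[OF \<sigma>, of "Suc p"] 1 by auto
      then have "\<sigma> (Suc p) - 1 < n" "Suc (\<sigma> (Suc p) - 1) = \<sigma> (Suc p)" by auto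
      then show ?thesis
        by (intro exI[of _ "\<sigma> (Suc p) - 1"]) (simp add: Sn_inv_apply[OF \<sigma>] del: upt_Suc)
    qed
    ultimately show ?case using map_nth_update[of ?js] 1 by (metis length_map)
  qed
  then show ?thesis by (simp only: map_map o_def of_real_1 scaleC_one)
qed

lemma clinear_U_perm: "\<sigma> \<in> Sn n \<Longrightarrow> clinear (U_perm n \<sigma>)"
  unfolding U_perm_def by (intro clinear_lin_ext multilinear_U_perm)

lemma U_perm_elem: "\<sigma> \<in> Sn (length hs) \<Longrightarrow> U_perm (length hs) \<sigma> (elem () hs) = elem () (perm_list \<sigma> hs)"
  unfolding U_perm_def perm_list_def
  by (subst lin_ext_elem[OF multilinear_U_perm]) simp_all

lemma clinear_symm: "clinear (symm n \<alpha>)"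
  unfolding symm_def
  by (intro clinear_scaleC clinear_sum_fun clinear_compose[OF clinear_ot clinear_U_perm])

lemma symm_elem:
  "symm (length hs) \<alpha> (elem () hs) =
    (1 / fact (length hs)) *\<^sub>C (\<Sum>\<sigma>\<in>Sn (length hs). elem (\<sigma> \<circ> \<alpha> \<circ> inv \<sigma>) (perm_list \<sigma> hs))"
  by (simp add: symm_def U_perm_elem)

lemma multilinear_Wmap: "multilinear (\<lambda>\<alpha> hs. symm (length hs) \<alpha> (elem () hs))"
  by (rule multilinear_clinear[OF multilinear_relabel[OF multilinear_elem, where r = "\<lambda>_ _. ()"],
        where g = "\<lambda>\<alpha> n. symm n \<alpha>"]) (rule clinear_symm)

lemma clinear_Wmap: "clinear Wmap"
  unfolding Wmap_def by (intro clinear_lin_ext multilinear_Wmap)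

lemma Wmap_elem:
  "Wmap (elem \<alpha> hs) =
    (1 / fact (length hs)) *\<^sub>C (\<Sum>\<sigma>\<in>Sn (length hs). elem (\<sigma> \<circ> \<alpha> \<circ> inv \<sigma>) (perm_list \<sigma> hs))"
  unfolding Wmap_def by (subst lin_ext_elem[OF multilinear_Wmap]) (rule symm_elem)

lemma sum_Sn_translate:
  assumes "\<tau> \<in> Sn n"
  shows "(\<Sum>\<sigma>\<in>Sn n. f (\<sigma> \<circ> \<tau>)) = (\<Sum>\<sigma>\<in>Sn n. f \<sigma>)"
  by (rule sum.reindex_bij_witness[of _ "\<lambda>\<sigma>. \<sigma> \<circ> inv \<tau>" "\<lambda>\<sigma>. \<sigma> \<circ> \<tau>"])
    (auto simp: fun_eq_iff Sn_inv_apply[OF assms] assms intro!: Sn_comp Sn_inv)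

lemma Wmap_conj:
  assumes "\<sigma> \<in> Sn (length hs)"
  shows "Wmap (elem (\<sigma> \<circ> \<alpha> \<circ> inv \<sigma>) (perm_list \<sigma> hs)) = Wmap (elem \<alpha> hs)"
proof -
  have "(\<Sum>\<tau>\<in>Sn (length hs). elem (\<tau> \<circ> (\<sigma> \<circ> \<alpha> \<circ> inv \<sigma>) \<circ> inv \<tau>) (perm_list \<tau> (perm_list \<sigma> hs))) =
     (\<Sum>\<tau>\<in>Sn (length hs). elem ((\<tau> \<circ> \<sigma>) \<circ> \<alpha> \<circ> inv (\<tau> \<circ> \<sigma>)) (perm_list (\<tau> \<circ> \<sigma>) hs))"
    using assms by (intro sum.cong refl) (simp only: inv_comp_assoc Sn_bij perm_list_comp)
  also have "\<dots> = (\<Sum>\<tau>\<in>Sn (length hs). elem (\<tau> \<circ> \<alpha> \<circ> inv \<tau>) (perm_list \<tau> hs))"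
    by (rule sum_Sn_translate[OF assms])
  finally show ?thesis by (simp add: Wmap_elem)
qed

lemma sum_scaleC_const: "(\<Sum>i\<in>I. x) = of_nat (card I) *\<^sub>C (x :: 'a::complex_vector)"
  by (induction I rule: infinite_finite_induct)
    (simp_all add: scaleC_add_left scaleC_one)

lemma Wmap_Wmap: "Wmap (Wmap \<xi>) = Wmap \<xi>"
proof (rule clinear_eqI[where f = "\<lambda>\<xi>. Wmap (Wmap \<xi>)"])
  show "clinear (\<lambda>\<xi>. Wmap (Wmap \<xi>))" by (rule clinear_compose[OF clinear_Wmap clinear_Wmap])
  fix \<alpha> and hs :: "'a list"
  have "Wmap (Wmap (elem \<alpha> hs)) = (1 / fact (length hs)) *\<^sub>C (\<Sum>\<sigma>\<in>Sn (length hs). Wmap (elem \<alpha> hs))"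
    by (subst Wmap_elem[of \<alpha> hs])
      (simp add: clinear_scale[OF clinear_Wmap] clinear_sum[OF clinear_Wmap] Wmap_conj)
  then show "Wmap (Wmap (elem \<alpha> hs)) = Wmap (elem \<alpha> hs)"
    by (simp add: sum_scaleC_const card_Sn scaleC_scaleC scaleC_one)
qed (rule clinear_Wmap)

subsection \<open>The space of the algebra\<close>

text \<open>The unsymmetrised counterpart of \<open>TP\<close>, spanned by elementary tensors. Identities are proved on this
  larger space, where they can be checked on generators.\<close>

definition perm_tens :: "'a::real_inner ptens set" where
  "perm_tens = cspan {elem \<alpha> hs |\<alpha> hs. \<alpha> \<in> S0 (length hs)}"

lemma perm_tens_elem: "\<alpha> \<in> S0 (length hs) \<Longrightarrow> elem \<alpha> hs \<in> perm_tens"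
  unfolding perm_tens_def by (rule complex_vector.span_base) auto

lemma perm_tens_subspace: "complex_vector.subspace perm_tens"
  unfolding perm_tens_def by (rule complex_vector.subspace_span)

lemma perm_tens_induct [consumes 1, case_names zero add]:
  assumes "\<xi> \<in> perm_tens" "P 0"
    "\<And>c \<alpha> hs \<xi>. \<alpha> \<in> S0 (length hs) \<Longrightarrow> P \<xi> \<Longrightarrow> P (c *\<^sub>C elem \<alpha> hs + \<xi>)"
  shows "P \<xi>"
  using assms(1) unfolding perm_tens_def
  by (induction rule: complex_vector.span_induct_alt) (use assms(2,3) in auto)

lemma clinear_perm_tens_image:
  assumes "\<xi> \<in> perm_tens" "clinear f" "complex_vector.subspace V"
    "\<And>\<alpha> hs. \<alpha> \<in> S0 (length hs) \<Longrightarrow> f (elem \<alpha> hs) \<in> V"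
  shows "f \<xi> \<in> V"
  using assms(1)
proof (induction rule: perm_tens_induct)
  case zero
  then show ?case using assms(2,3) by (simp add: clinear_zero complex_vector.subspace_0)
next
  case (add c \<alpha> hs \<xi>)
  then show ?case using assms
    by (simp add: clinear_add clinear_scale complex_vector.subspace_add complex_vector.subspace_scale)
qed

lemma clinear_perm_tens_eqI:
  assumes "\<xi> \<in> perm_tens" "clinear f" "clinear g"
    "\<And>\<alpha> hs. \<alpha> \<in> S0 (length hs) \<Longrightarrow> f (elem \<alpha> hs) = g (elem \<alpha> hs)"
  shows "f \<xi> = g \<xi>"
  using assms(1) by (induction rule: perm_tens_induct)
    (simp_all add: assms clinear_zero clinear_add clinear_scale)

lemma tensor_power_elem: "elem () hs \<in> tensor_power (length hs)"
  unfolding tensor_power_def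
  by (rule CollectI, rule exI[of _ "{0}"], rule exI[of _ "\<lambda>_. 1"], rule exI[of _ "\<lambda>_. hs"])
    (simp add: scaleC_one)

lemma tensor_power_eqI:
  assumes "F \<in> tensor_power n" "clinear f" "clinear g"
    "\<And>hs. length hs = n \<Longrightarrow> f (elem () hs) = g (elem () hs)"
  shows "f F = g F"
proof -
  obtain J :: "nat set" and c w where "F = (\<Sum>j\<in>J. of_real (c j) *\<^sub>C elem () (w j))" "\<forall>j\<in>J. length (w j) = n"
    using assms(1) unfolding tensor_power_def mem_Collect_eq
    by (elim exE conjE) (rule that)
  then show ?thesis
    by (simp add: clinear_sum clinear_scale assms)
qed

lemma ot_perm_tens:
  assumes "\<alpha> \<in> S0 n" "F \<in> tensor_power n"
  shows "ot \<alpha> F \<in> perm_tens"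
proof -
  obtain J :: "nat set" and c w where F: "F = (\<Sum>j\<in>J. of_real (c j) *\<^sub>C elem () (w j))" "\<forall>j\<in>J. length (w j) = n"
    using assms(2) unfolding tensor_power_def mem_Collect_eq
    by (elim exE conjE) (rule that)
  show ?thesis unfolding F(1) clinear_sum[OF clinear_ot] clinear_scale[OF clinear_ot] ot_elem
    using F(2) assms(1)
    by (intro complex_vector.subspace_sum complex_vector.subspace_scale perm_tens_subspace
        perm_tens_elem) auto
qed

lemma Wmap_ot:
  assumes "F \<in> tensor_power n"
  shows "Wmap (ot \<alpha> F) = symm n \<alpha> F"
  using assms clinear_compose[OF clinear_Wmap clinear_ot] clinear_symm
  by (rule tensor_power_eqI) (auto simp: Wmap_elem symm_elem)

lemma Wmap_perm_tens: "\<xi> \<in> perm_tens \<Longrightarrow> Wmap \<xi> \<in> perm_tens"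
proof (erule clinear_perm_tens_image[OF _ clinear_Wmap perm_tens_subspace])
  fix \<alpha> and hs :: "'a list" assume "\<alpha> \<in> S0 (length hs)"
  then show "Wmap (elem \<alpha> hs) \<in> perm_tens"
    unfolding Wmap_elem
    by (intro complex_vector.subspace_scale complex_vector.subspace_sum perm_tens_subspace
        perm_tens_elem) (simp add: S0_conj)
qed

lemma TP_subspace: "complex_vector.subspace TP"
  unfolding TP_def by (rule complex_vector.subspace_span)

lemma Wmap_TP: "\<xi> \<in> perm_tens \<Longrightarrow> Wmap \<xi> \<in> TP"
proof (erule clinear_perm_tens_image[OF _ clinear_Wmap TP_subspace])
  fix \<alpha> and hs :: "'a list" assume "\<alpha> \<in> S0 (length hs)"
  then have "symm (length hs) \<alpha> (elem () hs) \<in> TP"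
    unfolding TP_def using tensor_power_elem by (intro complex_vector.span_base) blast
  then show "Wmap (elem \<alpha> hs) \<in> TP" by (simp add: symm_elem Wmap_elem)
qed

lemma TP_fixed: "\<xi> \<in> TP \<Longrightarrow> \<xi> \<in> perm_tens \<and> Wmap \<xi> = \<xi>"
  unfolding TP_def
proof (induction rule: complex_vector.span_induct_alt)
  case base
  show ?case by (simp add: complex_vector.subspace_0[OF perm_tens_subspace] clinear_zero[OF clinear_Wmap])
next
  case (step c x y)
  then obtain n \<alpha> F where x: "x = symm n \<alpha> F" "\<alpha> \<in> S0 n" "F \<in> tensor_power n" by blast
  then have "x = Wmap (ot \<alpha> F)" by (simp add: Wmap_ot)
  then have "x \<in> perm_tens" "Wmap x = x"
    using x by (simp_all add: Wmap_Wmap Wmap_perm_tens ot_perm_tens)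
  then show ?case using step
    by (simp add: clinear_add[OF clinear_Wmap] clinear_scale[OF clinear_Wmap]
        complex_vector.subspace_add[OF perm_tens_subspace]
        complex_vector.subspace_scale[OF perm_tens_subspace])
qed

lemma TP_perm_tens: "\<xi> \<in> TP \<Longrightarrow> \<xi> \<in> perm_tens"
  and Wmap_id: "\<xi> \<in> TP \<Longrightarrow> Wmap \<xi> = \<xi>"
  by (simp_all add: TP_fixed)

section \<open>Pair partitions and contractions\<close>

lemma P12_permutes: "\<pi> \<in> P12 n \<Longrightarrow> \<pi> permutes {1..n}"
  and P12_Sn: "\<pi> \<in> P12 n \<Longrightarrow> \<pi> \<in> Sn n"
  by (simp_all add: P12_def Sn_def)

lemma P12_involution [simp]: "\<pi> \<in> P12 n \<Longrightarrow> \<pi> (\<pi> x) = x"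
  by (simp add: P12_def fun_eq_iff)

lemma P12_id: "id \<in> P12 n"
  by (simp add: P12_def permutes_id)

lemma finite_P12: "finite (P12 n)"
  unfolding P12_def by (rule finite_subset[OF _ finite_permutations[of "{1..n}"]]) auto

lemma supp_subset: "\<pi> \<in> P12 n \<Longrightarrow> supp \<pi> \<subseteq> {1..n}"
  unfolding supp_def using permutes_not_in[OF P12_permutes] by blast

lemma finite_supp: "\<pi> \<in> P12 n \<Longrightarrow> finite (supp \<pi>)"
  using supp_subset finite_subset by blast

definition keep :: "nat \<Rightarrow> (nat \<Rightarrow> nat) \<Rightarrow> nat set" where
  "keep n \<pi> = {0..n} - supp \<pi>"

lemma card_supp:
  assumes "\<pi> \<in> P12 n"
  shows "card (supp \<pi>) = 2 * npairs \<pi>"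
proof -
  let ?L = "{x \<in> supp \<pi>. x < \<pi> x}"
  have inv: "\<pi> (\<pi> x) = x" for x using assms by simp
  have "supp \<pi> = ?L \<union> \<pi> ` ?L"
  proof (intro equalityI subsetI)
    fix x assume x: "x \<in> supp \<pi>"
    show "x \<in> ?L \<union> \<pi> ` ?L"
    proof (cases "x < \<pi> x")
      case False
      then have "\<pi> x \<in> ?L" using x inv by (auto simp: supp_def)
      then show ?thesis using inv[of x] by (intro UnI2 image_eqI[of x \<pi> "\<pi> x"]) simp_all
    qed (use x in auto)
  qed (auto simp: supp_def inv)
  moreover have "?L \<inter> \<pi> ` ?L = {}" using inv by auto
  moreover have "finite ?L" using finite_supp[OF assms] by simp
  moreover have "inj_on \<pi> ?L" by (rule inj_on_inverseI[of _ \<pi>]) (rule inv)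
  ultimately have "card (supp \<pi>) = card ?L + card (\<pi> ` ?L)" "card (\<pi> ` ?L) = card ?L"
    using card_Un_disjoint[of ?L "\<pi> ` ?L"] by (simp_all add: card_image)
  then show ?thesis by (simp add: npairs_def)
qed

lemma card_keep:
  assumes "\<pi> \<in> P12 n"
  shows "card (keep n \<pi>) = Suc (n - 2 * npairs \<pi>)"
proof -
  have "card (keep n \<pi>) = card {0..n} - card (supp \<pi>)"
    unfolding keep_def using supp_subset[OF assms]
    by (intro card_Diff_subset finite_supp[OF assms]) auto
  moreover have "card (supp \<pi>) \<le> n"
    using card_mono[OF _ supp_subset[OF assms]] by simp
  ultimately show ?thesis by (simp add: card_supp[OF assms] Suc_diff_le)
qed

lemma keep_subset: "keep n \<pi> \<subseteq> {0..n}"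
  by (auto simp: keep_def)

lemma finite_keep: "finite (keep n \<pi>)"
  by (simp add: keep_def)

lemma zero_keep: "\<pi> \<in> P12 n \<Longrightarrow> 0 \<in> keep n \<pi>"
  using supp_subset[of \<pi> n] by (auto simp: keep_def)

definition contr_perm :: "(nat \<Rightarrow> nat) \<Rightarrow> (nat \<Rightarrow> nat) \<Rightarrow> nat \<Rightarrow> nat" where
  "contr_perm \<pi> \<alpha> = perm_del (supp \<pi>) (\<pi> \<circ> \<alpha>)"

lemma P12_comp_S0: "\<pi> \<in> P12 n \<Longrightarrow> \<alpha> \<in> S0 n \<Longrightarrow> \<pi> \<circ> \<alpha> \<in> S0 n"
  using P12_Sn Sn_subset_S0 by (intro S0_comp) auto

lemma contr_perm_permutes:
  assumes "\<pi> \<in> P12 n" "\<alpha> \<in> S0 n"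
  shows "contr_perm \<pi> \<alpha> permutes keep n \<pi>"
  unfolding contr_perm_def keep_def
  using perm_del_permutes[OF finite_supp[OF assms(1)] S0_permutes[OF P12_comp_S0[OF assms]]] by simp

lemma perm_contr_S0:
  assumes "\<pi> \<in> P12 n" "\<alpha> \<in> S0 n"
  shows "perm_contr n \<pi> \<alpha> \<in> S0 (n - 2 * npairs \<pi>)"
  unfolding S0_def perm_contr_def
  using contr_perm_permutes[OF assms] card_keep[OF assms(1)]
  by (auto simp: contr_perm_def keep_def intro!: transport_permutes)

definition pair_prod :: "nat \<Rightarrow> (nat \<Rightarrow> nat) \<Rightarrow> 'a::real_inner list \<Rightarrow> real" where
  "pair_prod n \<pi> hs = (\<Prod>i\<in>{i \<in> {1..n}. i < \<pi> i}. inner (hs ! (i - 1)) (hs ! (\<pi> i - 1)))"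

lemma restr_keep: "restr (keep (length hs) \<pi>) hs = nths hs {j. Suc j \<notin> supp \<pi>}"
  unfolding restr_def nths_conv_map
  by (rule arg_cong[where f = "map ((!) hs)"], rule filter_cong) (auto simp: keep_def)

lemma length_restr_keep:
  "\<pi> \<in> P12 (length hs) \<Longrightarrow> length (restr (keep (length hs) \<pi>) hs) = length hs - 2 * npairs \<pi>"
  by (simp add: length_restr keep_subset zero_keep card_keep)

lemma multilinear_tens_contr:
  assumes \<pi>: "\<pi> \<in> P12 n"
  shows "multilinear (\<lambda>(_::unit) hs. if length hs = n then
     of_real (pair_prod n \<pi> hs) *\<^sub>C elem () (nths hs {j. Suc j \<notin> supp \<pi>}) else 0)"
proof (rule multilinear_scaled_elem[where P = "\<lambda>_ m. m = n"], goal_cases)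
  case (1 l hs p)
  let ?js = "filter (\<lambda>j. j \<in> {j. Suc j \<notin> supp \<pi>}) [0..<n]"
  let ?I = "{i \<in> {1..n}. i < \<pi> i}"
  have inv: "\<pi> (\<pi> x) = x" for x using \<pi> by simp
  have nths: "nths (hs[p := w]) {j. Suc j \<notin> supp \<pi>} = map ((!) (hs[p := w])) ?js" for w
    using 1 by (simp add: nths_conv_map)
  have nths': "nths hs {j. Suc j \<notin> supp \<pi>} = map ((!) hs) ?js"
    using 1 by (simp add: nths_conv_map)
  show ?case
  proof (cases "Suc p \<in> supp \<pi>")
    case True
    define i\<^sub>0 where "i\<^sub>0 = (if Suc p < \<pi> (Suc p) then Suc p else \<pi> (Suc p))"
    have ne: "\<pi> (Suc p) \<noteq> Suc p" using True by (simp add: supp_def)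
    have in_n: "\<pi> x \<in> {1..n} \<longleftrightarrow> x \<in> {1..n}" for x using Sn_in[OF P12_Sn[OF \<pi>]] .
    have "i\<^sub>0 \<in> ?I" using ne 1 in_n[of "Suc p"] by (auto simp: i\<^sub>0_def inv)
    have oth: "i - 1 \<noteq> p \<and> \<pi> i - 1 \<noteq> p" if "i \<in> ?I - {i\<^sub>0}" for i
      using that inv[of i] by (auto simp: i\<^sub>0_def split: if_splits)
    have i0: "(i\<^sub>0 - 1 = p \<and> \<pi> i\<^sub>0 - 1 \<noteq> p) \<or> (i\<^sub>0 - 1 \<noteq> p \<and> \<pi> i\<^sub>0 - 1 = p)"
      using ne in_n[of "Suc p"] 1 by (auto simp: i\<^sub>0_def inv split: if_splits)
    have "pair_prod n \<pi> (hs[p := a *\<^sub>R u + b *\<^sub>R v]) =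
        a * pair_prod n \<pi> (hs[p := u]) + b * pair_prod n \<pi> (hs[p := v])" for u v a b
      unfolding pair_prod_def
    proof (rule prod_linear_slot[where i\<^sub>0 = i\<^sub>0 and
          s = "\<lambda>i. inner (hs ! (i - 1)) (hs ! (\<pi> i - 1))"])
      show "i\<^sub>0 \<in> ?I" by fact
      show "inner (hs[p := w] ! (i - 1)) (hs[p := w] ! (\<pi> i - 1)) =
          inner (hs ! (i - 1)) (hs ! (\<pi> i - 1))" if "i \<in> ?I - {i\<^sub>0}" for i w
        using oth[OF that] by simp
      show "inner (hs[p := a *\<^sub>R u + b *\<^sub>R v] ! (i\<^sub>0 - 1)) (hs[p := a *\<^sub>R u + b *\<^sub>R v] ! (\<pi> i\<^sub>0 - 1)) =
          a * inner (hs[p := u] ! (i\<^sub>0 - 1)) (hs[p := u] ! (\<pi> i\<^sub>0 - 1)) +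
          b * inner (hs[p := v] ! (i\<^sub>0 - 1)) (hs[p := v] ! (\<pi> i\<^sub>0 - 1))" for u v a b
        using i0 1 by (auto simp: inner_add_left inner_add_right)
    qed simp
    moreover have "p \<notin> set ?js" using True by simp
    ultimately show ?thesis
      unfolding nths nths' by (simp add: map_nth_update_notin)
  next
    case False
    have "p \<in> set ?js" using False 1 by simp
    then obtain j where j: "j < length ?js" "?js ! j = p" by (metis in_set_conv_nth)
    have "i - 1 \<noteq> p \<and> \<pi> i - 1 \<noteq> p" if "i \<in> ?I" for i
      using that False inv[of i] by (auto simp: supp_def)
    then have "inner (hs[p := w] ! (i - 1)) (hs[p := w] ! (\<pi> i - 1)) =
        inner (hs ! (i - 1)) (hs ! (\<pi> i - 1))" if "i \<in> ?I" for i w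
      using that by (metis nth_list_update_neq)
    then have "pair_prod n \<pi> (hs[p := w]) = pair_prod n \<pi> hs" for w
      unfolding pair_prod_def by (intro prod.cong refl)
    moreover have "map ((!) (hs[p := w])) ?js = (map ((!) hs) ?js)[j := w]" for w
      using j 1 by (intro map_nth_update) simp_all
    ultimately show ?thesis
      unfolding nths nths' using j by (intro disjI1 exI[of _ j]) simp
  qed
qed

lemma clinear_tens_contr: "\<pi> \<in> P12 n \<Longrightarrow> clinear (tens_contr n \<pi>)"
  unfolding tens_contr_def pair_prod_def[symmetric]
  by (intro clinear_lin_ext multilinear_tens_contr)

lemma tens_contr_elem:
  assumes "\<pi> \<in> P12 (length hs)"
  shows "tens_contr (length hs) \<pi> (elem () hs) =
    of_real (pair_prod (length hs) \<pi> hs) *\<^sub>C elem () (restr (keep (length hs) \<pi>) hs)"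
  unfolding tens_contr_def pair_prod_def[symmetric] restr_keep
  by (subst lin_ext_elem[OF multilinear_tens_contr[OF assms]]) simp

text \<open>\<open>T\<close> is symmetrisation after \<open>T_raw\<close>. Without the symmetrisation the interplay with creation and
  annihilation is an identity between explicit tensors (lemma \<open>T_raw_creat\<close>).\<close>

definition T_raw :: "real \<Rightarrow> 'a::real_inner ptens \<Rightarrow> 'a ptens" where
  "T_raw q = lin_ext (\<lambda>\<alpha> hs. \<Sum>\<pi>\<in>P12 (length hs).
     of_real (perm_contr_coeff q (length hs) \<pi> \<alpha>) *\<^sub>C
       ot (perm_contr (length hs) \<pi> \<alpha>) (tens_contr (length hs) \<pi> (elem () hs)))"

definition creat :: "'a::real_inner \<Rightarrow> 'a ptens \<Rightarrow> 'a ptens" where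
  "creat h = lin_ext (\<lambda>\<alpha> hs. elem \<alpha> (hs @ [h]))"

definition annih :: "real \<Rightarrow> 'a::real_inner \<Rightarrow> 'a ptens \<Rightarrow> 'a ptens" where
  "annih q h = lin_ext (\<lambda>\<alpha> hs. \<Sum>k\<in>{1..length hs}. of_real (if \<alpha> k = k then 1 else q) *\<^sub>C
     ot (transport ({0..length hs} - {k}) {0..length hs - 1} (perm_del {k} \<alpha>))
       (r_minus k h (elem () hs)))"

lemma multilinear_elem_clinear:
  assumes "\<And>l n. clinear (g l n)"
  shows "multilinear (\<lambda>l hs. g l (length hs) (elem () hs))"
  by (rule multilinear_clinear[OF multilinear_relabel[OF multilinear_elem, where r = "\<lambda>_ _. ()"],
        where g = g]) (rule assms)

lemma multilinear_T_raw: "multilinear (\<lambda>\<alpha> hs. \<Sum>\<pi>\<in>P12 (length hs).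
     of_real (perm_contr_coeff q (length hs) \<pi> \<alpha>) *\<^sub>C
       ot (perm_contr (length hs) \<pi> \<alpha>) (tens_contr (length hs) \<pi> (elem () hs)))"
  by (rule multilinear_elem_clinear[where g = "\<lambda>\<alpha> n F. \<Sum>\<pi>\<in>P12 n.
        of_real (perm_contr_coeff q n \<pi> \<alpha>) *\<^sub>C ot (perm_contr n \<pi> \<alpha>) (tens_contr n \<pi> F)"])
    (intro clinear_sum_fun clinear_scaleC clinear_compose[OF clinear_ot clinear_tens_contr])

lemma clinear_T_raw: "clinear (T_raw q)"
  unfolding T_raw_def by (intro clinear_lin_ext multilinear_T_raw)

lemma T_raw_elem:
  "T_raw q (elem \<alpha> hs) = (\<Sum>\<pi>\<in>P12 (length hs).
    of_real (perm_contr_coeff q (length hs) \<pi> \<alpha> * pair_prod (length hs) \<pi> hs) *\<^sub>C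
    elem (perm_contr (length hs) \<pi> \<alpha>) (restr (keep (length hs) \<pi>) hs))"
  unfolding T_raw_def
  by (subst lin_ext_elem[OF multilinear_T_raw])
    (simp add: tens_contr_elem clinear_scale[OF clinear_ot] scaleC_scaleC)

lemma Tmap_T_raw: "Tmap q \<xi> = Wmap (T_raw q \<xi>)"
proof (rule clinear_eqI[where g = "\<lambda>\<xi>. Wmap (T_raw q \<xi>)"])
  have ml: "multilinear (\<lambda>\<alpha> hs. \<Sum>\<pi>\<in>P12 (length hs). of_real (perm_contr_coeff q (length hs) \<pi> \<alpha>) *\<^sub>C
      Wmap (ot (perm_contr (length hs) \<pi> \<alpha>) (tens_contr (length hs) \<pi> (elem () hs))))"
    by (rule multilinear_elem_clinear[where g = "\<lambda>\<alpha> n F. \<Sum>\<pi>\<in>P12 n.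
        of_real (perm_contr_coeff q n \<pi> \<alpha>) *\<^sub>C Wmap (ot (perm_contr n \<pi> \<alpha>) (tens_contr n \<pi> F))"])
      (intro clinear_sum_fun clinear_scaleC clinear_compose[OF clinear_Wmap]
        clinear_compose[OF clinear_ot clinear_tens_contr])
  show "clinear (Tmap q)"
    unfolding Tmap_def Let_def by (rule clinear_lin_ext[OF ml])
  show "clinear (\<lambda>\<xi>. Wmap (T_raw q \<xi>))"
    by (rule clinear_compose[OF clinear_Wmap clinear_T_raw])
  fix \<alpha> and hs :: "'a list"
  show "Tmap q (elem \<alpha> hs) = Wmap (T_raw q (elem \<alpha> hs))"
    unfolding Tmap_def Let_def T_raw_def lin_ext_elem[OF ml] lin_ext_elem[OF multilinear_T_raw]
    by (simp add: clinear_sum[OF clinear_Wmap] clinear_scale[OF clinear_Wmap])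
qed

lemma clinear_Tmap: "clinear (Tmap q)"
  using clinear_compose[OF clinear_Wmap clinear_T_raw] by (simp add: Tmap_T_raw[abs_def])

lemma clinear_creat: "clinear (creat h)"
  unfolding creat_def by (intro clinear_lin_ext multilinear_elem_append)

lemma creat_elem: "creat h (elem \<alpha> hs) = elem \<alpha> (hs @ [h])"
  unfolding creat_def by (rule lin_ext_elem[OF multilinear_elem_append])

lemma multilinear_annih: "multilinear (\<lambda>\<alpha> hs. \<Sum>k\<in>{1..length hs}. of_real (if \<alpha> k = k then 1 else q) *\<^sub>C
     ot (transport ({0..length hs} - {k}) {0..length hs - 1} (perm_del {k} \<alpha>))
       (r_minus k h (elem () hs)))"
  by (rule multilinear_elem_clinear[where g = "\<lambda>\<alpha> n F. \<Sum>k\<in>{1..n}.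
        of_real (if \<alpha> k = k then 1 else q) *\<^sub>C
        ot (transport ({0..n} - {k}) {0..n - 1} (perm_del {k} \<alpha>)) (r_minus k h F)"])
    (intro clinear_sum_fun clinear_scaleC clinear_compose[OF clinear_ot clinear_r_minus], simp)

lemma clinear_annih: "clinear (annih q h)"
  unfolding annih_def by (intro clinear_lin_ext multilinear_annih)

lemma annih_elem_r_minus: "annih q h (elem \<alpha> hs) = (\<Sum>k\<in>{1..length hs}.
    of_real (if \<alpha> k = k then 1 else q) *\<^sub>C
     ot (transport ({0..length hs} - {k}) {0..length hs - 1} (perm_del {k} \<alpha>))
       (r_minus k h (elem () hs)))"
  unfolding annih_def by (rule lin_ext_elem[OF multilinear_annih])

lemma annih_elem: "annih q h (elem \<alpha> hs) = (\<Sum>k\<in>{1..length hs}.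
    of_real ((if \<alpha> k = k then 1 else q) * inner (hs ! (k - 1)) h) *\<^sub>C
    elem (transport ({0..length hs} - {k}) {0..length hs - 1} (perm_del {k} \<alpha>))
      (restr ({0..length hs} - {k}) hs))"
  unfolding annih_elem_r_minus
  by (intro sum.cong refl) (simp add: r_minus_elem clinear_scale[OF clinear_ot] scaleC_scaleC)

lemma creat_perm_tens: "\<xi> \<in> perm_tens \<Longrightarrow> creat h \<xi> \<in> perm_tens"
proof (erule clinear_perm_tens_image[OF _ clinear_creat perm_tens_subspace])
  fix \<alpha> and hs :: "'a list" assume "\<alpha> \<in> S0 (length hs)"
  then show "creat h (elem \<alpha> hs) \<in> perm_tens"
    using S0_mono[of "length hs" "length (hs @ [h])"]
    by (auto simp: creat_elem intro!: perm_tens_elem)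
qed

lemma transport_del_S0:
  assumes "\<alpha> \<in> S0 n" "k \<in> {1..n}"
  shows "transport ({0..n} - {k}) {0..n - 1} (perm_del {k} \<alpha>) \<in> S0 (n - 1)"
  unfolding S0_def
  using assms perm_del_single_permutes[OF S0_permutes[OF assms(1)], of k]
  by (auto intro!: transport_permutes)

lemma annih_perm_tens: "\<xi> \<in> perm_tens \<Longrightarrow> annih q h \<xi> \<in> perm_tens"
proof (erule clinear_perm_tens_image[OF _ clinear_annih perm_tens_subspace])
  fix \<alpha> and hs :: "'a list" assume \<alpha>: "\<alpha> \<in> S0 (length hs)"
  have "elem (transport ({0..length hs} - {k}) {0..length hs - 1} (perm_del {k} \<alpha>))
      (restr ({0..length hs} - {k}) hs) \<in> perm_tens" if "k \<in> {1..length hs}" for k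
    using that transport_del_S0[OF \<alpha> that]
    by (intro perm_tens_elem) (auto simp: length_restr)
  then show "annih q h (elem \<alpha> hs) \<in> perm_tens"
    unfolding annih_elem
    by (intro complex_vector.subspace_sum complex_vector.subspace_scale perm_tens_subspace) auto
qed

lemma T_raw_perm_tens: "\<xi> \<in> perm_tens \<Longrightarrow> T_raw q \<xi> \<in> perm_tens"
proof (erule clinear_perm_tens_image[OF _ clinear_T_raw perm_tens_subspace])
  fix \<alpha> and hs :: "'a list" assume \<alpha>: "\<alpha> \<in> S0 (length hs)"
  then show "T_raw q (elem \<alpha> hs) \<in> perm_tens"
    unfolding T_raw_elem
    by (intro complex_vector.subspace_sum complex_vector.subspace_scale perm_tens_subspace
        perm_tens_elem) (auto simp: length_restr_keep perm_contr_S0)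
qed

lemma Tmap_TP: "\<xi> \<in> perm_tens \<Longrightarrow> Tmap q \<xi> \<in> TP"
  by (simp add: Tmap_T_raw Wmap_TP T_raw_perm_tens)

section \<open>Right multiplication as creation plus annihilation\<close>

lemma P12I: "\<pi> permutes {1..n} \<Longrightarrow> (\<And>x. \<pi> (\<pi> x) = x) \<Longrightarrow> \<pi> \<in> P12 n"
  unfolding P12_def by (auto intro!: ext)

lemma P12_Suc_fix:
  assumes "\<rho> \<in> P12 (Suc n)" "\<rho> (Suc n) = Suc n"
  shows "\<rho> \<in> P12 n"
proof -
  have "\<rho> permutes {1..Suc n}" using assms(1) by (rule P12_permutes)
  then have "\<rho> permutes {1..n}"
    using assms(2) by (rule_tac permutes_superset[of _ "{1..Suc n}"]) (auto simp: le_Suc_eq)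
  then show ?thesis using assms by (simp add: P12_def)
qed

lemma P12_mono: "\<pi> \<in> P12 n \<Longrightarrow> \<pi> \<in> P12 (Suc n)"
  unfolding P12_def by (auto intro: permutes_subset)

lemma P12_fix_top: "\<pi> \<in> P12 n \<Longrightarrow> \<pi> (Suc n) = Suc n"
  using permutes_not_in[OF P12_permutes] by simp

lemma keep_iff: "k \<in> keep n \<pi> \<longleftrightarrow> k \<le> n \<and> \<pi> k = k"
  by (auto simp: keep_def supp_def)

text \<open>As \<open>k\<close> and \<open>n + 1\<close> are fixed points of \<open>\<pi>\<close>, the product with their transposition adds the pair
  \<open>{k, n + 1}\<close> to \<open>\<pi>\<close>.\<close>

abbreviation pair_top :: "nat \<Rightarrow> nat \<Rightarrow> (nat \<Rightarrow> nat) \<Rightarrow> nat \<Rightarrow> nat" where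
  "pair_top n k \<pi> \<equiv> Transposition.transpose k (Suc n) \<circ> \<pi>"

lemma pair_top_apply:
  assumes "\<pi> \<in> P12 n" "k \<in> keep n \<pi>"
  shows "pair_top n k \<pi> x = (if x = k then Suc n else if x = Suc n then k else \<pi> x)"
proof -
  have inv: "\<pi> (\<pi> x) = x" for x using assms by simp
  have "\<pi> k = k" "\<pi> (Suc n) = Suc n" "k \<noteq> Suc n"
    using assms P12_fix_top by (auto simp: keep_iff)
  then have "\<pi> x = k \<longleftrightarrow> x = k" "\<pi> x = Suc n \<longleftrightarrow> x = Suc n" using inv by metis+
  then show ?thesis
    using \<open>\<pi> k = k\<close> \<open>\<pi> (Suc n) = Suc n\<close> by (auto simp: Transposition.transpose_def)
qed

lemma pair_top_P12:
  assumes \<pi>: "\<pi> \<in> P12 n" "k \<in> keep n \<pi> - {0}"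
  shows "pair_top n k \<pi> \<in> P12 (Suc n)"
proof -
  have k: "k \<in> keep n \<pi>" "k \<in> {1..Suc n}" using \<pi> by (auto simp: keep_iff)
  have "pair_top n k \<pi> permutes {1..Suc n}"
    using P12_permutes[OF P12_mono[OF \<pi>(1)]] k by (intro permutes_compose permutes_swap_id) auto
  moreover have "\<pi> x = k \<longleftrightarrow> x = k" "\<pi> x = Suc n \<longleftrightarrow> x = Suc n" for x
    using \<pi> k P12_fix_top[OF \<pi>(1)] P12_involution[OF \<pi>(1)] by (metis keep_iff)+
  then have "pair_top n k \<pi> (pair_top n k \<pi> x) = x" for x
    using \<pi> by (auto simp: pair_top_apply[OF \<pi>(1) k(1)] simp del: o_apply)
  ultimately show ?thesis by (rule P12I)
qed

text \<open>A pair partition of \<open>[n + 1]\<close> either leaves \<open>n + 1\<close> single or pairs it with a singleton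
  of a pair partition of \<open>[n]\<close>.\<close>

lemma sum_P12_Suc:
  "(\<Sum>\<pi>\<in>P12 (Suc n). f \<pi>) =
    (\<Sum>\<pi>\<in>P12 n. f \<pi>) + (\<Sum>\<pi>\<in>P12 n. \<Sum>k\<in>keep n \<pi> - {0}. f (pair_top n k \<pi>))"
proof -
  let ?F = "{\<rho> \<in> P12 (Suc n). \<rho> (Suc n) = Suc n}" and ?G = "{\<rho> \<in> P12 (Suc n). \<rho> (Suc n) \<noteq> Suc n}"
  have "P12 (Suc n) = ?F \<union> ?G" by auto
  then have "(\<Sum>\<pi>\<in>P12 (Suc n). f \<pi>) = sum f (?F \<union> ?G)" by (rule arg_cong[where f = "sum f"])
  also have "\<dots> = sum f ?F + sum f ?G"
    using finite_P12[of "Suc n"] by (intro sum.union_disjoint) auto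
  also have "?F = P12 n" using P12_Suc_fix P12_mono P12_fix_top by blast
  also have "sum f ?G = (\<Sum>(\<pi>, k)\<in>(SIGMA \<pi>:P12 n. keep n \<pi> - {0}). f (pair_top n k \<pi>))"
  proof (rule sym, rule sum.reindex_bij_witness[where
        i = "\<lambda>\<rho>. (pair_top n (\<rho> (Suc n)) \<rho>, \<rho> (Suc n))" and j = "\<lambda>(\<pi>, k). pair_top n k \<pi>"], goal_cases)
    case (1 x)
    then obtain \<pi> k where x: "x = (\<pi>, k)" "\<pi> \<in> P12 n" "k \<in> keep n \<pi>" by auto
    have "pair_top n k \<pi> (Suc n) = k"
      using x by (simp add: pair_top_apply[OF x(2,3)] keep_iff del: o_apply)
    then show ?case using x by (simp add: fun_eq_iff)
  next
    case (2 x)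
    then obtain \<pi> k where x: "x = (\<pi>, k)" "\<pi> \<in> P12 n" "k \<in> keep n \<pi>" "k \<noteq> 0" by auto
    have "pair_top n k \<pi> (Suc n) = k"
      using x by (simp add: pair_top_apply[OF x(2,3)] keep_iff del: o_apply)
    moreover have "k \<noteq> Suc n" using x by (auto simp: keep_iff)
    ultimately show ?case using x pair_top_P12[OF x(2)] by simp
  next
    case (3 \<rho>)
    then show ?case by (simp add: fun_eq_iff)
  next
    case (4 \<rho>)
    then have \<rho>: "\<rho> \<in> P12 (Suc n)" "\<rho> (Suc n) \<noteq> Suc n" by auto
    let ?k = "\<rho> (Suc n)"
    have inv: "\<rho> (\<rho> x) = x" for x using \<rho>(1) by simp
    have k: "?k \<in> {1..Suc n}" using Sn_in[OF P12_Sn[OF \<rho>(1)], of "Suc n"] by simp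
    have eq: "\<rho> x = ?k \<longleftrightarrow> x = Suc n" "\<rho> x = Suc n \<longleftrightarrow> x = ?k" for x using inv by metis+
    have app: "pair_top n ?k \<rho> x = (if x = ?k then ?k else if x = Suc n then Suc n else \<rho> x)" for x
      using eq[of x] inv by (auto simp: Transposition.transpose_def)
    have "pair_top n ?k \<rho> permutes {1..Suc n}"
      using P12_permutes[OF \<rho>(1)] k by (intro permutes_compose permutes_swap_id) auto
    moreover have "pair_top n ?k \<rho> (pair_top n ?k \<rho> x) = x" for x
      unfolding app using eq inv by auto
    ultimately have "pair_top n ?k \<rho> \<in> P12 (Suc n)" by (rule P12I)
    moreover have "pair_top n ?k \<rho> (Suc n) = Suc n" unfolding app using \<rho> by simp
    ultimately have "pair_top n ?k \<rho> \<in> P12 n" by (rule P12_Suc_fix)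
    moreover have "?k \<in> keep n (pair_top n ?k \<rho>) - {0}"
      using app[of ?k] k \<rho>(2) by (auto simp: keep_iff simp del: o_apply)
    ultimately show ?case by simp
  qed auto
  also have "\<dots> = (\<Sum>\<pi>\<in>P12 n. \<Sum>k\<in>keep n \<pi> - {0}. f (pair_top n k \<pi>))"
    by (subst sum.Sigma) (auto simp: finite_P12 finite_keep)
  finally show ?thesis .
qed

lemma ord_bij_insert_top:
  assumes "finite A" "\<And>a. a \<in> A \<Longrightarrow> a < N" "card A = Suc m" "x \<in> insert N A"
  shows "ord_bij (insert N A) {0..Suc m} x = (if x = N then Suc m else ord_bij A {0..m} x)"
proof (rule ord_bij_eqI[OF _ _ _ assms(4)])
  let ?f = "\<lambda>x. if x = N then Suc m else ord_bij A {0..m} x"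
  have c: "card A = card {0..m}" using assms by simp
  have le: "ord_bij A {0..m} a \<le> m" if "a \<in> A" for a
    using ord_bij_in[OF assms(1) _ c that] by simp
  have N: "N \<notin> A" using assms(2) by blast
  show "strict_mono_on (insert N A) ?f"
  proof (rule strict_mono_onI)
    fix r s assume rs: "r \<in> insert N A" "s \<in> insert N A" "r < s"
    then have r: "r \<in> A" "r \<noteq> N" using assms(2)[of s] by auto
    show "?f r < ?f s"
      using rs r le[OF r(1)] strict_mono_onD[OF ord_bij_strict_mono[OF assms(1) _ c], of r s] by auto
  qed
  have "?f ` A = ord_bij A {0..m} ` A" using N by (intro image_cong) auto
  also have "\<dots> = {0..m}" using assms(1) c by (intro ord_bij_image) auto
  finally have im: "?f ` A = {0..m}" .
  have "?f ` insert N A = insert (Suc m) (?f ` A)" by (simp only: image_insert) simp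
  also have "\<dots> = {0..Suc m}" unfolding im by auto
  finally show "?f ` insert N A = {0..Suc m}" .
qed simp

lemma transport_insert_top:
  assumes "finite A" "\<And>a. a \<in> A \<Longrightarrow> a < N" "card A = Suc m" "\<delta> permutes A"
  shows "transport (insert N A) {0..Suc m} \<delta> = transport A {0..m} \<delta>"
proof (rule transport_eqI)
  have c: "card A = card {0..m}" using assms by simp
  have N: "N \<notin> A" using assms(2) by blast
  have p: "transport A {0..m} \<delta> permutes {0..m}" using assms c by (intro transport_permutes) auto
  then show "transport A {0..m} \<delta> permutes {0..Suc m}" by (rule permutes_subset) auto
  fix x assume x: "x \<in> insert N A"
  have "\<delta> N = N" using N assms(4) by (simp add: permutes_not_in)
  moreover have "transport A {0..m} \<delta> (Suc m) = Suc m" using p by (simp add: permutes_not_in)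
  moreover have "\<delta> x \<in> A" "transport A {0..m} \<delta> (ord_bij A {0..m} x) = ord_bij A {0..m} (\<delta> x)" if "x \<in> A"
    using that assms c by (auto simp: permutes_in_image intro!: transport_apply)
  ultimately show "transport A {0..m} \<delta> (ord_bij (insert N A) {0..Suc m} x) =
      ord_bij (insert N A) {0..Suc m} (\<delta> x)"
    using x N by (auto simp: ord_bij_insert_top[OF assms(1-3)])
qed (use assms in \<open>auto simp: card_insert_if\<close>)

lemma cyc0_fix_top:
  assumes "\<gamma> permutes A" "finite A" "N \<notin> A" "N \<noteq> 0"
  shows "cyc0 (insert N A) \<gamma> = Suc (cyc0 A \<gamma>)"
proof -
  have N: "\<gamma> N = N" using assms by (simp add: permutes_not_in)
  then have "perm_del {N} \<gamma> = \<gamma>" using assms by (simp add: perm_del_single permutes_inj)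
  moreover have "\<gamma> permutes (insert N A)" using assms(1) by (rule permutes_subset) auto
  ultimately show ?thesis
    using cyc0_del[of \<gamma> "insert N A" N] assms N by simp
qed

lemma restr_append:
  assumes "A \<subseteq> {0..length hs}"
  shows "restr A (hs @ [h]) = restr A hs" "restr (insert (Suc (length hs)) A) (hs @ [h]) = restr A hs @ [h]"
proof -
  have "Suc (length hs) \<notin> A" using assms by auto
  then show "restr A (hs @ [h]) = restr A hs" by (simp add: restr_def nths_append)
  have "nths hs {j. Suc j = Suc (length hs) \<or> Suc j \<in> A} = nths hs {j. Suc j \<in> A}"
    unfolding nths_conv_map by (rule arg_cong[where f = "map ((!) hs)"], rule filter_cong) auto
  then show "restr (insert (Suc (length hs)) A) (hs @ [h]) = restr A hs @ [h]"
    by (simp add: restr_def nths_append)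
qed

text \<open>A slot \<open>n + 1\<close> that stays single and is a fixed point of the permutation goes along unchanged: it
  adds one cycle before and one after the deletion, which cancel in the exponent of \<open>q\<close>.\<close>

lemma singleton_top:
  assumes \<pi>: "\<pi> \<in> P12 n" and \<alpha>: "\<alpha> \<in> S0 n" and n: "n = length hs" and q: "q \<noteq> 0"
  shows "perm_contr_coeff q (Suc n) \<pi> \<alpha> = perm_contr_coeff q n \<pi> \<alpha>"
    "perm_contr (Suc n) \<pi> \<alpha> = perm_contr n \<pi> \<alpha>"
    "pair_prod (Suc n) \<pi> (hs @ [h]) = pair_prod n \<pi> hs"
    "restr (keep (Suc n) \<pi>) (hs @ [h]) = restr (keep n \<pi>) hs @ [h]"
proof -
  have \<gamma>: "\<pi> \<circ> \<alpha> permutes {0..n}" using P12_comp_S0[OF \<pi> \<alpha>] by (rule S0_permutes)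
  have \<delta>: "contr_perm \<pi> \<alpha> permutes keep n \<pi>" using \<pi> \<alpha> by (rule contr_perm_permutes)
  have keep: "keep (Suc n) \<pi> = insert (Suc n) (keep n \<pi>)"
    using P12_fix_top[OF \<pi>] by (auto simp: keep_iff)
  have le: "2 * npairs \<pi> \<le> n"
    using card_mono[OF _ supp_subset[OF \<pi>]] by (simp add: card_supp[OF \<pi>])
  have "cyc0 (insert (Suc n) {0..n}) (\<pi> \<circ> \<alpha>) = Suc (cyc0 {0..n} (\<pi> \<circ> \<alpha>))"
    using \<gamma> by (intro cyc0_fix_top) auto
  moreover have "insert (Suc n) {0..n} = {0..Suc n}" by auto
  moreover have "cyc0 (keep (Suc n) \<pi>) (contr_perm \<pi> \<alpha>) = Suc (cyc0 (keep n \<pi>) (contr_perm \<pi> \<alpha>))"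
    unfolding keep using \<delta> by (intro cyc0_fix_top) (auto simp: keep_def)
  ultimately show "perm_contr_coeff q (Suc n) \<pi> \<alpha> = perm_contr_coeff q n \<pi> \<alpha>"
    by (simp add: perm_contr_coeff_def keep_def[symmetric] contr_perm_def[symmetric])
  have "transport (insert (Suc n) (keep n \<pi>)) {0..Suc (n - 2 * npairs \<pi>)} (contr_perm \<pi> \<alpha>) =
      transport (keep n \<pi>) {0..n - 2 * npairs \<pi>} (contr_perm \<pi> \<alpha>)"
    using \<delta> card_keep[OF \<pi>]
    by (intro transport_insert_top) (auto simp: keep_def)
  then show "perm_contr (Suc n) \<pi> \<alpha> = perm_contr n \<pi> \<alpha>"
    using le
    by (simp add: perm_contr_def keep_def[symmetric] contr_perm_def[symmetric] keep Suc_diff_le)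
  have I: "{i \<in> {1..Suc n}. i < \<pi> i} = {i \<in> {1..n}. i < \<pi> i}"
    using P12_fix_top[OF \<pi>] by (auto simp: le_Suc_eq)
  have "\<pi> i \<in> {1..n}" if "i \<in> {1..n}" for i using Sn_in[OF P12_Sn[OF \<pi>]] that by blast
  then have "(hs @ [h]) ! (i - 1) = hs ! (i - 1) \<and> (hs @ [h]) ! (\<pi> i - 1) = hs ! (\<pi> i - 1)"
    if "i \<in> {1..n}" for i
    using that n by (fastforce simp: nth_append)
  then show "pair_prod (Suc n) \<pi> (hs @ [h]) = pair_prod n \<pi> hs"
    unfolding pair_prod_def I by (intro prod.cong refl) auto
  show "restr (keep (Suc n) \<pi>) (hs @ [h]) = restr (keep n \<pi>) hs @ [h]"
    using restr_append(2)[OF keep_subset[of "length hs" \<pi>], of h] n keep by simp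
qed

text \<open>Pairing \<open>n + 1\<close> with a surviving slot \<open>k\<close> amounts to contracting with \<open>\<pi>\<close> first and then
  annihilating the slot \<open>k\<close> of the result; the power of \<open>q\<close> records whether a cycle
  is lost.\<close>

lemma paired_top:
  fixes h :: "'a::real_inner"
  assumes \<pi>: "\<pi> \<in> P12 n" and \<alpha>: "\<alpha> \<in> S0 n" and n: "n = length hs" and q: "q \<noteq> 0"
    and k: "k \<in> keep n \<pi> - {0}"
  defines "m \<equiv> n - 2 * npairs \<pi>"
  defines "k' \<equiv> ord_bij (keep n \<pi>) {0..m} k"
  shows "perm_contr_coeff q (Suc n) (pair_top n k \<pi>) \<alpha> =
      perm_contr_coeff q n \<pi> \<alpha> * (if perm_contr n \<pi> \<alpha> k' = k' then 1 else q)"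
    "perm_contr (Suc n) (pair_top n k \<pi>) \<alpha> =
      transport ({0..m} - {k'}) {0..m - 1} (perm_del {k'} (perm_contr n \<pi> \<alpha>))"
    "pair_prod (Suc n) (pair_top n k \<pi>) (hs @ [h]) =
      pair_prod n \<pi> hs * inner (restr (keep n \<pi>) hs ! (k' - 1)) h"
    "restr (keep (Suc n) (pair_top n k \<pi>)) (hs @ [h]) = restr ({0..m} - {k'}) (restr (keep n \<pi>) hs)"
proof -
  let ?\<rho> = "pair_top n k \<pi>" and ?N = "Suc n" and ?\<delta> = "contr_perm \<pi> \<alpha>" and ?A = "keep n \<pi>"
  let ?\<tau> = "Transposition.transpose k ?N" and ?B = "{0..m}"
  have kA: "k \<in> ?A" "k \<noteq> 0" "k \<le> n" "\<pi> k = k" using k by (auto simp: keep_iff)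
  note \<rho> = pair_top_apply[OF \<pi> kA(1)]
  have \<rho>P: "?\<rho> \<in> P12 ?N" using \<pi> k by (rule pair_top_P12)
  have \<gamma>: "\<pi> \<circ> \<alpha> permutes {0..n}" using P12_comp_S0[OF \<pi> \<alpha>] by (rule S0_permutes)
  then have \<gamma>': "\<pi> \<circ> \<alpha> permutes {0..?N}" by (rule permutes_subset) auto
  have \<gamma>N: "(\<pi> \<circ> \<alpha>) ?N = ?N" using \<gamma> by (rule permutes_not_in) simp
  have \<delta>: "?\<delta> permutes ?A" using \<pi> \<alpha> by (rule contr_perm_permutes)
  have N: "?N \<notin> ?A" "k \<noteq> ?N" using kA by (auto simp: keep_def)
  have \<delta>N: "?\<delta> ?N = ?N" using \<delta> N by (simp add: permutes_not_in)
  have card: "card ?A = Suc m" using card_keep[OF \<pi>] by (simp add: m_def)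
  have supp: "supp ?\<rho> = supp \<pi> \<union> {?N} \<union> {k}"
    using N kA by (auto simp: supp_def \<rho> P12_fix_top[OF \<pi>] simp del: o_apply)
  have keep: "keep ?N ?\<rho> = ?A - {k}"
    unfolding keep_def supp by auto
  have "0 \<in> ?A" "0 \<noteq> k" using zero_keep[OF \<pi>] kA by auto
  then have "2 \<le> card ?A"
    using kA card_mono[of ?A "{0, k}"] finite_keep by auto
  then have m: "1 \<le> m" using card by simp
  have "card (supp ?\<rho>) = Suc (Suc (card (supp \<pi>)))"
    using N kA finite_supp[OF \<pi>] P12_fix_top[OF \<pi>] unfolding supp
    by (simp add: card_insert_if keep_def supp_def)
  then have np: "npairs ?\<rho> = Suc (npairs \<pi>)"
    by (simp add: card_supp[OF \<pi>] card_supp[OF \<rho>P])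
  \<comment> \<open>splicing the fixed point \<open>n + 1\<close> into the cycle of \<open>k\<close> and deleting it again\<close>
  have splice: "perm_del {?N} (?\<tau> \<circ> \<beta>) = \<beta>" if "inj \<beta>" "\<beta> ?N = ?N" for \<beta>
  proof -
    have "inj (?\<tau> \<circ> \<beta>)" using that by (simp add: inj_compose)
    then show ?thesis
      using that by (simp add: perm_del_single fun_eq_iff transpose_commute)
  qed
  have inj\<gamma>: "inj (\<pi> \<circ> \<alpha>)" "inj ?\<delta>" using \<gamma> \<delta> by (auto intro: permutes_inj)
  have \<tau>\<gamma>: "?\<tau> \<circ> (\<pi> \<circ> \<alpha>) permutes {0..?N}"
    by (rule permutes_compose[OF \<gamma>' permutes_swap_id]) (use kA in auto)
  have "cyc0 {0..?N} (?\<tau> \<circ> (\<pi> \<circ> \<alpha>)) = cyc0 ({0..?N} - {?N}) (perm_del {?N} (?\<tau> \<circ> (\<pi> \<circ> \<alpha>)))"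
    using N \<gamma>N by (subst cyc0_del[OF \<tau>\<gamma>, of ?N]) auto
  also have "{0..?N} - {?N} = {0..n}" by auto
  finally have cyc1: "cyc0 {0..?N} (?\<rho> \<circ> \<alpha>) = cyc0 {0..n} (\<pi> \<circ> \<alpha>)"
    using splice[OF inj\<gamma>(1) \<gamma>N] by (simp only: comp_assoc)
  have "perm_del (supp \<pi>) (?\<tau> \<circ> (\<pi> \<circ> \<alpha>)) = ?\<tau> \<circ> ?\<delta>"
    unfolding contr_perm_def
  proof (rule perm_del_comp_left[OF \<gamma>])
    fix x assume "x \<in> supp \<pi>"
    then have "x \<noteq> k" "x \<noteq> ?N" using kA supp_subset[OF \<pi>] by (auto simp: supp_def)
    then show "?\<tau> x = x" by simp
  qed simp_all
  moreover have fin: "finite (supp \<pi>)" using \<pi> by (rule finite_supp)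
  moreover have "perm_del (supp \<pi> \<union> {?N}) (?\<tau> \<circ> (\<pi> \<circ> \<alpha>)) = perm_del {?N} (perm_del (supp \<pi>) (?\<tau> \<circ> (\<pi> \<circ> \<alpha>)))"
    using fin \<tau>\<gamma> by (intro perm_del_Un[OF \<tau>\<gamma> _ perm_del_permutes[OF fin \<tau>\<gamma>]]) auto
  ultimately have d1: "perm_del (supp \<pi> \<union> {?N}) (?\<tau> \<circ> (\<pi> \<circ> \<alpha>)) = ?\<delta>"
    using splice[OF inj\<gamma>(2) \<delta>N] by simp
  have "perm_del (supp \<pi> \<union> {?N} \<union> {k}) (?\<tau> \<circ> (\<pi> \<circ> \<alpha>)) =
      perm_del {k} (perm_del (supp \<pi> \<union> {?N}) (?\<tau> \<circ> (\<pi> \<circ> \<alpha>)))"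
    by (rule perm_del_Un[OF \<tau>\<gamma> _ \<delta>[folded d1]]) (auto simp: finite_keep)
  then have del: "perm_del (supp ?\<rho>) (?\<rho> \<circ> \<alpha>) = perm_del {k} ?\<delta>"
    unfolding supp d1 by (simp only: comp_assoc)
  have cyc2: "int (cyc0 (?A - {k}) (perm_del {k} ?\<delta>)) =
      int (cyc0 ?A ?\<delta>) - (if ?\<delta> k = k then 1 else 0)"
    using cyc0_del[OF \<delta> finite_keep kA(1,2)] by simp
  have fA: "finite ?A" "finite ?B" "finite {0..m - 1}" "card ?A = card ?B" "card ?A = Suc (card {0..m - 1})"
    using card m by (simp_all add: finite_keep)
  have pc: "perm_contr n \<pi> \<alpha> = transport ?A ?B ?\<delta>"
    by (simp add: perm_contr_def contr_perm_def keep_def m_def)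
  have "perm_contr n \<pi> \<alpha> k' = ord_bij ?A ?B (?\<delta> k)"
    unfolding pc k'_def using fA kA by (intro transport_apply)
  then have fix_iff: "perm_contr n \<pi> \<alpha> k' = k' \<longleftrightarrow> ?\<delta> k = k"
    using ord_bij_inverse[OF fA(1,2,4)] kA(1) permutes_in_image[OF \<delta>, of k] by (metis k'_def)
  have e1: "perm_contr_coeff q ?N ?\<rho> \<alpha> = q powi (int (cyc0 (?A - {k}) (perm_del {k} ?\<delta>)) -
      int (cyc0 {0..n} (\<pi> \<circ> \<alpha>)) + int (Suc (npairs \<pi>)))"
    by (simp only: perm_contr_coeff_def keep_def[symmetric] del keep cyc1 np)
  have e2: "perm_contr_coeff q n \<pi> \<alpha> = q powi (int (cyc0 ?A ?\<delta>) -
      int (cyc0 {0..n} (\<pi> \<circ> \<alpha>)) + int (npairs \<pi>))"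
    by (simp only: perm_contr_coeff_def keep_def[symmetric] contr_perm_def[symmetric])
  show "perm_contr_coeff q (Suc n) ?\<rho> \<alpha> =
      perm_contr_coeff q n \<pi> \<alpha> * (if perm_contr n \<pi> \<alpha> k' = k' then 1 else q)"
    using q power_int_add_1[OF disjI1[OF q],
        of "int (cyc0 ?A ?\<delta>) - int (cyc0 {0..n} (\<pi> \<circ> \<alpha>)) + int (npairs \<pi>)"]
    unfolding e1 e2 cyc2 fix_iff by (auto simp: algebra_simps)
  have m': "Suc n - 2 * npairs ?\<rho> = m - 1" by (simp add: np m_def)
  show "perm_contr (Suc n) ?\<rho> \<alpha> =
      transport ({0..m} - {k'}) {0..m - 1} (perm_del {k'} (perm_contr n \<pi> \<alpha>))"
    unfolding perm_contr_def[of "Suc n"] keep_def[symmetric] del keep m' pc k'_def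
    by (rule transport_del[OF fA kA(1) \<delta>, symmetric])
  have k'B: "k' \<in> ?B" "k' \<noteq> 0"
    using ord_bij_in[OF fA(1,2,4) kA(1)] ord_bij_eq_0_iff[OF fA(1,2,4) kA(1) zero_keep[OF \<pi>]] kA
    by (simp_all add: k'_def)
  have hk: "restr ?A hs ! (k' - 1) = hs ! (k - 1)"
  proof -
    have "restr ?A hs ! (k' - 1) = hs ! (ord_bij ?B ?A k' - 1)"
      using restr_nth[of ?A hs k'] k'B keep_subset[of n \<pi>] zero_keep[OF \<pi>] card n by simp
    then show ?thesis using ord_bij_inverse[OF fA(1,2,4) kA(1)] by (simp add: k'_def)
  qed
  have I: "{i \<in> {1..?N}. i < ?\<rho> i} = insert k {i \<in> {1..n}. i < \<pi> i}"
    using kA by (auto simp: \<rho> simp del: o_apply)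
  have "k \<notin> {i \<in> {1..n}. i < \<pi> i}" using kA by simp
  moreover have "inner ((hs @ [h]) ! (i - 1)) ((hs @ [h]) ! (?\<rho> i - 1)) = inner (hs ! (i - 1)) (hs ! (\<pi> i - 1))"
    if "i \<in> {i \<in> {1..n}. i < \<pi> i}" for i
  proof -
    have "i \<noteq> k" "i \<noteq> ?N" using that kA by auto
    then have r: "?\<rho> i = \<pi> i" by (simp add: \<rho> del: o_apply)
    have "\<pi> i \<in> {1..n}" using Sn_in[OF P12_Sn[OF \<pi>]] that by blast
    then show ?thesis unfolding r using that n by (auto simp: nth_append)
  qed
  moreover have "inner ((hs @ [h]) ! (k - 1)) ((hs @ [h]) ! (?\<rho> k - 1)) = inner (hs ! (k - 1)) h"
    unfolding \<rho> using kA n by (auto simp: nth_append)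
  ultimately show "pair_prod (Suc n) ?\<rho> (hs @ [h]) =
      pair_prod n \<pi> hs * inner (restr ?A hs ! (k' - 1)) h"
    unfolding pair_prod_def I hk by (subst prod.insert) (auto intro!: prod.cong)
  have lr: "length (restr ?A hs) = m"
    using length_restr[of ?A hs] keep_subset[of n \<pi>] zero_keep[OF \<pi>] card n by simp
  have subs: "?A - {k} \<subseteq> {0..length hs}" "0 \<in> ?A - {k}" "card (?A - {k}) = m"
    using keep_subset[of n \<pi>] zero_keep[OF \<pi>] kA card n finite_keep by auto
  have subs': "?B - {k'} \<subseteq> {0..length (restr ?A hs)}" "0 \<in> ?B - {k'}" "card (?B - {k'}) = m"
    using k'B by (auto simp: lr)
  have "restr (?A - {k}) hs = restr (?B - {k'}) (restr ?A hs)"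
  proof (rule slots_eqI)
    show "length (restr (?A - {k}) hs) = length (restr (?B - {k'}) (restr ?A hs))"
      using length_restr[OF subs(1,2)] length_restr[OF subs'(1,2)] subs subs' by simp
    fix i assume "i \<in> {1..length (restr (?B - {k'}) (restr ?A hs))}"
    then have i: "i \<in> {1..m - 1}" using length_restr[OF subs'(1,2)] subs' by simp
    define x where "x = ord_bij {0..m - 1} (?A - {k}) i"
    have ci: "card {0..m - 1} = card (?A - {k})" "card {0..m - 1} = card (?B - {k'})"
      using subs subs' m by auto
    have x: "x \<in> ?A - {k}"
      unfolding x_def using ci i by (intro ord_bij_in) (auto simp: finite_keep)
    have "ord_bij (?A - {k}) {0..m - 1} x = i"
      unfolding x_def using ci i by (intro ord_bij_inverse) (auto simp: finite_keep)
    then have "ord_bij (?B - {k'}) {0..m - 1} (ord_bij ?A ?B x) = i"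
      using ord_bij_del[OF fA kA(1) x] by (simp add: k'_def)
    moreover have "ord_bij ?A ?B x \<in> ?B - {k'}"
      using x ord_bij_in[OF fA(1,2,4), of x] ord_bij_inverse[OF fA(1,2,4), of x]
        ord_bij_inverse[OF fA(1,2,4) kA(1)] by (auto simp: k'_def)
    ultimately have y: "ord_bij {0..m - 1} (?B - {k'}) i = ord_bij ?A ?B x"
      using ord_bij_inverse[of "?B - {k'}" "{0..m - 1}" "ord_bij ?A ?B x"] ci by simp
    have "restr (?B - {k'}) (restr ?A hs) ! (i - 1) = restr ?A hs ! (ord_bij ?A ?B x - 1)"
      using restr_nth[OF subs'(1,2), of i, unfolded subs'(3), OF i] unfolding y .
    also have "\<dots> = hs ! (x - 1)"
    proof -
      have "x \<noteq> 0"
        using ord_bij_eq_0_iff[of "{0..m - 1}" "?A - {k}" i] ci i subs by (auto simp: x_def finite_keep)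
      then have "ord_bij ?A ?B x \<in> {1..m}"
        using x ord_bij_in[OF fA(1,2,4), of x] ord_bij_eq_0_iff[OF fA(1,2,4), of x] zero_keep[OF \<pi>]
        by (simp add: Suc_le_eq)
      then show ?thesis
        using restr_nth[of ?A hs "ord_bij ?A ?B x"] keep_subset[of n \<pi>] zero_keep[OF \<pi>] card n x
          ord_bij_inverse[OF fA(1,2,4), of x] by simp
    qed
    also have "\<dots> = restr (?A - {k}) hs ! (i - 1)"
      using restr_nth[OF subs(1,2), of i, unfolded subs(3), OF i] unfolding x_def by (rule sym)
    finally show "restr (?A - {k}) hs ! (i - 1) = restr (?B - {k'}) (restr ?A hs) ! (i - 1)" by simp
  qed
  moreover have "restr (?A - {k}) (hs @ [h]) = restr (?A - {k}) hs"
    by (rule restr_append(1)) (use subs in blast)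
  ultimately show "restr (keep (Suc n) ?\<rho>) (hs @ [h]) = restr (?B - {k'}) (restr ?A hs)"
    by (simp add: keep)
qed

text \<open>The pair partitions with \<open>n + 1\<close> single give the creation term, those in which \<open>n + 1\<close> is paired give
  the annihilation term. This is the decomposition of the field operator in algebraic form.\<close>

lemma T_raw_creat:
  assumes q: "q \<noteq> 0" and \<xi>: "\<xi> \<in> perm_tens"
  shows "T_raw q (creat h \<xi>) = creat h (T_raw q \<xi>) + annih q h (T_raw q \<xi>)"
  using \<xi>
proof (rule clinear_perm_tens_eqI)
  show "clinear (\<lambda>\<xi>. T_raw q (creat h \<xi>))"
    by (rule clinear_compose[OF clinear_T_raw clinear_creat])
  show "clinear (\<lambda>\<xi>. creat h (T_raw q \<xi>) + annih q h (T_raw q \<xi>))"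
    by (rule clinear_plus[OF clinear_compose[OF clinear_creat clinear_T_raw]
          clinear_compose[OF clinear_annih clinear_T_raw]])
  fix \<alpha> and hs :: "'a list"
  assume \<alpha>: "\<alpha> \<in> S0 (length hs)"
  let ?n = "length hs"
  let ?t = "\<lambda>n \<pi> hs. of_real (perm_contr_coeff q n \<pi> \<alpha> * pair_prod n \<pi> hs) *\<^sub>C
    elem (perm_contr n \<pi> \<alpha>) (restr (keep n \<pi>) hs)"
  have "creat h (T_raw q (elem \<alpha> hs)) = (\<Sum>\<pi>\<in>P12 ?n. ?t (Suc ?n) \<pi> (hs @ [h]))"
    unfolding T_raw_elem clinear_sum[OF clinear_creat] clinear_scale[OF clinear_creat] creat_elem
    using singleton_top[OF _ \<alpha> refl q] by (intro sum.cong refl) simp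
  moreover have "annih q h (T_raw q (elem \<alpha> hs)) =
      (\<Sum>\<pi>\<in>P12 ?n. \<Sum>k\<in>keep ?n \<pi> - {0}. ?t (Suc ?n) (pair_top ?n k \<pi>) (hs @ [h]))"
    unfolding T_raw_elem clinear_sum[OF clinear_annih] clinear_scale[OF clinear_annih]
  proof (intro sum.cong refl)
    fix \<pi> assume \<pi>: "\<pi> \<in> P12 ?n"
    let ?A = "keep ?n \<pi>" and ?m = "?n - 2 * npairs \<pi>"
    let ?e = "ord_bij ?A {0..?m}" and ?c = "perm_contr_coeff q ?n \<pi> \<alpha> * pair_prod ?n \<pi> hs"
    let ?g = "\<lambda>k. of_real ((if perm_contr ?n \<pi> \<alpha> k = k then 1 else q) * inner (restr ?A hs ! (k - 1)) h) *\<^sub>C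
        elem (transport ({0..?m} - {k}) {0..?m - 1} (perm_del {k} (perm_contr ?n \<pi> \<alpha>)))
          (restr ({0..?m} - {k}) (restr ?A hs))"
    have fA: "finite ?A" "finite {0..?m}" "card ?A = card {0..?m}"
      using card_keep[OF \<pi>] by (simp_all add: finite_keep)
    have "bij_betw ?e ?A {0..?m}"
      using fA by (simp add: bij_betw_def ord_bij_image ord_bij_strict_mono strict_mono_on_imp_inj_on)
    then have "bij_betw ?e (?A - {0}) ({0..?m} - {?e 0})"
      using zero_keep[OF \<pi>] by (intro bij_betw_DiffI) (auto simp: bij_betw_def)
    moreover have "{0..?m} - {?e 0} = {1..?m}" by (auto simp: ord_bij_0)
    ultimately have bij: "bij_betw ?e (?A - {0}) {1..?m}" by simp
    have "annih q h (elem (perm_contr ?n \<pi> \<alpha>) (restr ?A hs)) = (\<Sum>k\<in>{1..?m}. ?g k)"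
      unfolding annih_elem length_restr_keep[OF \<pi>] by simp
    also have "\<dots> = (\<Sum>k\<in>?A - {0}. ?g (?e k))"
      using bij by (rule sum.reindex_bij_betw[symmetric])
    finally have eq: "annih q h (elem (perm_contr ?n \<pi> \<alpha>) (restr ?A hs)) = (\<Sum>k\<in>?A - {0}. ?g (?e k))" .
    show "of_real ?c *\<^sub>C annih q h (elem (perm_contr ?n \<pi> \<alpha>) (restr ?A hs)) =
        (\<Sum>k\<in>?A - {0}. ?t (Suc ?n) (pair_top ?n k \<pi>) (hs @ [h]))"
      unfolding eq complex_vector.scale_sum_right
    proof (rule sum.cong[OF refl])
      fix k assume k: "k \<in> ?A - {0}"
      note p = paired_top[OF \<pi> \<alpha> refl q k]
      show "of_real ?c *\<^sub>C ?g (?e k) = ?t (Suc ?n) (pair_top ?n k \<pi>) (hs @ [h])"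
        unfolding p by (simp add: scaleC_scaleC mult_ac)
    qed
  qed
  ultimately show "T_raw q (creat h (elem \<alpha> hs)) =
      creat h (T_raw q (elem \<alpha> hs)) + annih q h (T_raw q (elem \<alpha> hs))"
    by (simp add: creat_elem T_raw_elem sum_P12_Suc)
qed

section \<open>\<open>T\<close> as a bijection of the symmetric tensors\<close>

lemma P12_conj:
  assumes "\<pi> \<in> P12 n" "\<sigma> \<in> Sn n"
  shows "\<sigma> \<circ> \<pi> \<circ> inv \<sigma> \<in> P12 n"
proof (rule P12I)
  show "\<sigma> \<circ> \<pi> \<circ> inv \<sigma> permutes {1..n}"
    using P12_permutes[OF assms(1)] Sn_permutes[OF assms(2)]
    by (intro permutes_compose permutes_inv)
  show "(\<sigma> \<circ> \<pi> \<circ> inv \<sigma>) ((\<sigma> \<circ> \<pi> \<circ> inv \<sigma>) x) = x" for x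
    using assms by (simp add: Sn_inv_apply[OF assms(2)])
qed

lemma supp_conj:
  assumes "\<sigma> \<in> Sn n"
  shows "supp (\<sigma> \<circ> \<pi> \<circ> inv \<sigma>) = \<sigma> ` supp \<pi>"
proof
  note inv = Sn_inv_apply[OF assms]
  show "supp (\<sigma> \<circ> \<pi> \<circ> inv \<sigma>) \<subseteq> \<sigma> ` supp \<pi>"
  proof
    fix x assume "x \<in> supp (\<sigma> \<circ> \<pi> \<circ> inv \<sigma>)"
    then have "\<pi> (inv \<sigma> x) \<noteq> inv \<sigma> x" using inv(2)[of x] by (auto simp: supp_def)
    then show "x \<in> \<sigma> ` supp \<pi>" using inv(2)[of x] by (intro image_eqI[of x \<sigma> "inv \<sigma> x"]) (auto simp: supp_def)
  qed
  show "\<sigma> ` supp \<pi> \<subseteq> supp (\<sigma> \<circ> \<pi> \<circ> inv \<sigma>)"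
  proof
    fix y assume "y \<in> \<sigma> ` supp \<pi>"
    then obtain x where x: "y = \<sigma> x" "\<pi> x \<noteq> x" by (auto simp: supp_def)
    then have "\<sigma> (\<pi> x) \<noteq> \<sigma> x" using inv(1) by metis
    then show "y \<in> supp (\<sigma> \<circ> \<pi> \<circ> inv \<sigma>)" using x by (simp add: supp_def inv)
  qed
qed

lemma keep_conj:
  assumes "\<sigma> \<in> Sn n"
  shows "keep n (\<sigma> \<circ> \<pi> \<circ> inv \<sigma>) = \<sigma> ` keep n \<pi>"
  unfolding keep_def supp_conj[OF assms]
  using Sn_image[OF assms] image_set_diff[OF bij_is_inj[OF Sn_bij[OF assms]]] by metis

lemma npairs_conj: "\<sigma> \<in> Sn n \<Longrightarrow> npairs (\<sigma> \<circ> \<pi> \<circ> inv \<sigma>) = npairs \<pi>"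
  by (simp add: npairs_def supp_conj card_image inj_on_subset[OF bij_is_inj[OF Sn_bij]])

text \<open>The two products run over different representatives of corresponding pairs, which is
  harmless because the inner product is symmetric.\<close>

lemma pair_prod_conj:
  assumes \<pi>: "\<pi> \<in> P12 (length hs)" and \<sigma>: "\<sigma> \<in> Sn (length hs)"
  shows "pair_prod (length hs) (\<sigma> \<circ> \<pi> \<circ> inv \<sigma>) (perm_list \<sigma> hs) = pair_prod (length hs) \<pi> hs"
proof -
  let ?n = "length hs"
  have inv: "inv \<sigma> (\<sigma> x) = x" "\<sigma> (inv \<sigma> x) = x" for x using \<sigma> by (simp_all add: Sn_inv_apply)
  have \<pi>\<pi>: "\<pi> (\<pi> x) = x" for x using \<pi> by simp
  have ran: "\<sigma> x \<in> {1..?n} \<longleftrightarrow> x \<in> {1..?n}" "inv \<sigma> x \<in> {1..?n} \<longleftrightarrow> x \<in> {1..?n}"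
    "\<pi> x \<in> {1..?n} \<longleftrightarrow> x \<in> {1..?n}" for x
    using Sn_in[OF \<sigma>] Sn_in[OF Sn_inv[OF \<sigma>]] Sn_in[OF P12_Sn[OF \<pi>]] by blast+
  have inj: "\<sigma> x = \<sigma> y \<longleftrightarrow> x = y" "inv \<sigma> x = inv \<sigma> y \<longleftrightarrow> x = y" for x y using inv by metis+
  \<comment> \<open>\<open>t\<close> sends the smaller point of a pair to the smaller point of the image pair\<close>
  define t where "t i = (if \<sigma> i < \<sigma> (\<pi> i) then \<sigma> i else \<sigma> (\<pi> i))" for i
  define u where "u j = (if inv \<sigma> j < \<pi> (inv \<sigma> j) then inv \<sigma> j else \<pi> (inv \<sigma> j))" for j
  have "(\<Prod>i\<in>{i \<in> {1..?n}. i < \<pi> i}. inner (hs ! (i - 1)) (hs ! (\<pi> i - 1))) =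
     (\<Prod>j\<in>{j \<in> {1..?n}. j < \<sigma> (\<pi> (inv \<sigma> j))}. inner (hs ! (inv \<sigma> j - 1)) (hs ! (\<pi> (inv \<sigma> j) - 1)))"
  proof (rule prod.reindex_bij_witness[where j = t and i = u])
    fix i assume i: "i \<in> {i \<in> {1..?n}. i < \<pi> i}"
    then have ne: "\<sigma> i \<noteq> \<sigma> (\<pi> i)" using inj by auto
    show "u (t i) = i" using i by (auto simp: t_def u_def inv \<pi>\<pi>)
    have "\<sigma> i \<in> {1..?n}" "\<sigma> (\<pi> i) \<in> {1..?n}" using i ran by blast+
    then show "t i \<in> {j \<in> {1..?n}. j < \<sigma> (\<pi> (inv \<sigma> j))}"
      using ne by (auto simp: t_def inv \<pi>\<pi>)
    show "inner (hs ! (inv \<sigma> (t i) - 1)) (hs ! (\<pi> (inv \<sigma> (t i)) - 1)) =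
        inner (hs ! (i - 1)) (hs ! (\<pi> i - 1))"
      by (auto simp: t_def inv \<pi>\<pi> inner_commute)
  next
    fix j assume j: "j \<in> {j \<in> {1..?n}. j < \<sigma> (\<pi> (inv \<sigma> j))}"
    then have ne: "inv \<sigma> j \<noteq> \<pi> (inv \<sigma> j)" using inv by (metis (no_types, lifting) less_irrefl mem_Collect_eq)
    show "t (u j) = j" using j by (auto simp: t_def u_def inv \<pi>\<pi>)
    have "inv \<sigma> j \<in> {1..?n}" "\<pi> (inv \<sigma> j) \<in> {1..?n}" using j ran by blast+
    then show "u j \<in> {i \<in> {1..?n}. i < \<pi> i}"
      using ne by (auto simp: u_def \<pi>\<pi>)
  qed
  moreover have "inner (perm_list \<sigma> hs ! (j - 1)) (perm_list \<sigma> hs ! (\<sigma> (\<pi> (inv \<sigma> j)) - 1)) =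
      inner (hs ! (inv \<sigma> j - 1)) (hs ! (\<pi> (inv \<sigma> j) - 1))" if "j \<in> {1..?n}" for j
  proof -
    have "\<sigma> (\<pi> (inv \<sigma> j)) \<in> {1..?n}" using that ran by blast
    then show ?thesis using that by (simp only: perm_list_nth inv)
  qed
  ultimately show ?thesis by (simp add: pair_prod_def)
qed

lemma perm_contr_coeff_conj:
  assumes \<pi>: "\<pi> \<in> P12 n" and \<alpha>: "\<alpha> \<in> S0 n" and \<sigma>: "\<sigma> \<in> Sn n"
  shows "perm_contr_coeff q n (\<sigma> \<circ> \<pi> \<circ> inv \<sigma>) (\<sigma> \<circ> \<alpha> \<circ> inv \<sigma>) = perm_contr_coeff q n \<pi> \<alpha>"
    "contr_perm (\<sigma> \<circ> \<pi> \<circ> inv \<sigma>) (\<sigma> \<circ> \<alpha> \<circ> inv \<sigma>) = \<sigma> \<circ> contr_perm \<pi> \<alpha> \<circ> inv \<sigma>"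
proof -
  have b: "bij \<sigma>" "\<sigma> 0 = 0" using \<sigma> by (simp_all add: Sn_bij Sn_zero)
  have comp: "(\<sigma> \<circ> \<pi> \<circ> inv \<sigma>) \<circ> (\<sigma> \<circ> \<alpha> \<circ> inv \<sigma>) = \<sigma> \<circ> (\<pi> \<circ> \<alpha>) \<circ> inv \<sigma>"
    using Sn_inv_apply(1)[OF \<sigma>] by (simp add: fun_eq_iff)
  show c: "contr_perm (\<sigma> \<circ> \<pi> \<circ> inv \<sigma>) (\<sigma> \<circ> \<alpha> \<circ> inv \<sigma>) = \<sigma> \<circ> contr_perm \<pi> \<alpha> \<circ> inv \<sigma>"
    unfolding contr_perm_def comp supp_conj[OF \<sigma>]
    by (rule perm_del_conj[OF S0_permutes[OF P12_comp_S0[OF \<pi> \<alpha>]] _ b(1)]) simp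
  have "cyc0 (keep n (\<sigma> \<circ> \<pi> \<circ> inv \<sigma>)) (contr_perm (\<sigma> \<circ> \<pi> \<circ> inv \<sigma>) (\<sigma> \<circ> \<alpha> \<circ> inv \<sigma>)) =
      cyc0 (keep n \<pi>) (contr_perm \<pi> \<alpha>)"
    unfolding c keep_conj[OF \<sigma>] by (rule cyc0_conj[OF b])
  moreover have "cyc0 {0..n} (\<sigma> \<circ> (\<pi> \<circ> \<alpha>) \<circ> inv \<sigma>) = cyc0 {0..n} (\<pi> \<circ> \<alpha>)"
    using cyc0_conj[OF b, of "{0..n}"] by (simp add: Sn_image[OF \<sigma>])
  ultimately show "perm_contr_coeff q n (\<sigma> \<circ> \<pi> \<circ> inv \<sigma>) (\<sigma> \<circ> \<alpha> \<circ> inv \<sigma>) = perm_contr_coeff q n \<pi> \<alpha>"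
    unfolding perm_contr_coeff_def keep_def[symmetric] contr_perm_def[symmetric]
    unfolding comp npairs_conj[OF \<sigma>] by (simp only:)
qed

lemma Tmap_elem:
  "Tmap q (elem \<alpha> hs) = (\<Sum>\<pi>\<in>P12 (length hs).
    of_real (perm_contr_coeff q (length hs) \<pi> \<alpha> * pair_prod (length hs) \<pi> hs) *\<^sub>C
    Wmap (elem (perm_contr (length hs) \<pi> \<alpha>) (restr (keep (length hs) \<pi>) hs)))"
  by (simp add: Tmap_T_raw T_raw_elem clinear_sum[OF clinear_Wmap] clinear_scale[OF clinear_Wmap])

text \<open>A permutation of the slots conjugates the pair partitions and so only reorders the summands of
  \<open>T\<close>; each contracted tensor changes by the induced permutation of the surviving slots, which the
  symmetrisation removes.\<close>

lemma Tmap_conj: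
  assumes \<alpha>: "\<alpha> \<in> S0 (length hs)" and \<sigma>: "\<sigma> \<in> Sn (length hs)"
  shows "Tmap q (elem (\<sigma> \<circ> \<alpha> \<circ> inv \<sigma>) (perm_list \<sigma> hs)) = Tmap q (elem \<alpha> hs)"
proof -
  let ?n = "length hs"
  let ?t = "\<lambda>\<pi> \<alpha> hs. of_real (perm_contr_coeff q ?n \<pi> \<alpha> * pair_prod ?n \<pi> hs) *\<^sub>C
    Wmap (elem (perm_contr ?n \<pi> \<alpha>) (restr (keep ?n \<pi>) hs))"
  have "?t (\<sigma> \<circ> \<pi> \<circ> inv \<sigma>) (\<sigma> \<circ> \<alpha> \<circ> inv \<sigma>) (perm_list \<sigma> hs) = ?t \<pi> \<alpha> hs" if \<pi>: "\<pi> \<in> P12 ?n" for \<pi>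
  proof -
    let ?m = "?n - 2 * npairs \<pi>"
    obtain \<tau> where \<tau>: "\<tau> \<in> Sn ?m"
      "transport (\<sigma> ` keep ?n \<pi>) {0..?m} (\<sigma> \<circ> contr_perm \<pi> \<alpha> \<circ> inv \<sigma>) =
        \<tau> \<circ> transport (keep ?n \<pi>) {0..?m} (contr_perm \<pi> \<alpha>) \<circ> inv \<tau>"
      "restr (\<sigma> ` keep ?n \<pi>) (perm_list \<sigma> hs) = perm_list \<tau> (restr (keep ?n \<pi>) hs)"
      using transport_relabel[OF \<sigma> keep_subset zero_keep[OF \<pi>] card_keep[OF \<pi>] contr_perm_permutes[OF \<pi> \<alpha>]]
      by blast
    have "perm_contr ?n (\<sigma> \<circ> \<pi> \<circ> inv \<sigma>) (\<sigma> \<circ> \<alpha> \<circ> inv \<sigma>) = \<tau> \<circ> perm_contr ?n \<pi> \<alpha> \<circ> inv \<tau>"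
      unfolding perm_contr_def keep_def[symmetric] contr_perm_def[symmetric]
        perm_contr_coeff_conj[OF \<pi> \<alpha> \<sigma>] keep_conj[OF \<sigma>] npairs_conj[OF \<sigma>] by (rule \<tau>(2))
    moreover have "restr (keep ?n (\<sigma> \<circ> \<pi> \<circ> inv \<sigma>)) (perm_list \<sigma> hs) = perm_list \<tau> (restr (keep ?n \<pi>) hs)"
      unfolding keep_conj[OF \<sigma>] by (rule \<tau>(3))
    moreover have "\<tau> \<in> Sn (length (restr (keep ?n \<pi>) hs))"
      using \<tau>(1) length_restr_keep[OF \<pi>] by simp
    ultimately show ?thesis
      by (simp only: Wmap_conj perm_contr_coeff_conj[OF \<pi> \<alpha> \<sigma>] pair_prod_conj[OF \<pi> \<sigma>])
  qed
  then have "(\<Sum>\<pi>\<in>P12 ?n. ?t \<pi> \<alpha> hs) =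
      (\<Sum>\<pi>\<in>P12 ?n. ?t (\<sigma> \<circ> \<pi> \<circ> inv \<sigma>) (\<sigma> \<circ> \<alpha> \<circ> inv \<sigma>) (perm_list \<sigma> hs))"
    by (intro sum.cong refl) simp
  also have "\<dots> = (\<Sum>\<pi>\<in>P12 ?n. ?t \<pi> (\<sigma> \<circ> \<alpha> \<circ> inv \<sigma>) (perm_list \<sigma> hs))"
  proof (rule sum.reindex_bij_witness[where i = "\<lambda>\<pi>. inv \<sigma> \<circ> \<pi> \<circ> \<sigma>" and j = "\<lambda>\<pi>. \<sigma> \<circ> \<pi> \<circ> inv \<sigma>"])
    fix \<pi> assume \<pi>: "\<pi> \<in> P12 ?n"
    show "inv \<sigma> \<circ> (\<sigma> \<circ> \<pi> \<circ> inv \<sigma>) \<circ> \<sigma> = \<pi>" "\<sigma> \<circ> (inv \<sigma> \<circ> \<pi> \<circ> \<sigma>) \<circ> inv \<sigma> = \<pi>"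
      by (simp_all add: fun_eq_iff Sn_inv_apply[OF \<sigma>])
    show "\<sigma> \<circ> \<pi> \<circ> inv \<sigma> \<in> P12 ?n" using \<pi> \<sigma> by (rule P12_conj)
    show "inv \<sigma> \<circ> \<pi> \<circ> \<sigma> \<in> P12 ?n"
      using P12_conj[OF \<pi> Sn_inv[OF \<sigma>]] by (simp add: inv_inv_eq Sn_bij[OF \<sigma>])
  qed simp
  finally show ?thesis by (simp only: Tmap_elem length_perm_list)
qed

lemma Tmap_Wmap:
  assumes "\<xi> \<in> perm_tens"
  shows "Tmap q (Wmap \<xi>) = Tmap q \<xi>"
  using assms clinear_compose[OF clinear_Tmap clinear_Wmap] clinear_Tmap
proof (rule clinear_perm_tens_eqI)
  fix \<alpha> and hs :: "'a list" assume "\<alpha> \<in> S0 (length hs)"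
  then have "Tmap q (Wmap (elem \<alpha> hs)) =
      (1 / fact (length hs)) *\<^sub>C (\<Sum>\<sigma>\<in>Sn (length hs). Tmap q (elem \<alpha> hs))"
    by (simp add: Wmap_elem clinear_scale[OF clinear_Tmap] clinear_sum[OF clinear_Tmap] Tmap_conj)
  then show "Tmap q (Wmap (elem \<alpha> hs)) = Tmap q (elem \<alpha> hs)"
    by (simp add: sum_scaleC_const card_Sn scaleC_scaleC scaleC_one)
qed

definition TP_below :: "nat \<Rightarrow> 'a::real_inner ptens set" where
  "TP_below m = cspan {Wmap (elem \<alpha> hs) |\<alpha> hs. \<alpha> \<in> S0 (length hs) \<and> length hs < m}"

lemma TP_below_subspace: "complex_vector.subspace (TP_below m)"
  unfolding TP_below_def by (rule complex_vector.subspace_span)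

lemma TP_below_base: "\<alpha> \<in> S0 (length hs) \<Longrightarrow> length hs < m \<Longrightarrow> Wmap (elem \<alpha> hs) \<in> TP_below m"
  unfolding TP_below_def by (rule complex_vector.span_base) blast

lemma TP_below_0: "TP_below 0 = {0}"
  by (simp add: TP_below_def)

lemma TP_below_TP: "TP_below m \<subseteq> TP"
  unfolding TP_below_def
  by (rule complex_vector.span_minimal[OF _ TP_subspace]) (auto simp: Wmap_TP perm_tens_elem)

lemma TP_below_mono: "m \<le> n \<Longrightarrow> TP_below m \<subseteq> TP_below n"
  unfolding TP_below_def by (rule complex_vector.span_mono) (blast intro: less_le_trans)

lemma TP_in_below:
  assumes "\<xi> \<in> TP"
  shows "\<exists>m. \<xi> \<in> TP_below m"
proof -
  have "\<exists>m. Wmap \<zeta> \<in> TP_below m" if "\<zeta> \<in> perm_tens" for \<zeta> :: "'a ptens"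
    using that
  proof (induction rule: perm_tens_induct)
    case zero
    then show ?case
      using complex_vector.subspace_0[OF TP_below_subspace]
      by (intro exI[of _ 0]) (simp add: clinear_zero[OF clinear_Wmap])
  next
    case (add c \<alpha> hs \<zeta>)
    then obtain m where m: "Wmap \<zeta> \<in> TP_below m" by blast
    let ?m = "max m (Suc (length hs))"
    have "Wmap (elem \<alpha> hs) \<in> TP_below ?m"
      using add by (intro TP_below_base) auto
    moreover have "Wmap \<zeta> \<in> TP_below ?m" using m TP_below_mono[of m ?m] by auto
    ultimately show ?case
      by (auto simp: clinear_add[OF clinear_Wmap] clinear_scale[OF clinear_Wmap] TP_below_subspace
          intro!: exI[of _ ?m] complex_vector.subspace_add complex_vector.subspace_scale)
  qed
  then show ?thesis using assms TP_perm_tens Wmap_id by metis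
qed

lemma trivial_contraction:
  assumes "\<alpha> \<in> S0 (length hs)"
  shows "perm_contr_coeff q (length hs) id \<alpha> = 1" "pair_prod (length hs) id hs = 1"
    "perm_contr (length hs) id \<alpha> = \<alpha>" "restr (keep (length hs) id) hs = hs"
proof -
  have s: "supp id = {}" by (simp add: supp_def)
  then show "perm_contr_coeff q (length hs) id \<alpha> = 1"
    by (simp add: perm_contr_coeff_def npairs_def)
  show "pair_prod (length hs) id hs = 1" by (simp add: pair_prod_def)
  show "perm_contr (length hs) id \<alpha> = \<alpha>"
    using assms by (simp add: perm_contr_def s npairs_def transport_self S0_permutes)
  show "restr (keep (length hs) id) hs = hs"
    unfolding restr_keep s by (simp add: nths_all)
qed

text \<open>The nontrivial contractions lower the degree. Hence \<open>T\<close> is the identity plus a map that is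
  nilpotent on each of the spaces \<open>TP_below m\<close>, and such a map is bijective.\<close>

lemma Tmap_diff_below:
  assumes "\<xi> \<in> TP_below (Suc m)"
  shows "Tmap q \<xi> - \<xi> \<in> TP_below m"
  using assms unfolding TP_below_def[of "Suc m"]
proof (induction rule: complex_vector.span_induct_alt)
  case base
  then show ?case using complex_vector.subspace_0[OF TP_below_subspace]
    by (simp add: clinear_zero[OF clinear_Tmap])
next
  case (step c x y)
  then obtain \<alpha> hs where x: "x = Wmap (elem \<alpha> hs)" and \<alpha>: "\<alpha> \<in> S0 (length hs)" and n: "length hs \<le> m"
    by (auto simp: less_Suc_eq_le)
  let ?n = "length hs"
  let ?t = "\<lambda>\<pi>. of_real (perm_contr_coeff q ?n \<pi> \<alpha> * pair_prod ?n \<pi> hs) *\<^sub>C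
    Wmap (elem (perm_contr ?n \<pi> \<alpha>) (restr (keep ?n \<pi>) hs))"
  have "Tmap q x = Tmap q (elem \<alpha> hs)"
    unfolding x using \<alpha> by (intro Tmap_Wmap perm_tens_elem)
  also have "\<dots> = (\<Sum>\<pi>\<in>P12 ?n. ?t \<pi>)" by (rule Tmap_elem)
  also have "\<dots> = ?t id + (\<Sum>\<pi>\<in>P12 ?n - {id}. ?t \<pi>)"
    by (rule sum.remove[OF finite_P12 P12_id])
  also have "?t id = x"
    by (simp add: trivial_contraction[OF \<alpha>] scaleC_one x del: id_apply)
  finally have "Tmap q x - x = (\<Sum>\<pi>\<in>P12 ?n - {id}. ?t \<pi>)"
    by (simp only: add_diff_cancel_left')
  moreover have "Wmap (elem (perm_contr ?n \<pi> \<alpha>) (restr (keep ?n \<pi>) hs)) \<in> TP_below m"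
    if \<pi>: "\<pi> \<in> P12 ?n - {id}" for \<pi>
  proof -
    have P: "\<pi> \<in> P12 ?n" "\<pi> \<noteq> id" using \<pi> by auto
    then have "supp \<pi> \<noteq> {}" by (auto simp: supp_def fun_eq_iff)
    then have "npairs \<pi> > 0" "2 * npairs \<pi> \<le> ?n"
      using card_supp[OF P(1)] finite_supp[OF P(1)] card_mono[OF _ supp_subset[OF P(1)]]
      by (auto simp: card_gt_0_iff intro!: Nat.gr0I)
    then have "?n - 2 * npairs \<pi> < m" using n by simp
    then show ?thesis
      using perm_contr_S0[OF P(1) \<alpha>] length_restr_keep[OF P(1)] by (intro TP_below_base) auto
  qed
  ultimately have "Tmap q x - x \<in> TP_below m"
    by (auto intro!: complex_vector.subspace_sum complex_vector.subspace_scale TP_below_subspace)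
  moreover have "Tmap q (c *\<^sub>C x + y) - (c *\<^sub>C x + y) = c *\<^sub>C (Tmap q x - x) + (Tmap q y - y)"
    by (simp add: clinear_add[OF clinear_Tmap] clinear_scale[OF clinear_Tmap]
        complex_vector.scale_right_diff_distrib)
  ultimately show ?case using step(2)
    by (simp only: complex_vector.subspace_add[OF TP_below_subspace]
        complex_vector.subspace_scale[OF TP_below_subspace])
qed

lemma inj_on_Tmap: "inj_on (Tmap q) TP"
proof (rule inj_onI)
  fix x y :: "'a ptens" assume xy: "x \<in> TP" "y \<in> TP" "Tmap q x = Tmap q y"
  then have T0: "Tmap q (x - y) = 0" by (simp add: clinear_diff[OF clinear_Tmap])
  have "x - y \<in> TP" using xy by (intro complex_vector.subspace_diff[OF TP_subspace])
  then obtain m where "x - y \<in> TP_below m" using TP_in_below by blast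
  then have "x - y = 0"
  proof (induction m)
    case (Suc m)
    then have "0 - (x - y) \<in> TP_below m" using Tmap_diff_below[of "x - y" m q] T0 by simp
    then have "- (x - y) \<in> TP_below m" by simp
    then show ?case using Suc complex_vector.subspace_neg[OF TP_below_subspace] by force
  qed (simp add: TP_below_0)
  then show "x = y" by simp
qed

lemma Tmap_image: "Tmap q ` TP = (TP :: 'a::real_inner ptens set)"
proof
  show "Tmap q ` TP \<subseteq> (TP :: 'a ptens set)" by (auto simp: Tmap_TP TP_perm_tens)
  have "TP_below m \<subseteq> Tmap q ` (TP :: 'a ptens set)" for m
  proof (induction m)
    case 0
    have "0 = Tmap q (0 :: 'a ptens)" "0 \<in> (TP :: 'a ptens set)"
      by (simp_all add: clinear_zero[OF clinear_Tmap] complex_vector.subspace_0[OF TP_subspace])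
    then show ?case by (auto simp: TP_below_0)
  next
    case (Suc m)
    show ?case
    proof
      fix x :: "'a ptens" assume x: "x \<in> TP_below (Suc m)"
      then have "Tmap q x - x \<in> Tmap q ` TP"
        using Tmap_diff_below[OF x, of q] Suc.IH by blast
      then obtain z where z: "z \<in> TP" "Tmap q x - x = Tmap q z" by blast
      then have "x = Tmap q (x - z)" by (simp add: clinear_diff[OF clinear_Tmap] algebra_simps)
      moreover have "x - z \<in> TP"
        using x z TP_below_TP by (intro complex_vector.subspace_diff[OF TP_subspace]) auto
      ultimately show "x \<in> Tmap q ` TP" by blast
    qed
  qed
  then show "(TP :: 'a ptens set) \<subseteq> Tmap q ` TP" using TP_in_below by blast
qed

lemma T_inv_Tmap: "\<xi> \<in> TP \<Longrightarrow> T_inv q (Tmap q \<xi>) = \<xi>"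
  unfolding T_inv_def by (rule inv_into_f_f[OF inj_on_Tmap])

lemma Tmap_T_inv: "\<xi> \<in> TP \<Longrightarrow> Tmap q (T_inv q \<xi>) = \<xi>"
  unfolding T_inv_def by (rule f_inv_into_f) (simp add: Tmap_image)

lemma T_inv_TP: "\<xi> \<in> TP \<Longrightarrow> T_inv q \<xi> \<in> TP"
  unfolding T_inv_def by (rule inv_into_into) (simp add: Tmap_image)

section \<open>The inner product as a kernel on elementary tensors\<close>

definition kern :: "real \<Rightarrow> (nat \<Rightarrow> nat) \<Rightarrow> 'a::real_inner list \<Rightarrow> (nat \<Rightarrow> nat) \<Rightarrow> 'a list \<Rightarrow> real" where
  "kern q \<alpha> hs \<beta> gs = (\<Sum>\<sigma>\<in>Sn (length hs). chi q (length hs) (\<alpha> \<circ> \<sigma> \<circ> inv \<beta> \<circ> inv \<sigma>) *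
     (\<Prod>i\<in>{1..length hs}. inner (hs ! (i - 1)) (gs ! (inv \<sigma> i - 1))))"

lemma prod_shift: "(\<Prod>i<n. f i) = (\<Prod>i\<in>{1..n}. f (i - 1))" for n :: nat
  by (rule prod.reindex_bij_witness[of _ "\<lambda>i. i - 1" Suc]) auto

lemma multilinear_sum_prod:
  fixes v :: "'l \<Rightarrow> 'j \<Rightarrow> nat \<Rightarrow> 'a::real_inner"
  assumes "\<And>j. j \<in> J \<Longrightarrow> bij_betw (g j) {1..n} {1..n}"
  shows "multilinear (\<lambda>l gs. if length gs = n then complex_of_real
    (\<Sum>j\<in>J. w l j * (\<Prod>i\<in>{1..n}. inner (v l j i) (gs ! (g j i - 1)))) else 0)"
proof (rule multilinearI)
  fix l p a b and gs :: "'a list" and x y :: 'a assume p: "p < length gs"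
  let ?c = "\<lambda>gs. \<Sum>j\<in>J. w l j * (\<Prod>i\<in>{1..n}. inner (v l j i) (gs ! (g j i - 1)))"
  let ?f = "\<lambda>gs. if length gs = n then complex_of_real (?c gs) else 0"
  show "?f (gs[p := a *\<^sub>R x + b *\<^sub>R y]) =
      of_real a *\<^sub>C ?f (gs[p := x]) + of_real b *\<^sub>C ?f (gs[p := y])"
  proof (cases "length gs = n")
    case True
    have "(\<Prod>i\<in>{1..n}. inner (v l j i) (gs[p := a *\<^sub>R x + b *\<^sub>R y] ! (g j i - 1))) =
        a * (\<Prod>i\<in>{1..n}. inner (v l j i) (gs[p := x] ! (g j i - 1))) +
        b * (\<Prod>i\<in>{1..n}. inner (v l j i) (gs[p := y] ! (g j i - 1)))" if j: "j \<in> J" for j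
    proof -
      have "g j ` {1..n} = {1..n}" using assms[OF j] by (rule bij_betw_imp_surj_on)
      moreover have "Suc p \<in> {1..n}" using p True by simp
      ultimately have "Suc p \<in> g j ` {1..n}" by (simp only:)
      then obtain i\<^sub>0 where i0: "i\<^sub>0 \<in> {1..n}" "g j i\<^sub>0 = Suc p" by (rule imageE) (rule that, simp_all only:)
      show ?thesis
      proof (rule prod_linear_slot[where i\<^sub>0 = i\<^sub>0 and s = "\<lambda>i. inner (v l j i) (gs ! (g j i - 1))"])
        fix i z assume i: "i \<in> {1..n} - {i\<^sub>0}"
        then have "g j i \<in> {1..n}" "g j i \<noteq> g j i\<^sub>0"
          using bij_betw_apply[OF assms[OF j], of i] i i0(1)
            inj_onD[OF bij_betw_imp_inj_on[OF assms[OF j]], of i i\<^sub>0] by blast+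
        then have "g j i - 1 \<noteq> p" using i0 by auto
        then show "inner (v l j i) (gs[p := z] ! (g j i - 1)) = inner (v l j i) (gs ! (g j i - 1))"
          by simp
      qed (use i0 p in \<open>simp_all add: inner_add_right\<close>)
    qed
    then have "?c (gs[p := a *\<^sub>R x + b *\<^sub>R y]) = a * ?c (gs[p := x]) + b * ?c (gs[p := y])"
      by (simp add: distrib_left sum.distrib sum_distrib_left mult.left_commute)
    then show ?thesis using True by (simp only: length_list_update simp_thms if_True of_real_add of_real_mult scaleC_complex_def)
  qed (simp add: scaleC_complex_def)
qed

lemma bij_betw_id_slots: "bij_betw (\<lambda>i. i) {1..n} {1..n::nat}"
  by (simp add: bij_betw_def)

lemma Sn_bij_betw: "\<sigma> \<in> Sn n \<Longrightarrow> bij_betw \<sigma> {1..n} {1..n}"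
  "\<sigma> \<in> Sn n \<Longrightarrow> bij_betw (inv \<sigma>) {1..n} {1..n}"
  using permutes_imp_bij[OF Sn_permutes] permutes_imp_bij[OF Sn_permutes[OF Sn_inv]] by blast+

lemma tens_inner_elem:
  fixes hs gs :: "'a::real_inner list"
  assumes "length gs = length hs"
  shows "tens_inner (elem () hs) (elem () gs) = of_real (\<Prod>i\<in>{1..length hs}. inner (hs ! (i - 1)) (gs ! (i - 1)))"
proof -
  let ?P = "\<lambda>hs gs. if length hs = length gs
    then complex_of_real (\<Prod>i<length hs. inner (hs ! i) (gs ! i)) else 0"
  have A: "multilinear (\<lambda>_::unit. ?P hs)" for hs :: "'a list"
  proof -
    have eq: "?P hs gs = (if length gs = length hs then complex_of_real
        (\<Sum>j\<in>{()}. 1 * (\<Prod>i\<in>{1..length hs}. inner (hs ! (i - 1)) (gs ! (i - 1)))) else 0)" for gs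
      unfolding prod_shift by simp
    show ?thesis unfolding eq
      by (rule multilinear_sum_prod[where w = "\<lambda>_ _. 1" and v = "\<lambda>_ _ i. hs ! (i - 1)" and g = "\<lambda>_ i. i"])
        (rule bij_betw_id_slots)
  qed
  have B: "multilinear (\<lambda>(_::unit) hs. ?P hs gs)"
  proof -
    have eq: "?P hs gs = (if length hs = length gs then complex_of_real
        (\<Sum>j\<in>{()}. 1 * (\<Prod>i\<in>{1..length gs}. inner (gs ! (i - 1)) (hs ! (i - 1)))) else 0)" for hs
      unfolding prod_shift by (simp add: inner_commute)
    show ?thesis unfolding eq
      by (rule multilinear_sum_prod[where w = "\<lambda>_ _. 1" and v = "\<lambda>_ _ i. gs ! (i - 1)" and g = "\<lambda>_ i. i"])
        (rule bij_betw_id_slots)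
  qed
  have "tens_inner (elem () hs) (elem () gs) =
      lin_ext (\<lambda>_ hs. ?P hs gs) (elem () hs)"
    unfolding tens_inner_def by (simp only: antilin_ext_elem[OF A])
  also have "\<dots> = of_real (\<Prod>i\<in>{1..length hs}. inner (hs ! (i - 1)) (gs ! (i - 1)))"
    using assms by (subst lin_ext_elem[OF B]) (simp add: prod_shift)
  finally show ?thesis .
qed

lemma q_inner_kern:
  "q_inner q \<xi> \<zeta> = lin_ext (\<lambda>\<alpha> hs. antilin_ext (\<lambda>\<beta> gs.
    if length gs = length hs then of_real (kern q \<alpha> hs \<beta> gs) else 0) \<zeta>) \<xi>"
proof -
  have "(if length hs = length gs
     then \<Sum>\<sigma>\<in>Sn (length hs). of_real (chi q (length hs) (\<alpha> \<circ> \<sigma> \<circ> inv \<beta> \<circ> inv \<sigma>)) *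
       tens_inner (elem () hs) (U_perm (length hs) \<sigma> (elem () gs)) else 0) =
     (if length gs = length hs then complex_of_real (kern q \<alpha> hs \<beta> gs) else 0)"
    for \<alpha> \<beta> and hs gs :: "'a list"
  proof (cases "length gs = length hs")
    case True
    have "of_real (chi q (length hs) (\<alpha> \<circ> \<sigma> \<circ> inv \<beta> \<circ> inv \<sigma>)) *
        tens_inner (elem () hs) (U_perm (length hs) \<sigma> (elem () gs)) =
        complex_of_real (chi q (length hs) (\<alpha> \<circ> \<sigma> \<circ> inv \<beta> \<circ> inv \<sigma>) *
          (\<Prod>i\<in>{1..length hs}. inner (hs ! (i - 1)) (gs ! (inv \<sigma> i - 1))))"
      if \<sigma>: "\<sigma> \<in> Sn (length hs)" for \<sigma>
    proof -
      have "U_perm (length hs) \<sigma> (elem () gs) = elem () (perm_list \<sigma> gs)"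
        using U_perm_elem[of \<sigma> gs] \<sigma> True by simp
      moreover have "(\<Prod>i\<in>{1..length hs}. inner (hs ! (i - 1)) (perm_list \<sigma> gs ! (i - 1))) =
          (\<Prod>i\<in>{1..length hs}. inner (hs ! (i - 1)) (gs ! (inv \<sigma> i - 1)))"
        using True by (intro prod.cong refl) (simp only: perm_list_nth)
      ultimately show ?thesis
        using True by (simp only: tens_inner_elem length_perm_list of_real_mult)
    qed
    then show ?thesis using True by (simp only: kern_def of_real_sum if_True refl cong: sum.cong)
  qed simp
  then show ?thesis unfolding q_inner_def by simp
qed

lemma multilinear_kern_right:
  "multilinear (\<lambda>\<beta> gs. if length gs = length hs then complex_of_real (kern q \<alpha> hs \<beta> gs) else 0)"
  unfolding kern_def
  by (rule multilinear_sum_prod[where w = "\<lambda>\<beta> \<sigma>. chi q (length hs) (\<alpha> \<circ> \<sigma> \<circ> inv \<beta> \<circ> inv \<sigma>)"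
        and v = "\<lambda>_ _ i. hs ! (i - 1)" and g = inv]) (rule Sn_bij_betw)

lemma multilinear_kern_left:
  "multilinear (\<lambda>\<alpha> hs. if length gs = length hs then complex_of_real (kern q \<alpha> hs \<beta> gs) else 0)"
proof -
  have "multilinear (\<lambda>\<alpha> hs. if length hs = length gs then complex_of_real
      (\<Sum>\<sigma>\<in>Sn (length gs). chi q (length gs) (\<alpha> \<circ> \<sigma> \<circ> inv \<beta> \<circ> inv \<sigma>) *
        (\<Prod>i\<in>{1..length gs}. inner (gs ! (inv \<sigma> i - 1)) (hs ! (i - 1)))) else 0)"
    by (rule multilinear_sum_prod[where w = "\<lambda>\<alpha> \<sigma>. chi q (length gs) (\<alpha> \<circ> \<sigma> \<circ> inv \<beta> \<circ> inv \<sigma>)"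
          and v = "\<lambda>_ \<sigma> i. gs ! (inv \<sigma> i - 1)" and g = "\<lambda>_ i. i"]) (rule bij_betw_id_slots)
  then show ?thesis
    unfolding kern_def by (simp add: eq_commute[of "length gs"] inner_commute cong: if_cong)
qed

lemma multilinear_kern_ext:
  "multilinear (\<lambda>\<alpha> hs. antilin_ext (\<lambda>\<beta> gs.
    if length gs = length hs then complex_of_real (kern q \<alpha> hs \<beta> gs) else 0) \<zeta>)"
proof (rule multilinearI, goal_cases)
  case (1 l hs p u v a b)
  show ?case
    unfolding antilin_ext_def multilinearD[OF multilinear_kern_left 1] complex_vector.scale_sum_right
    unfolding sum.distrib[symmetric]
    by (rule sum.cong[OF refl]) (simp only: scaleC_complex_def distrib_left mult.left_commute)
qed

lemma clinear_q_inner_left: "clinear (\<lambda>\<xi>. q_inner q \<xi> \<zeta>)"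
  unfolding q_inner_kern by (intro clinear_lin_ext multilinear_kern_ext)

lemma q_inner_elem_left: "q_inner q (elem \<alpha> hs) \<zeta> = antilin_ext (\<lambda>\<beta> gs.
    if length gs = length hs then of_real (kern q \<alpha> hs \<beta> gs) else 0) \<zeta>"
  unfolding q_inner_kern by (rule lin_ext_elem[OF multilinear_kern_ext])

lemma q_inner_elem:
  "q_inner q (elem \<alpha> hs) (elem \<beta> gs) = (if length gs = length hs then of_real (kern q \<alpha> hs \<beta> gs) else 0)"
  unfolding q_inner_elem_left by (rule antilin_ext_elem[OF multilinear_kern_right])

lemma q_inner_add_left: "q_inner q (\<xi> + \<xi>') \<zeta> = q_inner q \<xi> \<zeta> + q_inner q \<xi>' \<zeta>"
  by (rule clinear_add[OF clinear_q_inner_left])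

lemma q_inner_scale_left: "q_inner q (c *\<^sub>C \<xi>) \<zeta> = c * q_inner q \<xi> \<zeta>"
  using clinear_scale[OF clinear_q_inner_left] by (simp add: scaleC_complex_def)

lemma q_inner_add_right: "q_inner q \<xi> (\<zeta> + \<zeta>') = q_inner q \<xi> \<zeta> + q_inner q \<xi> \<zeta>'"
  by (rule clinear_eqI[where f = "\<lambda>\<xi>. q_inner q \<xi> (\<zeta> + \<zeta>')"])
    (auto simp: q_inner_elem_left antilin_ext_add[OF multilinear_kern_right]
      intro: clinear_q_inner_left clinear_plus)

lemma q_inner_scale_right: "q_inner q \<xi> (c *\<^sub>C \<zeta>) = cnj c * q_inner q \<xi> \<zeta>"
proof -
  have "clinear (\<lambda>\<xi>. cnj c *\<^sub>C q_inner q \<xi> \<zeta>)" by (rule clinear_scaleC[OF clinear_q_inner_left])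
  then have "q_inner q \<xi> (c *\<^sub>C \<zeta>) = cnj c *\<^sub>C q_inner q \<xi> \<zeta>"
    by (rule clinear_eqI[OF clinear_q_inner_left])
      (simp add: q_inner_elem_left antilin_ext_scale[OF multilinear_kern_right])
  then show ?thesis by (simp add: scaleC_complex_def)
qed

lemma q_inner_zero_left: "q_inner q 0 \<zeta> = 0"
  by (rule clinear_zero[OF clinear_q_inner_left])

lemma q_inner_zero_right: "q_inner q \<xi> 0 = 0"
  using q_inner_add_right[of q \<xi> 0 0] by simp

lemma q_inner_diff_left: "q_inner q (\<xi> - \<xi>') \<zeta> = q_inner q \<xi> \<zeta> - q_inner q \<xi>' \<zeta>"
  by (rule clinear_diff[OF clinear_q_inner_left])

lemma q_inner_diff_right: "q_inner q \<xi> (\<zeta> - \<zeta>') = q_inner q \<xi> \<zeta> - q_inner q \<xi> \<zeta>'"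
  using q_inner_add_right[of q \<xi> "\<zeta> - \<zeta>'" \<zeta>'] by simp

lemma q_inner_sum_left: "q_inner q (\<Sum>i\<in>I. f i) \<zeta> = (\<Sum>i\<in>I. q_inner q (f i) \<zeta>)"
  by (rule clinear_sum[OF clinear_q_inner_left])

lemma q_inner_sum_right: "q_inner q \<xi> (\<Sum>i\<in>I. f i) = (\<Sum>i\<in>I. q_inner q \<xi> (f i))"
  by (induction I rule: infinite_finite_induct) (simp_all add: q_inner_zero_right q_inner_add_right)

lemma q_inner_perm_tens_eqI:
  assumes "\<zeta> \<in> perm_tens" "\<And>\<beta> gs. \<beta> \<in> S0 (length gs) \<Longrightarrow> q_inner q \<xi> (elem \<beta> gs) = q_inner q \<xi>' (f (elem \<beta> gs))"
    and "clinear f"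
  shows "q_inner q \<xi> \<zeta> = q_inner q \<xi>' (f \<zeta>)"
  using assms(1)
  by (induction rule: perm_tens_induct)
    (simp_all add: clinear_zero clinear_add clinear_scale assms q_inner_zero_right q_inner_add_right
      q_inner_scale_right)

subsection \<open>Invariance under simultaneous permutation\<close>

lemma sum_Sn_translate_left:
  assumes "\<tau> \<in> Sn n"
  shows "(\<Sum>\<sigma>\<in>Sn n. f (\<tau> \<circ> \<sigma>)) = (\<Sum>\<sigma>\<in>Sn n. f \<sigma>)"
  by (rule sum.reindex_bij_witness[of _ "\<lambda>\<sigma>. inv \<tau> \<circ> \<sigma>" "\<lambda>\<sigma>. \<tau> \<circ> \<sigma>"])
    (auto simp: fun_eq_iff Sn_inv_apply[OF assms] assms intro!: Sn_comp Sn_inv)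

text \<open>The sum over \<open>S(n)\<close> absorbs a permutation of the slots on either side. So symmetrisation does not
  change the inner product (lemma \<open>q_inner_Wmap_left\<close>), and a tensor differs from its symmetrisation by
  a vector of norm zero.\<close>

lemma kern_conj_left:
  assumes \<tau>: "\<tau> \<in> Sn (length hs)"
  shows "kern q (\<tau> \<circ> \<alpha> \<circ> inv \<tau>) (perm_list \<tau> hs) \<beta> gs = kern q \<alpha> hs \<beta> gs"
proof -
  let ?n = "length hs"
  note inv = Sn_inv_apply[OF \<tau>]
  let ?f = "\<lambda>\<sigma>. chi q ?n ((\<tau> \<circ> \<alpha> \<circ> inv \<tau>) \<circ> \<sigma> \<circ> inv \<beta> \<circ> inv \<sigma>) *
     (\<Prod>i\<in>{1..?n}. inner (perm_list \<tau> hs ! (i - 1)) (gs ! (inv \<sigma> i - 1)))"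
  have "kern q (\<tau> \<circ> \<alpha> \<circ> inv \<tau>) (perm_list \<tau> hs) \<beta> gs = (\<Sum>\<sigma>\<in>Sn ?n. ?f \<sigma>)"
    by (simp only: kern_def length_perm_list)
  also have "\<dots> = (\<Sum>\<sigma>\<in>Sn ?n. ?f (\<tau> \<circ> \<sigma>))" by (rule sum_Sn_translate_left[OF \<tau>, symmetric])
  also have "\<dots> = kern q \<alpha> hs \<beta> gs"
    unfolding kern_def
  proof (rule sum.cong[OF refl])
    fix \<sigma> assume \<sigma>: "\<sigma> \<in> Sn ?n"
    have i: "inv (\<tau> \<circ> \<sigma>) = inv \<sigma> \<circ> inv \<tau>" by (rule o_inv_distrib[OF Sn_bij[OF \<tau>] Sn_bij[OF \<sigma>]])
    have "(\<tau> \<circ> \<alpha> \<circ> inv \<tau>) \<circ> (\<tau> \<circ> \<sigma>) \<circ> inv \<beta> \<circ> inv (\<tau> \<circ> \<sigma>) = \<tau> \<circ> (\<alpha> \<circ> \<sigma> \<circ> inv \<beta> \<circ> inv \<sigma>) \<circ> inv \<tau>"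
      unfolding i by (simp add: fun_eq_iff inv)
    then have c: "chi q ?n ((\<tau> \<circ> \<alpha> \<circ> inv \<tau>) \<circ> (\<tau> \<circ> \<sigma>) \<circ> inv \<beta> \<circ> inv (\<tau> \<circ> \<sigma>)) =
        chi q ?n (\<alpha> \<circ> \<sigma> \<circ> inv \<beta> \<circ> inv \<sigma>)"
      by (simp only: chi_conj[OF \<tau>])
    have "(\<Prod>i\<in>{1..?n}. inner (perm_list \<tau> hs ! (i - 1)) (gs ! (inv (\<tau> \<circ> \<sigma>) i - 1))) =
        (\<Prod>i\<in>{1..?n}. inner (hs ! (inv \<tau> i - 1)) (gs ! (inv \<sigma> (inv \<tau> i) - 1)))"
      unfolding i by (intro prod.cong refl) (simp only: perm_list_nth o_apply)
    also have "\<dots> = (\<Prod>i\<in>{1..?n}. inner (hs ! (i - 1)) (gs ! (inv \<sigma> i - 1)))"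
      by (rule prod.reindex_bij_betw[OF Sn_bij_betw(2)[OF \<tau>]])
    finally show "?f (\<tau> \<circ> \<sigma>) = chi q ?n (\<alpha> \<circ> \<sigma> \<circ> inv \<beta> \<circ> inv \<sigma>) *
        (\<Prod>i\<in>{1..?n}. inner (hs ! (i - 1)) (gs ! (inv \<sigma> i - 1)))" using c by simp
  qed
  finally show ?thesis .
qed

lemma kern_term_conj_right:
  assumes \<tau>: "\<tau> \<in> Sn n" and \<sigma>: "\<sigma> \<in> Sn n" and \<beta>: "bij \<beta>" and n: "length gs = n"
  shows "\<alpha> \<circ> \<sigma> \<circ> inv (\<tau> \<circ> \<beta> \<circ> inv \<tau>) \<circ> inv \<sigma> = \<alpha> \<circ> (\<sigma> \<circ> \<tau>) \<circ> inv \<beta> \<circ> inv (\<sigma> \<circ> \<tau>)"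
    "i \<in> {1..n} \<Longrightarrow> perm_list \<tau> gs ! (inv \<sigma> i - 1) = gs ! (inv (\<sigma> \<circ> \<tau>) i - 1)"
proof -
  have b: "bij \<tau>" "bij \<sigma>" using \<tau> \<sigma> by (simp_all add: Sn_bij)
  show "\<alpha> \<circ> \<sigma> \<circ> inv (\<tau> \<circ> \<beta> \<circ> inv \<tau>) \<circ> inv \<sigma> = \<alpha> \<circ> (\<sigma> \<circ> \<tau>) \<circ> inv \<beta> \<circ> inv (\<sigma> \<circ> \<tau>)"
    using b \<beta> by (simp add: o_inv_distrib bij_comp bij_imp_bij_inv inv_inv_eq comp_assoc)
  assume "i \<in> {1..n}"
  then have "inv \<sigma> i \<in> {1..length gs}" using Sn_in[OF Sn_inv[OF \<sigma>]] n by blast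
  then show "perm_list \<tau> gs ! (inv \<sigma> i - 1) = gs ! (inv (\<sigma> \<circ> \<tau>) i - 1)"
    using b by (simp only: perm_list_nth o_inv_distrib o_apply)
qed

lemma kern_conj_right:
  assumes \<tau>: "\<tau> \<in> Sn (length hs)" and len: "length gs = length hs" and \<beta>: "bij \<beta>"
  shows "kern q \<alpha> hs (\<tau> \<circ> \<beta> \<circ> inv \<tau>) (perm_list \<tau> gs) = kern q \<alpha> hs \<beta> gs"
proof -
  let ?n = "length hs"
  let ?f = "\<lambda>\<sigma>. chi q ?n (\<alpha> \<circ> \<sigma> \<circ> inv \<beta> \<circ> inv \<sigma>) *
     (\<Prod>i\<in>{1..?n}. inner (hs ! (i - 1)) (gs ! (inv \<sigma> i - 1)))"
  have "kern q \<alpha> hs (\<tau> \<circ> \<beta> \<circ> inv \<tau>) (perm_list \<tau> gs) = (\<Sum>\<sigma>\<in>Sn ?n. ?f (\<sigma> \<circ> \<tau>))"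
    unfolding kern_def
    by (intro sum.cong refl arg_cong2[where f = "(*)"] prod.cong)
      (simp_all only: kern_term_conj_right[OF \<tau> _ \<beta> len])
  also have "\<dots> = kern q \<alpha> hs \<beta> gs" unfolding kern_def by (rule sum_Sn_translate[OF \<tau>])
  finally show ?thesis .
qed

lemma q_inner_Wmap_left:
  "q_inner q (Wmap \<xi>) \<zeta> = q_inner q \<xi> \<zeta>"
proof (rule clinear_eqI[where f = "\<lambda>\<xi>. q_inner q (Wmap \<xi>) \<zeta>"])
  show "clinear (\<lambda>\<xi>. q_inner q (Wmap \<xi>) \<zeta>)"
    by (rule clinear_compose[OF clinear_q_inner_left clinear_Wmap])
  fix \<alpha> and hs :: "'a list"
  have "q_inner q (elem (\<sigma> \<circ> \<alpha> \<circ> inv \<sigma>) (perm_list \<sigma> hs)) \<zeta> = q_inner q (elem \<alpha> hs) \<zeta>"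
    if "\<sigma> \<in> Sn (length hs)" for \<sigma>
    unfolding q_inner_elem_left by (simp only: kern_conj_left[OF that] length_perm_list)
  then show "q_inner q (Wmap (elem \<alpha> hs)) \<zeta> = q_inner q (elem \<alpha> hs) \<zeta>"
    by (simp add: Wmap_elem q_inner_scale_left q_inner_sum_left card_Sn)
qed (rule clinear_q_inner_left)

section \<open>Creation and annihilation are adjoint\<close>

text \<open>Coset decomposition of \<open>S(n + 1)\<close> along \<open>k = \<sigma>\<^bsup>-1\<^esup>(n + 1)\<close>.\<close>

lemma sum_Sn_Suc:
  "(\<Sum>\<sigma>\<in>Sn (Suc n). f \<sigma>) = (\<Sum>k\<in>{1..Suc n}. \<Sum>\<sigma>\<in>Sn n. f (\<sigma> \<circ> Transposition.transpose k (Suc n)))"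
proof -
  let ?N = "Suc n"
  have sub: "Sn n \<subseteq> Sn ?N" unfolding Sn_def by (auto intro: permutes_subset)
  have tr: "Transposition.transpose k ?N \<in> Sn ?N" if "k \<in> {1..?N}" for k
    unfolding Sn_def using that by (auto intro: permutes_swap_id)
  have top: "\<sigma> ?N = ?N" if "\<sigma> \<in> Sn n" for \<sigma> using permutes_not_in[OF Sn_permutes[OF that]] by simp
  have "(\<Sum>(k, \<sigma>)\<in>{1..?N} \<times> Sn n. f (\<sigma> \<circ> Transposition.transpose k ?N)) = (\<Sum>\<sigma>\<in>Sn ?N. f \<sigma>)"
  proof (rule sum.reindex_bij_witness[where j = "\<lambda>(k, \<sigma>). \<sigma> \<circ> Transposition.transpose k ?N"
        and i = "\<lambda>\<sigma>. (inv \<sigma> ?N, \<sigma> \<circ> Transposition.transpose (inv \<sigma> ?N) ?N)"], goal_cases)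
    case (1 x)
    then obtain k \<sigma> where x: "x = (k, \<sigma>)" "k \<in> {1..?N}" "\<sigma> \<in> Sn n" by auto
    have "\<sigma> \<circ> Transposition.transpose k ?N \<in> Sn ?N" using x tr sub by (intro Sn_comp) auto
    moreover have "(\<sigma> \<circ> Transposition.transpose k ?N) k = ?N" using top[OF x(3)] by simp
    ultimately have "inv (\<sigma> \<circ> Transposition.transpose k ?N) ?N = k" using Sn_inv_apply(1) by metis
    then show ?case using x by (simp add: comp_assoc)
  next
    case (2 x)
    then show ?case using tr sub by (auto intro!: Sn_comp)
  next
    case (3 \<sigma>)
    then show ?case by (simp add: comp_assoc)
  next
    case (4 \<sigma>)
    have k: "inv \<sigma> ?N \<in> {1..?N}" using Sn_in[OF Sn_inv[OF 4], of ?N] by simp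
    let ?\<tau> = "\<sigma> \<circ> Transposition.transpose (inv \<sigma> ?N) ?N"
    have "?\<tau> permutes {1..?N}" using 4 tr[OF k] by (intro Sn_permutes Sn_comp)
    moreover have "?\<tau> ?N = ?N" using Sn_inv_apply(2)[OF 4] by simp
    ultimately have "?\<tau> permutes {1..n}"
      by (elim permutes_superset) (auto simp: le_Suc_eq simp del: o_apply)
    then show ?case using k by (simp add: Sn_def)
  qed auto
  then show ?thesis by (simp add: sum.cartesian_product)
qed

text \<open>The slot of \<open>h\<close> is matched with some slot \<open>k\<close> of the other tensor. Deleting \<open>n + 1\<close> from
  \<open>\<alpha>\<sigma>\<beta>\<^bsup>-1\<^esup>\<sigma>\<^bsup>-1\<^esup>\<close> contributes the weight \<open>1\<close> or \<open>q\<close> by \<open>chi_del\<close>, and amounts to deleting \<open>k\<close> from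
  \<open>\<beta>\<close>, up to a permutation of the remaining slots that \<open>kern_conj_right\<close> removes.\<close>

lemma kern_creat:
  assumes \<alpha>: "\<alpha> \<in> S0 (length hs)" and \<beta>: "\<beta> \<in> S0 (length gs)" and len: "length gs = Suc (length hs)"
  shows "kern q \<alpha> (hs @ [h]) \<beta> gs = (\<Sum>k\<in>{1..length gs}.
    (if \<beta> k = k then 1 else q) * inner (gs ! (k - 1)) h *
    kern q \<alpha> hs (transport ({0..length gs} - {k}) {0..length gs - 1} (perm_del {k} \<beta>))
      (restr ({0..length gs} - {k}) gs))"
proof -
  define n N where "n = length hs" and "N = Suc n"
  have lg: "length gs = N" by (simp add: len N_def n_def)
  have \<alpha>n: "\<alpha> \<in> S0 n" and \<beta>N: "\<beta> \<in> S0 N" using \<alpha> \<beta> by (simp_all add: n_def lg)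
  have \<alpha>top: "\<alpha> N = N" using permutes_not_in[OF S0_permutes[OF \<alpha>n]] by (simp add: N_def)
  have len1: "length (hs @ [h]) = Suc n" by (simp add: n_def)
  have "(\<Sum>\<sigma>\<in>Sn n. chi q N (\<alpha> \<circ> (\<sigma> \<circ> Transposition.transpose k N) \<circ> inv \<beta> \<circ> inv (\<sigma> \<circ> Transposition.transpose k N)) *
      (\<Prod>i\<in>{1..N}. inner ((hs @ [h]) ! (i - 1)) (gs ! (inv (\<sigma> \<circ> Transposition.transpose k N) i - 1)))) =
    (if \<beta> k = k then 1 else q) * inner (gs ! (k - 1)) h *
    kern q \<alpha> hs (transport ({0..N} - {k}) {0..n} (perm_del {k} \<beta>)) (restr ({0..N} - {k}) gs)"
    if k: "k \<in> {1..N}" for k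
  proof -
    let ?t = "Transposition.transpose k N" and ?A = "{0..N} - {k}"
    have t: "?t \<in> Sn N" unfolding Sn_def using k by (auto simp: N_def intro: permutes_swap_id)
    have inv_t: "inv ?t = ?t" by simp
    \<comment> \<open>conjugating by \<open>t\<close> turns the deletion of \<open>k\<close> into the deletion of \<open>n + 1\<close>\<close>
    define \<beta>' where "\<beta>' = ?t \<circ> \<beta> \<circ> inv ?t"
    have \<beta>': "\<beta>' \<in> S0 N" unfolding \<beta>'_def by (rule S0_conj[OF \<beta>N t])
    let ?\<delta> = "perm_del {k} \<beta>"
    have \<delta>: "?\<delta> permutes ?A" using S0_permutes[OF \<beta>N] by (rule perm_del_single_permutes)
    have tA: "?t ` ?A = {0..n}"
    proof -
      have "?t ` ?A = ?t ` {0..N} - ?t ` {k}" by (rule image_set_diff[OF bij_is_inj[OF Sn_bij[OF t]]])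
      then show ?thesis using Sn_image[OF t] by (auto simp: N_def)
    qed
    have cA: "card ?A = Suc n" "0 \<in> ?A" using k by (auto simp: N_def)
    obtain \<tau> where \<tau>: "\<tau> \<in> Sn n"
      "transport {0..n} {0..n} (?t \<circ> ?\<delta> \<circ> inv ?t) = \<tau> \<circ> transport ?A {0..n} ?\<delta> \<circ> inv \<tau>"
      "restr {0..n} (perm_list ?t gs) = perm_list \<tau> (restr ?A gs)"
      using transport_relabel[of ?t gs ?A n ?\<delta>] t cA \<delta> by (auto simp: lg tA)
    have del: "perm_del {N} \<beta>' = ?t \<circ> ?\<delta> \<circ> inv ?t"
      using perm_del_conj[OF S0_permutes[OF \<beta>N] _ Sn_bij[OF t], of "{k}"] by (simp add: \<beta>'_def)
    have "{0..N} - {N} = {0..n}" by (auto simp: N_def)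
    then have "perm_del {N} \<beta>' permutes {0..n}"
      using perm_del_single_permutes[OF S0_permutes[OF \<beta>'], of N] by simp
    then have del': "perm_del {N} \<beta>' = \<tau> \<circ> transport ?A {0..n} ?\<delta> \<circ> inv \<tau>"
      using \<tau>(2) by (simp add: del transport_self)
    have "\<beta>' N = ?t (\<beta> k)" by (simp add: \<beta>'_def)
    moreover have "?t x = N \<longleftrightarrow> x = k" for x
      by (metis transpose_apply_first transpose_involutory)
    ultimately have fix_iff: "\<beta>' N = N \<longleftrightarrow> \<beta> k = k" by simp
    let ?r = "perm_list \<tau> (restr ?A gs)"
    have lr: "length (restr ?A gs) = n" using length_restr[of ?A gs] cA by (auto simp: lg)
    have summand: "chi q N (\<alpha> \<circ> (\<sigma> \<circ> ?t) \<circ> inv \<beta> \<circ> inv (\<sigma> \<circ> ?t)) *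
        (\<Prod>i\<in>{1..N}. inner ((hs @ [h]) ! (i - 1)) (gs ! (inv (\<sigma> \<circ> ?t) i - 1))) =
      ((if \<beta> k = k then 1 else q) * inner (gs ! (k - 1)) h) *
        (chi q n (\<alpha> \<circ> \<sigma> \<circ> inv (\<tau> \<circ> transport ?A {0..n} ?\<delta> \<circ> inv \<tau>) \<circ> inv \<sigma>) *
        (\<Prod>i\<in>{1..n}. inner (hs ! (i - 1)) (?r ! (inv \<sigma> i - 1))))"
      if \<sigma>: "\<sigma> \<in> Sn n" for \<sigma>
    proof -
      have \<sigma>N: "\<sigma> \<in> Sn N" using \<sigma> unfolding Sn_def N_def by (auto intro: permutes_subset)
      have top: "\<sigma> N = N" "inv \<sigma> N = N"
        using permutes_not_in[OF Sn_permutes[OF \<sigma>]] permutes_not_in[OF Sn_permutes[OF Sn_inv[OF \<sigma>]]]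
        by (simp_all add: N_def)
      have b: "bij \<alpha>" "bij \<sigma>" "bij \<beta>" "bij \<beta>'"
        using S0_bij[OF \<alpha>n] Sn_bij[OF \<sigma>] S0_bij[OF \<beta>N] S0_bij[OF \<beta>'] by auto
      have i: "inj \<alpha>" "inj \<sigma>" "inj (inv \<sigma>)" "inj (inv \<beta>')" "bij (inv \<beta>')"
        using b by (auto intro: bij_is_inj bij_imp_bij_inv)
      let ?\<gamma> = "\<alpha> \<circ> (\<sigma> \<circ> (inv \<beta>' \<circ> inv \<sigma>))"
      have \<gamma>: "\<alpha> \<circ> (\<sigma> \<circ> ?t) \<circ> inv \<beta> \<circ> inv (\<sigma> \<circ> ?t) = ?\<gamma>"
        using kern_term_conj_right(1)[OF t \<sigma>N b(3) lg, of \<alpha>] by (simp add: \<beta>'_def comp_assoc)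
      have "?\<gamma> \<in> S0 N"
        using \<alpha>n S0_mono[of n N] \<sigma>N Sn_subset_S0[of N] \<beta>'
        by (intro S0_comp S0_inv) (auto simp: N_def)
      moreover have "?\<gamma> N = N \<longleftrightarrow> \<beta> k = k"
      proof -
        have "?\<gamma> N = N \<longleftrightarrow> \<sigma> (inv \<beta>' N) = N" using injD[OF i(1), of "\<sigma> (inv \<beta>' N)" N] \<alpha>top top by auto
        also have "\<dots> \<longleftrightarrow> inv \<beta>' N = N" using injD[OF i(2), of "inv \<beta>' N" N] top by auto
        also have "\<dots> \<longleftrightarrow> \<beta>' N = N" using b(4) by (metis bij_inv_eq_iff)
        finally show ?thesis using fix_iff by simp
      qed
      moreover have "perm_del {N} ?\<gamma> = \<alpha> \<circ> \<sigma> \<circ> inv (\<tau> \<circ> transport ?A {0..n} ?\<delta> \<circ> inv \<tau>) \<circ> inv \<sigma>"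
      proof -
        have "perm_del {N} ?\<gamma> = \<alpha> \<circ> (\<sigma> \<circ> (perm_del {N} (inv \<beta>') \<circ> inv \<sigma>))"
          using i top \<alpha>top by (simp add: perm_del_comp_fix perm_del_comp_fix_right inj_compose)
        then show ?thesis by (simp only: perm_del_inv[OF b(4)] del' comp_assoc)
      qed
      ultimately have chi: "chi q N ?\<gamma> = (if \<beta> k = k then 1 else q) *
          chi q n (\<alpha> \<circ> \<sigma> \<circ> inv (\<tau> \<circ> transport ?A {0..n} ?\<delta> \<circ> inv \<tau>) \<circ> inv \<sigma>)"
        using chi_del[of ?\<gamma> n q] by (simp only: N_def)
      have io: "inv (\<sigma> \<circ> ?t) = ?t \<circ> inv \<sigma>"
        using o_inv_distrib[OF Sn_bij[OF \<sigma>N] Sn_bij[OF t]] inv_t by simp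
      have "(\<Prod>i\<in>{1..N}. inner ((hs @ [h]) ! (i - 1)) (gs ! (inv (\<sigma> \<circ> ?t) i - 1))) =
          (\<Prod>i\<in>{1..n}. inner ((hs @ [h]) ! (i - 1)) (gs ! (inv (\<sigma> \<circ> ?t) i - 1))) *
          inner ((hs @ [h]) ! (N - 1)) (gs ! (inv (\<sigma> \<circ> ?t) N - 1))"
        by (simp add: N_def)
      also have "inner ((hs @ [h]) ! (N - 1)) (gs ! (inv (\<sigma> \<circ> ?t) N - 1)) = inner (gs ! (k - 1)) h"
        by (simp add: io top inner_commute) (simp add: N_def n_def inner_commute)
      also have "(\<Prod>i\<in>{1..n}. inner ((hs @ [h]) ! (i - 1)) (gs ! (inv (\<sigma> \<circ> ?t) i - 1))) =
          (\<Prod>i\<in>{1..n}. inner (hs ! (i - 1)) (?r ! (inv \<sigma> i - 1)))"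
      proof (rule prod.cong[OF refl])
        fix i assume i: "i \<in> {1..n}"
        then have j: "inv \<sigma> i \<in> {1..n}" using Sn_in[OF Sn_inv[OF \<sigma>]] by blast
        have "?r ! (inv \<sigma> i - 1) = perm_list ?t gs ! (inv \<sigma> i - 1)"
          unfolding \<tau>(3)[symmetric] using restr_nth[of "{0..n}" "perm_list ?t gs" "inv \<sigma> i"] j
          by (simp add: lg N_def ord_bij_self)
        also have "\<dots> = gs ! (inv (\<sigma> \<circ> ?t) i - 1)"
          using kern_term_conj_right(2)[OF t \<sigma>N b(3) lg] i by (simp add: N_def)
        finally show "inner ((hs @ [h]) ! (i - 1)) (gs ! (inv (\<sigma> \<circ> ?t) i - 1)) =
            inner (hs ! (i - 1)) (?r ! (inv \<sigma> i - 1))"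
          using i by (auto simp: nth_append n_def)
      qed
      finally show ?thesis unfolding \<gamma> chi by (simp only: mult_ac)
    qed
    have "(\<Sum>\<sigma>\<in>Sn n. chi q N (\<alpha> \<circ> (\<sigma> \<circ> ?t) \<circ> inv \<beta> \<circ> inv (\<sigma> \<circ> ?t)) *
        (\<Prod>i\<in>{1..N}. inner ((hs @ [h]) ! (i - 1)) (gs ! (inv (\<sigma> \<circ> ?t) i - 1)))) =
      ((if \<beta> k = k then 1 else q) * inner (gs ! (k - 1)) h) *
        kern q \<alpha> hs (\<tau> \<circ> transport ?A {0..n} ?\<delta> \<circ> inv \<tau>) ?r"
      unfolding kern_def sum_distrib_left n_def[symmetric] by (rule sum.cong[OF refl summand])
    also have "kern q \<alpha> hs (\<tau> \<circ> transport ?A {0..n} ?\<delta> \<circ> inv \<tau>) ?r =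
        kern q \<alpha> hs (transport ?A {0..n} ?\<delta>) (restr ?A gs)"
      using \<tau>(1) lr \<delta> cA
      by (intro kern_conj_right permutes_bij[OF transport_permutes[of ?A "{0..n}"]]) (auto simp: n_def)
    finally show ?thesis .
  qed
  then show ?thesis
    unfolding kern_def[of q \<alpha> "hs @ [h]"] len1 sum_Sn_Suc lg by (simp add: N_def)
qed

lemma q_inner_creat:
  assumes \<xi>: "\<xi> \<in> perm_tens" and \<zeta>: "\<zeta> \<in> perm_tens"
  shows "q_inner q (creat h \<xi>) \<zeta> = q_inner q \<xi> (annih q h \<zeta>)"
  using \<xi> clinear_compose[OF clinear_q_inner_left clinear_creat] clinear_q_inner_left
proof (rule clinear_perm_tens_eqI)
  fix \<alpha> and hs :: "'a list" assume \<alpha>: "\<alpha> \<in> S0 (length hs)"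
  show "q_inner q (creat h (elem \<alpha> hs)) \<zeta> = q_inner q (elem \<alpha> hs) (annih q h \<zeta>)"
    using \<zeta>
  proof (rule q_inner_perm_tens_eqI[OF _ _ clinear_annih])
    fix \<beta> and gs :: "'a list" assume \<beta>: "\<beta> \<in> S0 (length gs)"
    have len: "length (restr ({0..length gs} - {k}) gs) = length gs - 1" if "k \<in> {1..length gs}" for k
      using that by (subst length_restr) auto
    show "q_inner q (creat h (elem \<alpha> hs)) (elem \<beta> gs) = q_inner q (elem \<alpha> hs) (annih q h (elem \<beta> gs))"
    proof (cases "length gs = Suc (length hs)")
      case True
      have "q_inner q (elem \<alpha> hs) (annih q h (elem \<beta> gs)) = (\<Sum>k\<in>{1..length gs}. of_real (
          (if \<beta> k = k then 1 else q) * inner (gs ! (k - 1)) h *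
          kern q \<alpha> hs (transport ({0..length gs} - {k}) {0..length gs - 1} (perm_del {k} \<beta>))
            (restr ({0..length gs} - {k}) gs)))"
        unfolding annih_elem q_inner_sum_right q_inner_scale_right q_inner_elem
      proof (rule sum.cong[OF refl])
        fix k assume "k \<in> {1..length gs}"
        from len[OF this] show "cnj (of_real ((if \<beta> k = k then 1 else q) * inner (gs ! (k - 1)) h)) *
            (if length (restr ({0..length gs} - {k}) gs) = length hs
             then of_real (kern q \<alpha> hs (transport ({0..length gs} - {k}) {0..length gs - 1} (perm_del {k} \<beta>))
               (restr ({0..length gs} - {k}) gs)) else 0) =
            of_real ((if \<beta> k = k then 1 else q) * inner (gs ! (k - 1)) h *
              kern q \<alpha> hs (transport ({0..length gs} - {k}) {0..length gs - 1} (perm_del {k} \<beta>))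
                (restr ({0..length gs} - {k}) gs))"
          using True by simp
      qed
      then show ?thesis
        unfolding creat_elem q_inner_elem using True kern_creat[OF \<alpha> \<beta> True, of q h] by simp
    next
      case False
      then have "q_inner q (elem \<alpha> hs) (annih q h (elem \<beta> gs)) = 0"
        unfolding annih_elem q_inner_sum_right q_inner_scale_right q_inner_elem
        by (intro sum.neutral ballI) (auto simp: len)
      then show ?thesis unfolding creat_elem q_inner_elem using False by simp
    qed
  qed
qed

section \<open>Positivity\<close>

lemma Z_set_cases:
  assumes "q \<in> Z_set - {0}"
  obtains N s where "0 < N" "s = 1 \<or> s = - 1" "q = s / real N"
proof -
  from assms obtain N where N: "1 \<le> N" "q = 1 / real N \<or> q = - (1 / real N)"
    unfolding Z_set_def by auto
  then show ?thesis using that[of N 1] that[of N "- 1"] by auto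
qed

text \<open>Gram-Schmidt, in the form of Parseval's identity. It turns inner products of tensors into sums
  over words in finitely many basis vectors.\<close>

lemma finite_parseval:
  fixes S :: "'a::real_inner set"
  assumes "finite S"
  shows "\<exists>B. finite B \<and> (\<forall>u\<in>S. \<forall>v. inner u v = (\<Sum>b\<in>B. inner u b * inner v b))"
proof -
  have "\<exists>B. finite B \<and> (\<forall>b\<in>B. \<forall>c\<in>B. inner b c = (if b = c then 1 else 0)) \<and>
      (\<forall>u\<in>S. \<forall>v. inner u v = (\<Sum>b\<in>B. inner u b * inner v b))"
    using assms
  proof (induction S)
    case empty
    then show ?case by (intro exI[of _ "{}"]) simp
  next
    case (insert x S)
    from insert.IH obtain B where B: "finite B \<and>
      (\<forall>b\<in>B. \<forall>c\<in>B. inner b c = (if b = c then 1 else 0)) \<and>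
      (\<forall>u\<in>S. \<forall>v. inner u v = (\<Sum>b\<in>B. inner u b * inner v b))" by (rule exE)
    then have fin: "finite B"
      and on: "\<And>b c. b \<in> B \<Longrightarrow> c \<in> B \<Longrightarrow> inner b c = (if b = c then 1 else 0)"
      and par: "\<And>u v. u \<in> S \<Longrightarrow> inner u v = (\<Sum>b\<in>B. inner u b * inner v b)" by auto
    define r where "r = x - (\<Sum>b\<in>B. inner x b *\<^sub>R b)"
    have rB: "inner r c = 0" if "c \<in> B" for c
    proof -
      have "inner (\<Sum>b\<in>B. inner x b *\<^sub>R b) c = (\<Sum>b\<in>B. if b = c then inner x b else 0)"
        unfolding inner_sum_left using on that by (intro sum.cong) auto
      then show ?thesis using that fin by (simp add: r_def inner_diff_left)
    qed
    have x: "x = r + (\<Sum>b\<in>B. inner x b *\<^sub>R b)" by (simp add: r_def)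
    have xv: "inner x v = inner r v + (\<Sum>b\<in>B. inner x b * inner v b)" for v
    proof -
      have "inner (\<Sum>b\<in>B. inner x b *\<^sub>R b) v = (\<Sum>b\<in>B. inner x b * inner v b)"
        unfolding inner_sum_left by (simp add: inner_commute[of v])
      then show ?thesis by (subst (1) x) (simp only: inner_add_left)
    qed
    show ?case
    proof (cases "r = 0")
      case True
      have "\<forall>u\<in>insert x S. \<forall>v. inner u v = (\<Sum>b\<in>B. inner u b * inner v b)"
      proof (intro ballI allI)
        fix u v assume "u \<in> insert x S"
        then show "inner u v = (\<Sum>b\<in>B. inner u b * inner v b)"
          using par[of u v] xv[of v] True by (elim insertE) simp_all
      qed
      with fin B[THEN conjunct2, THEN conjunct1] show ?thesis by (intro exI[of _ B] conjI)
    next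
      case False
      define e where "e = r /\<^sub>R norm r"
      have "inner r r = norm r * norm r" by (simp add: power2_norm_eq_inner[symmetric] power2_eq_square)
      then have ee: "inner e e = 1" using False by (simp add: e_def field_simps)
      have eB: "inner e c = 0" "inner c e = 0" if "c \<in> B" for c
        using rB[OF that] by (simp_all add: e_def inner_commute)
      have enB: "e \<notin> B" using eB[of e] ee by auto
      have ue: "inner u e = 0" if "u \<in> S" for u
        using par[OF that, of e] eB by simp
      have xe: "inner x e = norm r"
      proof -
        have "inner x e = inner r e" using xv[of e] eB by simp
        also have "\<dots> = inner r r / norm r" by (simp add: e_def divide_inverse mult.commute)
        also have "\<dots> = norm r" by (simp add: norm_eq_sqrt_inner real_div_sqrt)
        finally show ?thesis .
      qed
      have re: "inner r v = norm r * inner v e" for v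
        using False by (simp add: e_def inner_commute)
      have "\<forall>u\<in>insert x S. \<forall>v. inner u v = (\<Sum>b\<in>insert e B. inner u b * inner v b)"
      proof (intro ballI allI)
        fix u v assume "u \<in> insert x S"
        moreover have "inner t v = (\<Sum>b\<in>insert e B. inner t b * inner v b)" if "t \<in> S" for t
          using par[OF that, of v] ue[OF that] fin enB by simp
        moreover have "inner x v = (\<Sum>b\<in>insert e B. inner x b * inner v b)"
          using xv[of v] re[of v] xe fin enB by simp
        ultimately show "inner u v = (\<Sum>b\<in>insert e B. inner u b * inner v b)" by blast
      qed
      moreover have "\<forall>b\<in>insert e B. \<forall>c\<in>insert e B. inner b c = (if b = c then 1 else 0)"
        using on ee eB enB by auto
      moreover have "finite (insert e B)" using fin by simp
      ultimately show ?thesis by (intro exI[of _ "insert e B"] conjI)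
    qed
  qed
  then show ?thesis by blast
qed

definition perm_sign :: "real \<Rightarrow> (nat \<Rightarrow> nat) \<Rightarrow> real" where
  "perm_sign s \<alpha> = (if s = 1 then 1 else of_int (sign \<alpha>))"

text \<open>The coordinates of \<open>\<alpha> \<otimes> F\<close> in a Hilbert space: \<open>c\<close> and \<open>d\<close> are colourings, i.e. basis vectors
  of a tensor power of \<open>\<complex>\<^sup>N\<close> on which \<open>\<alpha>\<close> acts, and \<open>b\<close> picks a basis vector of the tensor power
  of \<open>\<H>\<close>.\<close>

definition amp :: "real \<Rightarrow> (nat \<Rightarrow> nat) \<Rightarrow> (nat \<Rightarrow> nat) \<Rightarrow> (nat \<Rightarrow> 'a) \<Rightarrow>
    (nat \<Rightarrow> nat) \<Rightarrow> 'a::real_inner list \<Rightarrow> real" where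
  "amp s c d b \<alpha> hs = (\<Sum>\<tau>\<in>Sn (length hs). perm_sign s \<alpha> *
     (if \<forall>y\<in>{0..length hs}. c ((\<tau> \<circ> \<alpha> \<circ> inv \<tau>) y) = d y then 1 else 0) *
     (\<Prod>i\<in>{1..length hs}. inner (hs ! (inv \<tau> i - 1)) (b i)))"

lemma perm_sign_conj:
  assumes "\<alpha> \<in> S0 n" "\<tau> \<in> Sn n"
  shows "perm_sign s (\<tau> \<circ> \<alpha> \<circ> inv \<tau>) = perm_sign s \<alpha>"
proof -
  have "permutation \<alpha>" "permutation \<tau>"
    using S0_permutes[OF assms(1)] Sn_permutes[OF assms(2)] by (auto simp: permutation_permutes)
  then show ?thesis
    by (simp add: perm_sign_def sign_compose sign_inverse permutation_inverse permutation_compose mult.commute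
        flip: of_int_mult)
qed

text \<open>A character value is a sum over colourings \<open>c\<close> that are invariant under
  \<open>\<gamma>\<delta>\<^bsup>-1\<^esup>\<close>; introducing the common value \<open>d\<close> of \<open>c\<gamma>\<close> and \<open>c\<delta>\<close> separates the two factors.\<close>

lemma chi_factor:
  assumes N: "0 < N" and s: "s = 1 \<or> s = - 1" and q: "q = s / real N"
    and \<gamma>: "\<gamma> \<in> S0 n" and \<delta>: "\<delta> \<in> S0 n"
  shows "chi q n (\<gamma> \<circ> inv \<delta>) = 1 / real N ^ n * (\<Sum>c\<in>colourings N {0..n}. \<Sum>d\<in>{0..n} \<rightarrow>\<^sub>E {..<N}.
    (perm_sign s \<gamma> * (if \<forall>y\<in>{0..n}. c (\<gamma> y) = d y then 1 else 0)) *
    (perm_sign s \<delta> * (if \<forall>y\<in>{0..n}. c (\<delta> y) = d y then 1 else 0)))"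
proof -
  let ?C = "colourings N {0..n}" and ?D = "{0..n} \<rightarrow>\<^sub>E {..<N}"
  have perm: "permutation \<gamma>" "permutation \<delta>" "permutation (inv \<delta>)"
    using S0_permutes[OF \<gamma>] S0_permutes[OF \<delta>] permutation_inverse[of \<delta>]
    by (auto simp: permutation_permutes)
  have sg: "perm_sign s (\<gamma> \<circ> inv \<delta>) = perm_sign s \<gamma> * perm_sign s \<delta>"
    using perm by (simp add: perm_sign_def sign_compose sign_inverse)
  have mem: "\<gamma> y \<in> {0..n}" "\<delta> y \<in> {0..n}" if "y \<in> {0..n}" for y
    using permutes_in_image[OF S0_permutes[OF \<gamma>]] permutes_in_image[OF S0_permutes[OF \<delta>]] that by blast+
  have "(\<Sum>d\<in>?D. (if \<forall>y\<in>{0..n}. c (\<gamma> y) = d y then 1 else 0) * (if \<forall>y\<in>{0..n}. c (\<delta> y) = d y then 1 else 0)) =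
      (if \<forall>y\<in>{0..n}. c ((\<gamma> \<circ> inv \<delta>) y) = c y then 1 else 0 :: real)" if c: "c \<in> ?C" for c
  proof -
    let ?d = "restrict (c \<circ> \<gamma>) {0..n}"
    have d: "?d \<in> ?D" using c mem by (auto simp: colourings_def PiE_iff)
    have iff: "(\<forall>y\<in>{0..n}. c ((\<gamma> \<circ> inv \<delta>) y) = c y) \<longleftrightarrow> (\<forall>y\<in>{0..n}. c (\<gamma> y) = c (\<delta> y))"
    proof -
      have "(\<forall>y\<in>{0..n}. c ((\<gamma> \<circ> inv \<delta>) y) = c y) \<longleftrightarrow> (\<forall>y\<in>\<delta> ` {0..n}. c ((\<gamma> \<circ> inv \<delta>) y) = c y)"
        by (simp only: permutes_image[OF S0_permutes[OF \<delta>]])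
      also have "\<dots> \<longleftrightarrow> (\<forall>y\<in>{0..n}. c (\<gamma> y) = c (\<delta> y))"
        by (simp add: permutes_inverses[OF S0_permutes[OF \<delta>]])
      finally show ?thesis .
    qed
    have eq_d: "(\<forall>y\<in>{0..n}. c (\<gamma> y) = d y) \<longleftrightarrow> d = ?d" if "d \<in> ?D" for d
      using that by (auto simp: fun_eq_iff PiE_iff extensional_def)
    have "(\<Sum>d\<in>?D. (if \<forall>y\<in>{0..n}. c (\<gamma> y) = d y then 1 else 0) * (if \<forall>y\<in>{0..n}. c (\<delta> y) = d y then 1 else 0)) =
       (\<Sum>d\<in>?D. if d = ?d then (if \<forall>y\<in>{0..n}. c (\<delta> y) = d y then 1 else 0) else 0 :: real)"
    proof (rule sum.cong[OF refl])
      fix d assume d: "d \<in> ?D"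
      show "(if \<forall>y\<in>{0..n}. c (\<gamma> y) = d y then 1 else 0) * (if \<forall>y\<in>{0..n}. c (\<delta> y) = d y then 1 else 0) =
          (if d = ?d then (if \<forall>y\<in>{0..n}. c (\<delta> y) = d y then 1 else 0) else 0 :: real)"
        unfolding eq_d[OF d] by (rule if_split[THEN iffD2]) simp
    qed
    also have "\<dots> = (if \<forall>y\<in>{0..n}. c (\<delta> y) = ?d y then 1 else 0)"
      using d by (simp add: finite_PiE)
    also have "(\<forall>y\<in>{0..n}. c (\<delta> y) = ?d y) \<longleftrightarrow> (\<forall>y\<in>{0..n}. c (\<gamma> y) = c (\<delta> y))" by auto
    finally show ?thesis unfolding iff .
  qed
  moreover have "real (card {c \<in> ?C. \<forall>y\<in>{0..n}. c ((\<gamma> \<circ> inv \<delta>) y) = c y}) =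
      (\<Sum>c\<in>?C. if \<forall>y\<in>{0..n}. c ((\<gamma> \<circ> inv \<delta>) y) = c y then 1 else 0)"
    by (simp add: finite_colourings sum.If_cases Int_def)
  ultimately have card: "real (card {c \<in> ?C. \<forall>y\<in>{0..n}. c ((\<gamma> \<circ> inv \<delta>) y) = c y}) =
      (\<Sum>c\<in>?C. \<Sum>d\<in>?D. (if \<forall>y\<in>{0..n}. c (\<gamma> y) = d y then 1 else 0) * (if \<forall>y\<in>{0..n}. c (\<delta> y) = d y then 1 else 0))"
    by simp
  have "chi q n (\<gamma> \<circ> inv \<delta>) = 1 / real N ^ n * (perm_sign s \<gamma> * perm_sign s \<delta> *
      real (card {c \<in> ?C. \<forall>y\<in>{0..n}. c ((\<gamma> \<circ> inv \<delta>) y) = c y}))"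
    using chi_colourings[OF S0_comp[OF \<gamma> S0_inv[OF \<delta>]] N s q]
    unfolding perm_sign_def[symmetric] sg by simp
  then show ?thesis
    unfolding card sum_distrib_left by (simp only: mult_ac)
qed

text \<open>Averaging over conjugates of \<open>\<alpha>\<close> gives the two arguments symmetric roles, at the price of the factor
  \<open>n!\<close>; then the summands factor by \<open>chi_factor\<close> and Parseval's identity.\<close>

lemma kern_factor:
  assumes N: "0 < N" and s: "s = 1 \<or> s = - 1" and q: "q = s / real N"
    and \<alpha>: "\<alpha> \<in> S0 (length hs)" and \<beta>: "\<beta> \<in> S0 (length gs)" and len: "length gs = length hs"
    and B: "finite B" "\<And>u v. u \<in> set hs \<Longrightarrow> inner u v = (\<Sum>b\<in>B. inner u b * inner v b)"
  shows "kern q \<alpha> hs \<beta> gs =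
    (\<Sum>(c, d, b)\<in>colourings N {0..length hs} \<times> ({0..length hs} \<rightarrow>\<^sub>E {..<N}) \<times> ({1..length hs} \<rightarrow>\<^sub>E B).
      1 / (fact (length hs) * real N ^ length hs) * amp s c d b \<alpha> hs * amp s c d b \<beta> gs)"
proof -
  let ?n = "length hs" and ?A = "{0..length hs}"
  let ?W = "colourings N ?A \<times> (?A \<rightarrow>\<^sub>E {..<N}) \<times> ({1..?n} \<rightarrow>\<^sub>E B)"
  let ?K = "1 / real N ^ ?n"
  define u where "u \<tau> \<alpha> c d = perm_sign s \<alpha> *
    (if \<forall>y\<in>?A. c ((\<tau> \<circ> \<alpha> \<circ> inv \<tau>) y) = d y then 1 else 0)" for \<tau> \<alpha> and c d :: "nat \<Rightarrow> nat"
  define w where "w \<tau> b hs = (\<Prod>i\<in>{1..?n}. inner (hs ! (inv \<tau> i - 1)) (b i))" for \<tau> b and hs :: "'a list"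
  have \<beta>n: "\<beta> \<in> S0 ?n" using \<beta> len by simp
  have amp: "amp s c d b \<alpha> hs = (\<Sum>\<tau>\<in>Sn ?n. u \<tau> \<alpha> c d * w \<tau> b hs)"
    "amp s c d b \<beta> gs = (\<Sum>\<tau>\<in>Sn ?n. u \<tau> \<beta> c d * w \<tau> b gs)" for c d b
    by (simp_all only: amp_def u_def w_def len)
  have summand: "chi q ?n ((\<tau> \<circ> \<alpha> \<circ> inv \<tau>) \<circ> \<sigma> \<circ> inv \<beta> \<circ> inv \<sigma>) *
      (\<Prod>i\<in>{1..?n}. inner (perm_list \<tau> hs ! (i - 1)) (gs ! (inv \<sigma> i - 1))) =
      (\<Sum>(c, d, b)\<in>?W. ?K * (u \<tau> \<alpha> c d * w \<tau> b hs) * (u \<sigma> \<beta> c d * w \<sigma> b gs))"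
    if \<tau>: "\<tau> \<in> Sn ?n" and \<sigma>: "\<sigma> \<in> Sn ?n" for \<tau> \<sigma>
  proof -
    have "inv (\<sigma> \<circ> \<beta> \<circ> inv \<sigma>) = \<sigma> \<circ> inv \<beta> \<circ> inv \<sigma>"
      using Sn_bij[OF \<sigma>] S0_bij[OF \<beta>n]
      by (simp add: o_inv_distrib bij_comp bij_imp_bij_inv inv_inv_eq comp_assoc)
    then have "chi q ?n ((\<tau> \<circ> \<alpha> \<circ> inv \<tau>) \<circ> \<sigma> \<circ> inv \<beta> \<circ> inv \<sigma>) =
        chi q ?n ((\<tau> \<circ> \<alpha> \<circ> inv \<tau>) \<circ> inv (\<sigma> \<circ> \<beta> \<circ> inv \<sigma>))" by (simp only: comp_assoc)
    also have "\<dots> = ?K * (\<Sum>c\<in>colourings N ?A. \<Sum>d\<in>?A \<rightarrow>\<^sub>E {..<N}. u \<tau> \<alpha> c d * u \<sigma> \<beta> c d)"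
      using chi_factor[OF N s q S0_conj[OF \<alpha> \<tau>] S0_conj[OF \<beta>n \<sigma>]]
      by (simp only: perm_sign_conj[OF \<alpha> \<tau>] perm_sign_conj[OF \<beta>n \<sigma>] u_def)
    finally have chi: "chi q ?n ((\<tau> \<circ> \<alpha> \<circ> inv \<tau>) \<circ> \<sigma> \<circ> inv \<beta> \<circ> inv \<sigma>) =
      ?K * (\<Sum>c\<in>colourings N ?A. \<Sum>d\<in>?A \<rightarrow>\<^sub>E {..<N}. u \<tau> \<alpha> c d * u \<sigma> \<beta> c d)" .
    have "inner (perm_list \<tau> hs ! (i - 1)) (gs ! (inv \<sigma> i - 1)) =
        (\<Sum>b\<in>B. inner (hs ! (inv \<tau> i - 1)) b * inner (gs ! (inv \<sigma> i - 1)) b)" if i: "i \<in> {1..?n}" for i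
    proof -
      have "inv \<tau> i \<in> {1..?n}" using Sn_in[OF Sn_inv[OF \<tau>]] i by blast
      then have "hs ! (inv \<tau> i - 1) \<in> set hs" by (intro nth_mem) auto
      then show ?thesis unfolding perm_list_nth[OF i] by (rule B(2))
    qed
    then have "(\<Prod>i\<in>{1..?n}. inner (perm_list \<tau> hs ! (i - 1)) (gs ! (inv \<sigma> i - 1))) =
        (\<Prod>i\<in>{1..?n}. \<Sum>b\<in>B. inner (hs ! (inv \<tau> i - 1)) b * inner (gs ! (inv \<sigma> i - 1)) b)"
      by (intro prod.cong refl)
    also have "\<dots> = (\<Sum>b\<in>{1..?n} \<rightarrow>\<^sub>E B. w \<tau> b hs * w \<sigma> b gs)"
      using B(1) by (subst prod_sum_PiE) (simp_all add: w_def prod.distrib)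
    finally have prod: "(\<Prod>i\<in>{1..?n}. inner (perm_list \<tau> hs ! (i - 1)) (gs ! (inv \<sigma> i - 1))) =
        (\<Sum>b\<in>{1..?n} \<rightarrow>\<^sub>E B. w \<tau> b hs * w \<sigma> b gs)" .
    have "(\<Sum>(c, d, b)\<in>?W. ?K * (u \<tau> \<alpha> c d * w \<tau> b hs) * (u \<sigma> \<beta> c d * w \<sigma> b gs)) =
        (\<Sum>c\<in>colourings N ?A. \<Sum>d\<in>?A \<rightarrow>\<^sub>E {..<N}. \<Sum>b\<in>{1..?n} \<rightarrow>\<^sub>E B.
          ?K * (u \<tau> \<alpha> c d * w \<tau> b hs) * (u \<sigma> \<beta> c d * w \<sigma> b gs))"
      by (simp only: sum.cartesian_product)
    also have "\<dots> = (\<Sum>c\<in>colourings N ?A. \<Sum>d\<in>?A \<rightarrow>\<^sub>E {..<N}. ?K * (u \<tau> \<alpha> c d * u \<sigma> \<beta> c d) *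
          (\<Sum>b\<in>{1..?n} \<rightarrow>\<^sub>E B. w \<tau> b hs * w \<sigma> b gs))"
      unfolding sum_distrib_left by (intro sum.cong refl) (simp only: mult_ac)
    also have "\<dots> = ?K * (\<Sum>c\<in>colourings N ?A. \<Sum>d\<in>?A \<rightarrow>\<^sub>E {..<N}. u \<tau> \<alpha> c d * u \<sigma> \<beta> c d) *
          (\<Sum>b\<in>{1..?n} \<rightarrow>\<^sub>E B. w \<tau> b hs * w \<sigma> b gs)"
      by (simp only: sum_distrib_left[where r = ?K] sum_distrib_right)
    finally show ?thesis unfolding chi prod by (rule sym)
  qed
  have "fact ?n * kern q \<alpha> hs \<beta> gs = (\<Sum>\<tau>\<in>Sn ?n. kern q (\<tau> \<circ> \<alpha> \<circ> inv \<tau>) (perm_list \<tau> hs) \<beta> gs)"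
    by (simp add: kern_conj_left card_Sn)
  also have "\<dots> = (\<Sum>\<tau>\<in>Sn ?n. \<Sum>\<sigma>\<in>Sn ?n. \<Sum>(c, d, b)\<in>?W.
      ?K * (u \<tau> \<alpha> c d * w \<tau> b hs) * (u \<sigma> \<beta> c d * w \<sigma> b gs))"
    unfolding kern_def length_perm_list using summand by (intro sum.cong refl)
  also have "\<dots> = (\<Sum>\<tau>\<in>Sn ?n. \<Sum>(c, d, b)\<in>?W. \<Sum>\<sigma>\<in>Sn ?n.
      ?K * (u \<tau> \<alpha> c d * w \<tau> b hs) * (u \<sigma> \<beta> c d * w \<sigma> b gs))"
    by (subst sum.swap) (simp add: case_prod_unfold)
  also have "\<dots> = (\<Sum>(c, d, b)\<in>?W. \<Sum>\<tau>\<in>Sn ?n. \<Sum>\<sigma>\<in>Sn ?n.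
      ?K * (u \<tau> \<alpha> c d * w \<tau> b hs) * (u \<sigma> \<beta> c d * w \<sigma> b gs))"
    by (subst sum.swap) (simp add: case_prod_unfold)
  also have "\<dots> = (\<Sum>(c, d, b)\<in>?W. ?K * amp s c d b \<alpha> hs * amp s c d b \<beta> gs)"
    unfolding amp
    by (intro sum.cong refl) (simp only: case_prod_unfold sum_distrib_left[where r = ?K] sum_product)
  finally have "kern q \<alpha> hs \<beta> gs = (\<Sum>(c, d, b)\<in>?W. ?K * amp s c d b \<alpha> hs * amp s c d b \<beta> gs) / fact ?n"
    by (simp add: eq_divide_eq mult.commute)
  then show ?thesis
    by (simp add: sum_divide_distrib case_prod_unfold mult.commute)
qed

definition kern_q :: "real \<Rightarrow> (nat \<Rightarrow> nat) \<times> 'a::real_inner list \<Rightarrow> (nat \<Rightarrow> nat) \<times> 'a list \<Rightarrow> real" where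
  "kern_q q x y = (if length (snd y) = length (snd x) then kern q (fst x) (snd x) (fst y) (snd y) else 0)"

text \<open>Positivity in the form of a Gram matrix. The index \<open>\<omega>\<close> includes the degree, so that tensors of
  different degrees have no coordinate in common.\<close>

lemma kern_q_gram:
  fixes S :: "((nat \<Rightarrow> nat) \<times> 'a::real_inner list) set"
  assumes q: "q \<in> Z_set - {0}" and S: "finite S" "\<And>x. x \<in> S \<Longrightarrow> fst x \<in> S0 (length (snd x))"
  obtains \<Omega> :: "(nat \<times> (nat \<Rightarrow> nat) \<times> (nat \<Rightarrow> nat) \<times> (nat \<Rightarrow> 'a)) set"
    and \<kappa> :: "nat \<times> (nat \<Rightarrow> nat) \<times> (nat \<Rightarrow> nat) \<times> (nat \<Rightarrow> 'a) \<Rightarrow> real" and \<Phi>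
  where "finite \<Omega>" "\<And>\<omega>. \<omega> \<in> \<Omega> \<Longrightarrow> 0 \<le> \<kappa> \<omega>"
    "\<And>x y. x \<in> S \<Longrightarrow> y \<in> S \<Longrightarrow> kern_q q x y = (\<Sum>\<omega>\<in>\<Omega>. \<kappa> \<omega> * \<Phi> \<omega> x * \<Phi> \<omega> y)"
proof -
  obtain N s where N: "0 < N" "s = 1 \<or> s = - 1" "q = s / real N" using q by (rule Z_set_cases)
  have "finite (\<Union>x\<in>S. set (snd x))" using S(1) by simp
  then obtain B where B0: "finite B \<and> (\<forall>u\<in>(\<Union>x\<in>S. set (snd x)). \<forall>v. inner u v = (\<Sum>b\<in>B. inner u b * inner v b))"
    by (rule exE[OF finite_parseval])
  note B = B0[THEN conjunct1] B0[THEN conjunct2, THEN bspec, THEN spec]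
  let ?L = "(\<lambda>x. length (snd x)) ` S"
  let ?W = "\<lambda>n. colourings N {0..n} \<times> ({0..n} \<rightarrow>\<^sub>E {..<N}) \<times> ({1..n} \<rightarrow>\<^sub>E B)"
  let ?\<kappa> = "\<lambda>(n, w). 1 / (fact n * real N ^ n)"
  let ?\<Phi> = "\<lambda>(n, c, d, b) x. if length (snd x) = n then amp s c d b (fst x) (snd x) else 0"
  have fW: "finite (?W n)" for n using B(1) by (intro finite_cartesian_product finite_colourings finite_PiE) auto
  show ?thesis
  proof (rule that[of "Sigma ?L ?W" ?\<kappa> ?\<Phi>])
    show "finite (Sigma ?L ?W)" by (rule finite_SigmaI[OF finite_imageI[OF S(1)] fW])
    show "0 \<le> ?\<kappa> \<omega>" for \<omega> by (simp add: case_prod_unfold)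
    fix x y assume x: "x \<in> S" and y: "y \<in> S"
    have "(\<Sum>\<omega>\<in>Sigma ?L ?W. ?\<kappa> \<omega> * ?\<Phi> \<omega> x * ?\<Phi> \<omega> y) =
        (\<Sum>n\<in>?L. \<Sum>w\<in>?W n. ?\<kappa> (n, w) * ?\<Phi> (n, w) x * ?\<Phi> (n, w) y)"
      by (subst sum.Sigma[OF finite_imageI[OF S(1)]])
        (use fW in blast, simp only: case_prod_unfold fst_conv snd_conv prod.collapse)
    also have "\<dots> = (\<Sum>n\<in>?L. if n = length (snd x) then
        (\<Sum>w\<in>?W n. ?\<kappa> (n, w) * ?\<Phi> (n, w) x * ?\<Phi> (n, w) y) else 0)"
    proof (rule sum.cong[OF refl])
      fix n
      show "(\<Sum>w\<in>?W n. ?\<kappa> (n, w) * ?\<Phi> (n, w) x * ?\<Phi> (n, w) y) = (if n = length (snd x) then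
          (\<Sum>w\<in>?W n. ?\<kappa> (n, w) * ?\<Phi> (n, w) x * ?\<Phi> (n, w) y) else 0)"
      proof (cases "n = length (snd x)")
        case False
        then have "length (snd x) \<noteq> n" by simp
        with False show ?thesis by (simp add: case_prod_unfold)
      next
        case True
        then show ?thesis by (rule if_P[symmetric])
      qed
    qed
    also have "\<dots> = (\<Sum>w\<in>?W (length (snd x)). ?\<kappa> (length (snd x), w) *
        ?\<Phi> (length (snd x), w) x * ?\<Phi> (length (snd x), w) y)"
      using S(1) x by simp
    also have "\<dots> = kern_q q x y"
    proof (cases "length (snd y) = length (snd x)")
      case True
      show ?thesis
      proof -
        have "inner u v = (\<Sum>b\<in>B. inner u b * inner v b)" if "u \<in> set (snd x)" for u v
          using x that by (intro B(2)) blast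
        from kern_factor[OF N S(2)[OF x] S(2)[OF y] True B(1) this] show ?thesis
          unfolding kern_q_def using True by (simp add: case_prod_unfold)
      qed
    qed (simp add: kern_q_def case_prod_unfold)
    finally show "kern_q q x y = (\<Sum>\<omega>\<in>Sigma ?L ?W. ?\<kappa> \<omega> * ?\<Phi> \<omega> x * ?\<Phi> \<omega> y)" by (rule sym)
  qed
qed

lemma q_inner_elem_kern_q: "q_inner q (elem \<alpha> hs) (elem \<beta> gs) = of_real (kern_q q (\<alpha>, hs) (\<beta>, gs))"
  by (simp add: q_inner_elem kern_q_def)

lemma q_inner_hermitian:
  assumes q: "q \<in> Z_set - {0}" and \<xi>: "\<xi> \<in> perm_tens" and \<zeta>: "\<zeta> \<in> perm_tens"
  shows "q_inner q \<zeta> \<xi> = cnj (q_inner q \<xi> \<zeta>)"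
  using \<xi>
proof (induction rule: perm_tens_induct)
  case (add c \<alpha> hs \<xi>)
  have "q_inner q \<zeta> (elem \<alpha> hs) = cnj (q_inner q (elem \<alpha> hs) \<zeta>)"
    using \<zeta>
  proof (induction rule: perm_tens_induct)
    case (add c \<beta> gs \<zeta>)
    let ?S = "{(\<alpha>, hs), (\<beta>, gs)}"
    have "kern_q q (\<beta>, gs) (\<alpha>, hs) = kern_q q (\<alpha>, hs) (\<beta>, gs)"
    proof (rule kern_q_gram[OF q, of ?S])
      show "fst x \<in> S0 (length (snd x))" if "x \<in> ?S" for x
        using that add.hyps \<open>\<alpha> \<in> S0 (length hs)\<close> by auto
    qed (auto simp: mult_ac)
    then show ?case
      using add.IH by (simp add: q_inner_add_left q_inner_add_right q_inner_scale_left q_inner_scale_right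
          q_inner_elem_kern_q)
  qed (simp add: q_inner_zero_left q_inner_zero_right)
  then show ?case
    using add.IH by (simp add: q_inner_add_left q_inner_add_right q_inner_scale_left q_inner_scale_right)
qed (simp add: q_inner_zero_left q_inner_zero_right)

lemma q_inner_nonneg:
  assumes q: "q \<in> Z_set - {0}" and \<xi>: "\<xi> \<in> perm_tens"
  shows "0 \<le> Re (q_inner q \<xi> \<xi>)"
proof -
  obtain t r where t: "finite t" "t \<subseteq> {elem \<alpha> hs |\<alpha> hs. \<alpha> \<in> S0 (length hs)}" "\<xi> = (\<Sum>a\<in>t. r a *\<^sub>C a)"
    using \<xi> unfolding perm_tens_def complex_vector.span_explicit by blast
  then have "\<forall>a\<in>t. \<exists>x. fst x \<in> S0 (length (snd x)) \<and> a = elem (fst x) (snd x)" by fastforce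
  then obtain g where g: "\<And>a. a \<in> t \<Longrightarrow> fst (g a) \<in> S0 (length (snd (g a))) \<and> a = elem (fst (g a)) (snd (g a))"
    by metis
  obtain \<Omega> :: "(nat \<times> (nat \<Rightarrow> nat) \<times> (nat \<Rightarrow> nat) \<times> (nat \<Rightarrow> 'a)) set" and \<kappa> \<Phi> where \<Omega>: "finite \<Omega>"
    "\<And>\<omega>. \<omega> \<in> \<Omega> \<Longrightarrow> 0 \<le> \<kappa> \<omega>"
    "\<And>x y. x \<in> g ` t \<Longrightarrow> y \<in> g ` t \<Longrightarrow> kern_q q x y = (\<Sum>\<omega>\<in>\<Omega>. \<kappa> \<omega> * \<Phi> \<omega> x * \<Phi> \<omega> y)"
    using kern_q_gram[OF q, of "g ` t"] t(1) g by blast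
  let ?f = "\<lambda>\<omega>. \<Sum>a\<in>t. r a * of_real (\<Phi> \<omega> (g a))"
  have kq: "q_inner q a b = of_real (kern_q q (g a) (g b))" if "a \<in> t" "b \<in> t" for a b
    using g[OF that(1)] g[OF that(2)] by (metis q_inner_elem_kern_q prod.collapse)
  have expand: "q_inner q \<xi> \<zeta> = (\<Sum>a\<in>t. r a * q_inner q a \<zeta>)"
    "q_inner q \<zeta> \<xi> = (\<Sum>b\<in>t. cnj (r b) * q_inner q \<zeta> b)" for \<zeta>
    by (simp_all add: t(3) q_inner_sum_left q_inner_sum_right q_inner_scale_left q_inner_scale_right)
  have "q_inner q \<xi> \<xi> = (\<Sum>a\<in>t. r a * (\<Sum>b\<in>t. cnj (r b) * q_inner q a b))"
    by (subst expand(1)) (simp only: expand(2))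
  also have "\<dots> = (\<Sum>a\<in>t. \<Sum>b\<in>t. r a * (cnj (r b) * of_real (kern_q q (g a) (g b))))"
    unfolding sum_distrib_left using kq by (intro sum.cong refl) simp
  also have "\<dots> = (\<Sum>a\<in>t. \<Sum>b\<in>t. \<Sum>\<omega>\<in>\<Omega>. of_real (\<kappa> \<omega>) * (r a * of_real (\<Phi> \<omega> (g a))) * cnj (r b * of_real (\<Phi> \<omega> (g b))))"
    using \<Omega>(3) by (intro sum.cong refl) (simp add: sum_distrib_left mult_ac)
  also have "\<dots> = (\<Sum>a\<in>t. \<Sum>\<omega>\<in>\<Omega>. \<Sum>b\<in>t. of_real (\<kappa> \<omega>) * (r a * of_real (\<Phi> \<omega> (g a))) * cnj (r b * of_real (\<Phi> \<omega> (g b))))"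
    by (intro sum.cong refl sum.swap)
  also have "\<dots> = (\<Sum>\<omega>\<in>\<Omega>. \<Sum>a\<in>t. \<Sum>b\<in>t. of_real (\<kappa> \<omega>) * (r a * of_real (\<Phi> \<omega> (g a))) * cnj (r b * of_real (\<Phi> \<omega> (g b))))"
    by (rule sum.swap)
  also have "\<dots> = (\<Sum>\<omega>\<in>\<Omega>. of_real (\<kappa> \<omega>) * (?f \<omega> * cnj (?f \<omega>)))"
    by (intro sum.cong refl) (simp only: sum_product cnj_sum, simp only: sum_distrib_left mult.assoc)
  also have "\<dots> = of_real (\<Sum>\<omega>\<in>\<Omega>. \<kappa> \<omega> * (cmod (?f \<omega>))\<^sup>2)"
    by (simp only: of_real_sum of_real_mult complex_norm_square)
  finally show ?thesis using \<Omega>(2) by (simp add: sum_nonneg)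
qed

lemma q_inner_self:
  assumes q: "q \<in> Z_set - {0}" and \<xi>: "\<xi> \<in> perm_tens"
  shows "q_inner q \<xi> \<xi> = of_real ((q_norm q \<xi>)\<^sup>2)"
proof -
  have "q_inner q \<xi> \<xi> = of_real (Re (q_inner q \<xi> \<xi>))"
    using q_inner_hermitian[OF q \<xi> \<xi>] by (simp add: complex_eq_iff)
  then show ?thesis using q_inner_nonneg[OF q \<xi>] by (simp add: q_norm_def)
qed

lemma perm_tens_closed:
  "\<xi> \<in> perm_tens \<Longrightarrow> \<zeta> \<in> perm_tens \<Longrightarrow> \<xi> + \<zeta> \<in> perm_tens"
  "\<xi> \<in> perm_tens \<Longrightarrow> \<zeta> \<in> perm_tens \<Longrightarrow> \<xi> - \<zeta> \<in> perm_tens"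
  "\<xi> \<in> perm_tens \<Longrightarrow> c *\<^sub>C \<xi> \<in> perm_tens"
  by (simp_all add: complex_vector.subspace_add complex_vector.subspace_diff
      complex_vector.subspace_scale perm_tens_subspace)

lemma q_norm_nonneg [simp]:
  assumes "q \<in> Z_set - {0}" "\<xi> \<in> perm_tens"
  shows "0 \<le> q_norm q \<xi>"
  using q_inner_nonneg[OF assms] by (simp add: q_norm_def)

lemma q_cauchy_schwarz:
  assumes q: "q \<in> Z_set - {0}" and \<xi>: "\<xi> \<in> perm_tens" and \<zeta>: "\<zeta> \<in> perm_tens"
  shows "cmod (q_inner q \<xi> \<zeta>) \<le> q_norm q \<xi> * q_norm q \<zeta>"
proof -
  let ?z = "q_inner q \<xi> \<zeta>"
  \<comment> \<open>positivity for the difference of \<open>\<xi>\<close> and the multiple of \<open>\<zeta>\<close> with the optimal phase\<close>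
  have quad: "0 \<le> (q_norm q \<xi>)\<^sup>2 - 2 * t * (cmod ?z)\<^sup>2 + t\<^sup>2 * (cmod ?z)\<^sup>2 * (q_norm q \<zeta>)\<^sup>2" for t
  proof -
    define c where "c = of_real t * ?z"
    have "0 \<le> Re (q_inner q (\<xi> - c *\<^sub>C \<zeta>) (\<xi> - c *\<^sub>C \<zeta>))"
      using \<xi> \<zeta> by (intro q_inner_nonneg[OF q] perm_tens_closed)
    also have "q_inner q (\<xi> - c *\<^sub>C \<zeta>) (\<xi> - c *\<^sub>C \<zeta>) =
        q_inner q \<xi> \<xi> - cnj c * ?z - c * cnj ?z + c * cnj c * q_inner q \<zeta> \<zeta>"
      by (simp add: q_inner_diff_left q_inner_diff_right q_inner_scale_left q_inner_scale_right
          q_inner_hermitian[OF q \<xi> \<zeta>] algebra_simps)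
    also have "\<dots> = of_real ((q_norm q \<xi>)\<^sup>2) - 2 * of_real t * (?z * cnj ?z) +
        of_real (t\<^sup>2) * (?z * cnj ?z) * of_real ((q_norm q \<zeta>)\<^sup>2)"
      by (simp add: c_def q_inner_self[OF q] \<xi> \<zeta> power2_eq_square mult_ac)
    also have "?z * cnj ?z = of_real ((cmod ?z)\<^sup>2)" by (rule complex_norm_square[symmetric])
    finally show ?thesis by simp
  qed
  have n: "0 \<le> q_norm q \<xi>" "0 \<le> q_norm q \<zeta>" using q \<xi> \<zeta> by simp_all
  have "(cmod ?z)\<^sup>2 \<le> (q_norm q \<xi> * q_norm q \<zeta>)\<^sup>2"
  proof (cases "q_norm q \<zeta> = 0")
    case True
    have "(cmod ?z)\<^sup>2 = 0"
    proof (rule ccontr)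
      assume ne: "(cmod ?z)\<^sup>2 \<noteq> 0"
      \<comment> \<open>at this \<open>t\<close> the quadratic expression, which is affine here, takes the value \<open>-1\<close>\<close>
      then show False
        using quad[of "((q_norm q \<xi>)\<^sup>2 + 1) / (2 * (cmod ?z)\<^sup>2)"] True by (simp add: field_simps)
    qed
    then show ?thesis by simp
  next
    case False
    have "2 * (1 / (q_norm q \<zeta>)\<^sup>2) * (cmod ?z)\<^sup>2 - (1 / (q_norm q \<zeta>)\<^sup>2)\<^sup>2 * (cmod ?z)\<^sup>2 * (q_norm q \<zeta>)\<^sup>2 =
        (cmod ?z)\<^sup>2 / (q_norm q \<zeta>)\<^sup>2"
      using False by (simp add: field_simps power2_eq_square)
    then have "(cmod ?z)\<^sup>2 / (q_norm q \<zeta>)\<^sup>2 \<le> (q_norm q \<xi>)\<^sup>2"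
      using quad[of "1 / (q_norm q \<zeta>)\<^sup>2"] by linarith
    then show ?thesis using False by (simp add: divide_le_eq power_mult_distrib)
  qed
  then show ?thesis using n by (intro power2_le_imp_le[of "cmod ?z"]) simp_all
qed

lemma q_norm_triangle:
  assumes q: "q \<in> Z_set - {0}" and \<xi>: "\<xi> \<in> perm_tens" and \<zeta>: "\<zeta> \<in> perm_tens"
  shows "q_norm q (\<xi> + \<zeta>) \<le> q_norm q \<xi> + q_norm q \<zeta>"
proof -
  have "of_real ((q_norm q (\<xi> + \<zeta>))\<^sup>2) = q_inner q (\<xi> + \<zeta>) (\<xi> + \<zeta>)"
    using \<xi> \<zeta> by (simp add: q_inner_self[OF q] perm_tens_closed)
  also have "\<dots> = of_real ((q_norm q \<xi>)\<^sup>2) + of_real ((q_norm q \<zeta>)\<^sup>2) + (q_inner q \<xi> \<zeta> + cnj (q_inner q \<xi> \<zeta>))"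
    using q_inner_hermitian[OF q \<xi> \<zeta>] q_inner_self[OF q \<xi>] q_inner_self[OF q \<zeta>]
    by (simp add: q_inner_add_left q_inner_add_right)
  also have "\<dots> = of_real ((q_norm q \<xi>)\<^sup>2 + (q_norm q \<zeta>)\<^sup>2 + 2 * Re (q_inner q \<xi> \<zeta>))"
    by (simp add: complex_add_cnj)
  finally have "(q_norm q (\<xi> + \<zeta>))\<^sup>2 = (q_norm q \<xi>)\<^sup>2 + (q_norm q \<zeta>)\<^sup>2 + 2 * Re (q_inner q \<xi> \<zeta>)"
    by (simp only: of_real_eq_iff)
  moreover have "Re (q_inner q \<xi> \<zeta>) \<le> q_norm q \<xi> * q_norm q \<zeta>"
    using complex_Re_le_cmod q_cauchy_schwarz[OF assms] by (rule order_trans)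
  ultimately have "(q_norm q (\<xi> + \<zeta>))\<^sup>2 \<le> (q_norm q \<xi> + q_norm q \<zeta>)\<^sup>2"
    by (simp add: power2_sum)
  moreover have "0 \<le> q_norm q \<xi> + q_norm q \<zeta>" using q \<xi> \<zeta> by simp
  ultimately show ?thesis by (rule power2_le_imp_le)
qed

lemma q_norm_scale: "q_norm q (c *\<^sub>C \<xi>) = cmod c * q_norm q \<xi>"
proof -
  have "q_inner q (c *\<^sub>C \<xi>) (c *\<^sub>C \<xi>) = (c * cnj c) * q_inner q \<xi> \<xi>"
    by (simp add: q_inner_scale_left q_inner_scale_right)
  also have "c * cnj c = of_real ((cmod c)\<^sup>2)" by (rule complex_norm_square[symmetric])
  finally show ?thesis by (simp add: q_norm_def real_sqrt_mult)
qed

lemma q_norm_minus_commute: "q_norm q (\<xi> - \<zeta>) = q_norm q (\<zeta> - \<xi>)"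
  using q_norm_scale[of q "- 1" "\<xi> - \<zeta>"] by (simp add: complex_vector.scale_right_diff_distrib)

lemma q_norm_zero [simp]: "q_norm q 0 = 0"
  by (simp add: q_norm_def q_inner_zero_left)

lemma q_norm_diff_triangle:
  assumes "q \<in> Z_set - {0}" "x \<in> perm_tens" "y \<in> perm_tens" "z \<in> perm_tens"
  shows "q_norm q (x - z) \<le> q_norm q (x - y) + q_norm q (y - z)"
  using q_norm_triangle[OF assms(1), of "x - y" "y - z"] assms by (simp add: perm_tens_closed)

section \<open>The completion\<close>

locale q_fock =
  fixes q :: real
  assumes q: "q \<in> Z_set - {0}"
begin

lemmas norm_triangle = q_norm_triangle[OF q]
  and norm_diff_triangle = q_norm_diff_triangle[OF q]

lemma q_cauchyD: "s \<in> q_cauchy q \<Longrightarrow> s n \<in> TP"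
  by (auto simp: q_cauchy_def)

lemma TP_closed: "x \<in> TP \<Longrightarrow> y \<in> TP \<Longrightarrow> x + y \<in> TP" "x \<in> TP \<Longrightarrow> y \<in> TP \<Longrightarrow> x - y \<in> TP"
  "x \<in> TP \<Longrightarrow> c *\<^sub>C x \<in> TP"
  by (simp_all add: complex_vector.subspace_add complex_vector.subspace_diff
      complex_vector.subspace_scale TP_subspace)

lemma norm_tendsto_zeroI:
  assumes "\<And>n. 0 \<le> f n" "\<And>n. f n \<le> g n" "g \<longlonglongrightarrow> 0"
  shows "f \<longlonglongrightarrow> (0::real)"
  by (rule tendsto_sandwich[OF _ _ tendsto_const assms(3)]) (auto simp: assms)

lemma equiv_null_rel: "equiv (q_cauchy q) (null_rel q)"
proof (rule equivI)
  show "null_rel q \<subseteq> q_cauchy q \<times> q_cauchy q" by (auto simp: null_rel_def)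
  show "refl_on (q_cauchy q) (null_rel q)" by (auto simp: refl_on_def null_rel_def)
  show "sym (null_rel q)" by (auto simp: sym_def null_rel_def q_norm_minus_commute)
  show "trans (null_rel q)"
  proof (rule transI)
    fix s t u assume st: "(s, t) \<in> null_rel q" "(t, u) \<in> null_rel q"
    then have TP: "s n \<in> perm_tens" "t n \<in> perm_tens" "u n \<in> perm_tens" for n
      by (auto simp: null_rel_def dest: q_cauchyD intro: TP_perm_tens)
    have "(\<lambda>n. q_norm q (s n - t n) + q_norm q (t n - u n)) \<longlonglongrightarrow> 0 + 0"
      using st by (intro tendsto_add) (auto simp: null_rel_def)
    then have "(\<lambda>n. q_norm q (s n - u n)) \<longlonglongrightarrow> 0"
      unfolding add_0_left
      by (rule norm_tendsto_zeroI[rotated 2])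
        (rule q_norm_nonneg[OF q perm_tens_closed(2)[OF TP(1,3)]], rule norm_diff_triangle[OF TP])
    then show "(s, u) \<in> null_rel q" using st by (auto simp: null_rel_def)
  qed
qed

lemma const_cauchy: "\<xi> \<in> TP \<Longrightarrow> (\<lambda>_. \<xi>) \<in> q_cauchy q"
  by (auto simp: q_cauchy_def)

lemma fvec_eq_iff:
  assumes "\<xi> \<in> TP" "\<zeta> \<in> TP"
  shows "fvec q \<xi> = fvec q \<zeta> \<longleftrightarrow> q_norm q (\<xi> - \<zeta>) = 0"
  unfolding fvec_def fock_cls_def eq_equiv_class_iff[OF equiv_null_rel const_cauchy[OF assms(1)] const_cauchy[OF assms(2)]]
  by (simp add: null_rel_def const_cauchy assms LIMSEQ_const_iff)

lemma fvec_memD: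
  assumes "s \<in> fvec q \<xi>"
  shows "s n \<in> TP" "s \<in> q_cauchy q" "(\<lambda>n. q_norm q (s n - \<xi>)) \<longlonglongrightarrow> 0"
  using assms by (auto simp: fvec_def fock_cls_def null_rel_def q_norm_minus_commute[of q \<xi>] dest: q_cauchyD)

lemma fvec_mem: "\<xi> \<in> TP \<Longrightarrow> (\<lambda>_. \<xi>) \<in> fvec q \<xi>"
  by (simp add: fvec_def fock_cls_def null_rel_def const_cauchy)

lemma tendsto_cauchy:
  assumes "\<And>n. s n \<in> TP" "\<xi> \<in> TP" "(\<lambda>n. q_norm q (s n - \<xi>)) \<longlonglongrightarrow> 0"
  shows "s \<in> q_cauchy q"
  unfolding q_cauchy_def
proof (intro CollectI conjI allI impI)
  show "range s \<subseteq> TP" using assms(1) by auto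
  fix e :: real assume "0 < e"
  then obtain M where M: "\<And>n. n \<ge> M \<Longrightarrow> norm (q_norm q (s n - \<xi>) - 0) < e / 2"
    using LIMSEQ_D[OF assms(3), of "e / 2"] by (meson half_gt_zero)
  have "q_norm q (s m - s n) < e" if "m \<ge> M" "n \<ge> M" for m n
  proof -
    have "q_norm q (s m - s n) \<le> q_norm q (s m - \<xi>) + q_norm q (\<xi> - s n)"
      using assms by (intro norm_diff_triangle TP_perm_tens)
    also have "\<dots> < e / 2 + e / 2"
      using M[OF that(1)] M[OF that(2)] by (intro add_strict_mono) (auto simp: q_norm_minus_commute[of q \<xi>])
    finally show ?thesis by simp
  qed
  then show "\<exists>M. \<forall>m\<ge>M. \<forall>n\<ge>M. q_norm q (s m - s n) < e" by blast
qed

lemma fock_cls_eq_fvec: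
  assumes "\<And>n. s n \<in> TP" "\<xi> \<in> TP" "(\<lambda>n. q_norm q (s n - \<xi>)) \<longlonglongrightarrow> 0"
  shows "fock_cls q s = fvec q \<xi>"
  unfolding fvec_def fock_cls_def
  by (rule equiv_class_eq[OF equiv_null_rel])
    (simp add: null_rel_def assms tendsto_cauchy[OF assms] const_cauchy)

lemma fock_add_fvec:
  assumes "\<xi> \<in> TP" "\<zeta> \<in> TP"
  shows "fock_add q (fvec q \<xi>) (fvec q \<zeta>) = fvec q (\<xi> + \<zeta>)"
proof -
  have const: "fock_cls q (\<lambda>n. s n + t n) = fvec q (\<xi> + \<zeta>)" if s: "s \<in> fvec q \<xi>" and t: "t \<in> fvec q \<zeta>" for s t
  proof (rule fock_cls_eq_fvec)
    show "s n + t n \<in> TP" for n using fvec_memD(1)[OF s] fvec_memD(1)[OF t] by (rule TP_closed)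
    show "\<xi> + \<zeta> \<in> TP" using assms by (rule TP_closed)
    have lim: "(\<lambda>n. q_norm q (s n - \<xi>) + q_norm q (t n - \<zeta>)) \<longlonglongrightarrow> 0"
      by (rule tendsto_add_zero) (intro fvec_memD s t)+
    have TP: "s n - \<xi> \<in> perm_tens" "t n - \<zeta> \<in> perm_tens" for n
      using fvec_memD(1)[OF s] fvec_memD(1)[OF t] assms by (simp_all add: TP_perm_tens TP_closed)
    have "q_norm q ((s n + t n) - (\<xi> + \<zeta>)) \<le> q_norm q (s n - \<xi>) + q_norm q (t n - \<zeta>)" for n
      unfolding add_diff_add by (rule norm_triangle[OF TP])
    then show "(\<lambda>n. q_norm q ((s n + t n) - (\<xi> + \<zeta>))) \<longlonglongrightarrow> 0"
      using lim unfolding add_diff_add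
      by (rule norm_tendsto_zeroI[rotated]) (rule q_norm_nonneg[OF q perm_tens_closed(1)[OF TP]])
  qed
  show ?thesis
    unfolding fock_add_def
    by (rule UN_constant_eq[OF fvec_mem[OF assms(1)]], rule ballI,
        rule UN_constant_eq[OF fvec_mem[OF assms(2)]], rule ballI, rule const)
qed

lemma fock_scale_fvec:
  assumes "\<xi> \<in> TP"
  shows "fock_scale q c (fvec q \<xi>) = fvec q (c *\<^sub>C \<xi>)"
proof -
  have const: "fock_cls q (\<lambda>n. c *\<^sub>C s n) = fvec q (c *\<^sub>C \<xi>)" if s: "s \<in> fvec q \<xi>" for s
  proof (rule fock_cls_eq_fvec)
    show "c *\<^sub>C s n \<in> TP" for n using fvec_memD(1)[OF s] by (rule TP_closed)
    show "c *\<^sub>C \<xi> \<in> TP" using assms by (rule TP_closed)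
    have "(\<lambda>n. cmod c * q_norm q (s n - \<xi>)) \<longlonglongrightarrow> cmod c * 0"
      by (intro tendsto_mult tendsto_const fvec_memD s)
    then show "(\<lambda>n. q_norm q (c *\<^sub>C s n - c *\<^sub>C \<xi>)) \<longlonglongrightarrow> 0"
      by (simp add: q_norm_scale flip: complex_vector.scale_right_diff_distrib)
  qed
  show ?thesis
    unfolding fock_scale_def
    by (rule UN_constant_eq[OF fvec_mem[OF assms]], rule ballI, rule const)
qed

text \<open>The inner product is continuous for the seminorm, so that every pair of representing sequences
  gives the same limit as the constant ones.\<close>

lemma fock_inner_fvec:
  assumes "\<xi> \<in> TP" "\<zeta> \<in> TP"
  shows "fock_inner q (fvec q \<xi>) (fvec q \<zeta>) = q_inner q \<xi> \<zeta>"
  unfolding fock_inner_def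
proof (rule the_equality)
  show "\<forall>s\<in>fvec q \<xi>. \<forall>t\<in>fvec q \<zeta>. (\<lambda>n. q_inner q (s n) (t n)) \<longlonglongrightarrow> q_inner q \<xi> \<zeta>"
  proof (intro ballI)
    fix s t assume s: "s \<in> fvec q \<xi>" and t: "t \<in> fvec q \<zeta>"
    have TP: "s n \<in> perm_tens" "t n \<in> perm_tens" "\<xi> \<in> perm_tens" "\<zeta> \<in> perm_tens" for n
      using fvec_memD(1)[OF s] fvec_memD(1)[OF t] assms by (auto intro: TP_perm_tens)
    let ?a = "\<lambda>n. q_norm q (s n - \<xi>)" and ?b = "\<lambda>n. q_norm q (t n - \<zeta>)"
    have bound: "cmod (q_inner q (s n) (t n) - q_inner q \<xi> \<zeta>) \<le> ?a n * (?b n + q_norm q \<zeta>) + q_norm q \<xi> * ?b n" for n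
    proof -
      have "q_inner q (s n) (t n) - q_inner q \<xi> \<zeta> = q_inner q (s n - \<xi>) (t n) + q_inner q \<xi> (t n - \<zeta>)"
        by (simp add: q_inner_diff_left q_inner_diff_right)
      also have "cmod \<dots> \<le> ?a n * q_norm q (t n) + q_norm q \<xi> * ?b n"
        by (intro order_trans[OF norm_triangle_ineq] add_mono q_cauchy_schwarz[OF q] perm_tens_closed TP)
      also have "q_norm q (t n) \<le> ?b n + q_norm q \<zeta>"
        using norm_triangle[of "t n - \<zeta>" \<zeta>] TP by (simp add: perm_tens_closed)
      then have "?a n * q_norm q (t n) \<le> ?a n * (?b n + q_norm q \<zeta>)"
        by (intro mult_left_mono q_norm_nonneg[OF q] perm_tens_closed TP)
      finally show ?thesis by simp
    qed
    have "(\<lambda>n. ?a n * (?b n + q_norm q \<zeta>) + q_norm q \<xi> * ?b n) \<longlonglongrightarrow> 0 * (0 + q_norm q \<zeta>) + q_norm q \<xi> * 0"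
      by (intro tendsto_intros fvec_memD s t)
    then have "(\<lambda>n. cmod (q_inner q (s n) (t n) - q_inner q \<xi> \<zeta>)) \<longlonglongrightarrow> 0"
      by (intro norm_tendsto_zeroI[OF _ bound]) simp_all
    then show "(\<lambda>n. q_inner q (s n) (t n)) \<longlonglongrightarrow> q_inner q \<xi> \<zeta>"
      by (simp add: tendsto_norm_zero_iff LIM_zero_iff)
  qed
  fix z assume "\<forall>s\<in>fvec q \<xi>. \<forall>t\<in>fvec q \<zeta>. (\<lambda>n. q_inner q (s n) (t n)) \<longlonglongrightarrow> z"
  then have "(\<lambda>_::nat. q_inner q \<xi> \<zeta>) \<longlonglongrightarrow> z" by (drule_tac bspec[OF _ fvec_mem[OF assms(1)]], drule_tac bspec[OF _ fvec_mem[OF assms(2)]])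
  then show "z = q_inner q \<xi> \<zeta>" by (simp add: LIMSEQ_const_iff)
qed

definition adjoint_maps :: "('a::real_inner ptens \<Rightarrow> 'a ptens) \<Rightarrow> ('a ptens \<Rightarrow> 'a ptens) \<Rightarrow> bool" where
  "adjoint_maps L L' \<longleftrightarrow> clinear L \<and> clinear L' \<and>
    (\<forall>\<xi>\<in>perm_tens. L \<xi> \<in> perm_tens \<and> L' \<xi> \<in> perm_tens) \<and>
    (\<forall>\<xi>\<in>perm_tens. \<forall>\<zeta>\<in>perm_tens. q_inner q (L \<xi>) \<zeta> = q_inner q \<xi> (L' \<zeta>))"

lemma adjoint_maps_swap:
  assumes "adjoint_maps L L'"
  shows "adjoint_maps L' L"
proof -
  have "q_inner q (L' \<xi>) \<zeta> = q_inner q \<xi> (L \<zeta>)" if "\<xi> \<in> perm_tens" "\<zeta> \<in> perm_tens" for \<xi> \<zeta>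
    using assms that q_inner_hermitian[OF q, of \<zeta> "L' \<xi>"] q_inner_hermitian[OF q, of "L \<zeta>" \<xi>]
    by (simp add: adjoint_maps_def)
  then show ?thesis using assms by (simp add: adjoint_maps_def)
qed

definition lift_op :: "('a::real_inner ptens \<Rightarrow> 'a ptens) \<Rightarrow> 'a fock_vec \<Rightarrow> 'a fock_vec" where
  "lift_op L x = fvec q (Wmap (L (SOME \<xi>. \<xi> \<in> TP \<and> fvec q \<xi> = x)))"

text \<open>By the Cauchy-Schwarz inequality a linear map that has an adjoint preserves the vectors of norm zero.
  It therefore descends to the dense subspace of the Fock space, and the representative chosen in
  \<open>lift_op\<close> does not matter.\<close>

lemma q_norm_adjoint_zero:
  assumes L: "adjoint_maps L L'" and \<xi>: "\<xi> \<in> perm_tens" "q_norm q \<xi> = 0"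
  shows "q_norm q (L \<xi>) = 0"
proof -
  have P: "L \<xi> \<in> perm_tens" "L' (L \<xi>) \<in> perm_tens" using L \<xi>(1) by (auto simp: adjoint_maps_def)
  have "q_inner q (L \<xi>) (L \<xi>) = q_inner q \<xi> (L' (L \<xi>))"
    using L \<xi>(1) P(1) by (simp add: adjoint_maps_def)
  moreover have "cmod (q_inner q \<xi> (L' (L \<xi>))) \<le> 0"
    using q_cauchy_schwarz[OF q \<xi>(1) P(2)] \<xi>(2) by simp
  ultimately show ?thesis by (simp add: q_norm_def)
qed

lemma q_norm_Wmap_diff: "q_norm q (Wmap \<xi> - \<xi>) = 0"
  by (simp add: q_norm_def q_inner_diff_left q_inner_Wmap_left)

lemma fvec_Wmap_eqI:
  assumes "\<xi> \<in> perm_tens" "\<zeta> \<in> perm_tens" "q_norm q (\<xi> - \<zeta>) = 0"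
  shows "fvec q (Wmap \<xi>) = fvec q (Wmap \<zeta>)"
proof -
  have "Wmap \<xi> \<in> perm_tens" "Wmap \<zeta> \<in> perm_tens" using assms by (simp_all add: Wmap_perm_tens)
  then have "q_norm q (Wmap \<xi> - Wmap \<zeta>) \<le> q_norm q (Wmap \<xi> - \<xi>) + (q_norm q (\<xi> - \<zeta>) + q_norm q (\<zeta> - Wmap \<zeta>))"
    using norm_diff_triangle[of "Wmap \<xi>" \<xi> "Wmap \<zeta>"] norm_diff_triangle[of \<xi> \<zeta> "Wmap \<zeta>"] assms by linarith
  then have "q_norm q (Wmap \<xi> - Wmap \<zeta>) \<le> 0"
    by (simp add: q_norm_Wmap_diff q_norm_minus_commute[of q \<zeta>] assms)
  moreover have "0 \<le> q_norm q (Wmap \<xi> - Wmap \<zeta>)"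
    using assms q by (intro q_norm_nonneg) (simp_all add: Wmap_perm_tens perm_tens_closed)
  ultimately show ?thesis using assms by (subst fvec_eq_iff) (simp_all add: Wmap_TP)
qed

lemma fvec_adjoint_cong:
  assumes L: "adjoint_maps L L'" and P: "\<xi> \<in> perm_tens" "\<zeta> \<in> perm_tens" and z: "q_norm q (\<xi> - \<zeta>) = 0"
  shows "fvec q (Wmap (L \<xi>)) = fvec q (Wmap (L \<zeta>))"
proof (rule fvec_Wmap_eqI)
  show "L \<xi> \<in> perm_tens" "L \<zeta> \<in> perm_tens" using L P by (auto simp: adjoint_maps_def)
  have "L \<xi> - L \<zeta> = L (\<xi> - \<zeta>)" using L by (simp add: adjoint_maps_def clinear_diff)
  then show "q_norm q (L \<xi> - L \<zeta>) = 0" using q_norm_adjoint_zero[OF L perm_tens_closed(2)[OF P] z] by simp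
qed

lemma lift_op_fvec:
  assumes L: "adjoint_maps L L'" and \<xi>: "\<xi> \<in> TP"
  shows "lift_op L (fvec q \<xi>) = fvec q (Wmap (L \<xi>))"
proof -
  let ?\<zeta> = "SOME \<zeta>. \<zeta> \<in> TP \<and> fvec q \<zeta> = fvec q \<xi>"
  have \<zeta>: "?\<zeta> \<in> TP \<and> fvec q ?\<zeta> = fvec q \<xi>" by (rule someI[of _ \<xi>]) (use \<xi> in simp)
  then have "q_norm q (?\<zeta> - \<xi>) = 0" using fvec_eq_iff[of ?\<zeta> \<xi>] \<xi> by blast
  then show ?thesis
    unfolding lift_op_def using \<zeta> \<xi> by (intro fvec_adjoint_cong[OF L]) (auto intro: TP_perm_tens)
qed

lemma lift_op_Wmap:
  assumes L: "adjoint_maps L L'" and \<xi>: "\<xi> \<in> perm_tens"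
  shows "lift_op L (fvec q (Wmap \<xi>)) = fvec q (Wmap (L \<xi>))"
  using lift_op_fvec[OF L Wmap_TP[OF \<xi>]]
    fvec_adjoint_cong[OF L Wmap_perm_tens[OF \<xi>] \<xi> q_norm_Wmap_diff]
  by (rule trans)

lemma dense_operator_lift_op:
  assumes L: "adjoint_maps L L'"
  shows "dense_operator q (lift_op L)"
proof -
  have lin: "clinear L" and P: "\<xi> \<in> TP \<Longrightarrow> Wmap (L \<xi>) \<in> TP" for \<xi>
    using L by (auto simp: adjoint_maps_def TP_perm_tens Wmap_TP)
  show ?thesis
    unfolding dense_operator_def fock_dense_def
  proof (intro conjI ballI allI)
    show "lift_op L ` fvec q ` TP \<subseteq> fvec q ` TP" using P by (auto simp: lift_op_fvec[OF L])
  next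
    fix x y :: "'a fock_vec" assume "x \<in> fvec q ` TP" "y \<in> fvec q ` TP"
    then obtain \<xi> \<zeta> where "x = fvec q \<xi>" "y = fvec q \<zeta>" "\<xi> \<in> TP" "\<zeta> \<in> TP" by auto
    then show "lift_op L (fock_add q x y) = fock_add q (lift_op L x) (lift_op L y)"
      using P by (simp add: fock_add_fvec lift_op_fvec[OF L] TP_closed clinear_add[OF lin] clinear_add[OF clinear_Wmap])
  next
    fix c and x :: "'a fock_vec" assume "x \<in> fvec q ` TP"
    then obtain \<xi> where "x = fvec q \<xi>" "\<xi> \<in> TP" by auto
    then show "lift_op L (fock_scale q c x) = fock_scale q c (lift_op L x)"
      using P by (simp add: fock_scale_fvec lift_op_fvec[OF L] TP_closed clinear_scale[OF lin] clinear_scale[OF clinear_Wmap])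
  qed
qed

lemma q_inner_Wmap_right:
  assumes "\<xi> \<in> perm_tens" "\<zeta> \<in> perm_tens"
  shows "q_inner q \<xi> (Wmap \<zeta>) = q_inner q \<xi> \<zeta>"
  using assms q_inner_hermitian[OF q, of "Wmap \<zeta>" \<xi>] q_inner_hermitian[OF q, of \<zeta> \<xi>]
  by (simp add: Wmap_perm_tens q_inner_Wmap_left)

lemma adjoint_operators_lift_op:
  assumes L: "adjoint_maps L L'"
  shows "adjoint_operators q (lift_op L) (lift_op L')"
proof -
  have "fock_inner q (lift_op K (fvec q \<xi>)) (fvec q \<zeta>) = fock_inner q (fvec q \<xi>) (lift_op K' (fvec q \<zeta>))"
    if K: "adjoint_maps K K'" and T: "\<xi> \<in> TP" "\<zeta> \<in> TP" for K K' and \<xi> \<zeta> :: "'a ptens"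
  proof -
    have P: "\<xi> \<in> perm_tens" "\<zeta> \<in> perm_tens" using T by (simp_all add: TP_perm_tens)
    have KP: "K \<xi> \<in> perm_tens" "K' \<zeta> \<in> perm_tens" using K P by (auto simp: adjoint_maps_def)
    have "q_inner q (K \<xi>) \<zeta> = q_inner q \<xi> (K' \<zeta>)" using K P by (simp add: adjoint_maps_def)
    then show ?thesis
      using T KP P by (simp add: lift_op_fvec[OF K] lift_op_fvec[OF adjoint_maps_swap[OF K]]
          fock_inner_fvec Wmap_TP q_inner_Wmap_left q_inner_Wmap_right)
  qed
  from this[OF L] this[OF adjoint_maps_swap[OF L]] show ?thesis
    unfolding adjoint_operators_def fock_dense_def by auto
qed

lemma adjoint_creat_annih: "adjoint_maps (creat h) (annih q h)"
  by (simp add: adjoint_maps_def clinear_creat clinear_annih creat_perm_tens annih_perm_tens q_inner_creat)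

end

section \<open>Powers of the field operator\<close>

text \<open>The element of the algebra that \<open>T\<close> maps to the power \<open>m\<close> of the field operator \<open>W((0)(1) \<otimes> h)\<close>
  (lemma \<open>tpow_field\<close>).\<close>

definition field_power :: "'a::real_inner \<Rightarrow> nat \<Rightarrow> 'a ptens" where
  "field_power h m = elem id (replicate m h)"

lemma id_S0: "id \<in> S0 n"
  by (simp add: S0_def permutes_id)

lemma field_power_perm_tens: "field_power h m \<in> perm_tens"
  unfolding field_power_def by (intro perm_tens_elem id_S0)

lemma Wmap_field_power: "Wmap (field_power h m) = field_power h m"
proof -
  have "elem (\<sigma> \<circ> id \<circ> inv \<sigma>) (perm_list \<sigma> (replicate m h)) = elem id (replicate m h)"
    if \<sigma>: "\<sigma> \<in> Sn m" for \<sigma>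
  proof -
    have "\<sigma> \<circ> id \<circ> inv \<sigma> = id" by (simp add: fun_eq_iff Sn_inv_apply[OF \<sigma>])
    moreover have "perm_list \<sigma> (replicate m h) = replicate m h"
    proof (rule slots_eqI)
      fix i assume "i \<in> {1..length (replicate m h)}"
      then have i: "i \<in> {1..m}" by simp
      then have "inv \<sigma> i \<in> {1..m}" using Sn_in[OF Sn_inv[OF \<sigma>]] by blast
      then have "inv \<sigma> i - 1 < m" "i - 1 < m" using i by auto
      then show "perm_list \<sigma> (replicate m h) ! (i - 1) = replicate m h ! (i - 1)"
        using i by (subst perm_list_nth) simp_all
    qed simp
    ultimately show ?thesis by (simp only:)
  qed
  then have "Wmap (field_power h m) = (1 / fact m) *\<^sub>C (\<Sum>\<sigma>\<in>Sn m. field_power h m)"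
    unfolding field_power_def Wmap_elem length_replicate
    by (intro arg_cong[where f = "\<lambda>x. (1 / fact m) *\<^sub>C x"] sum.cong refl)
  then show ?thesis by (simp add: sum_scaleC_const card_Sn scaleC_scaleC scaleC_one)
qed

lemma field_power_TP: "field_power h m \<in> TP"
  using Wmap_TP[OF field_power_perm_tens] by (simp add: Wmap_field_power)

lemma creat_field_power: "creat h (field_power h m) = field_power h (Suc m)"
  by (simp add: field_power_def creat_elem replicate_append_same)

lemma annih_field_power:
  "annih q h (field_power h m) = of_real (real m * inner h h) *\<^sub>C field_power h (m - 1)"
proof -
  have "elem (transport ({0..m} - {k}) {0..m - 1} (perm_del {k} id)) (restr ({0..m} - {k}) (replicate m h)) =
      field_power h (m - 1)" if k: "k \<in> {1..m}" for k
  proof -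
    have "perm_del {k} id = id" by (simp add: perm_del_single)
    moreover have "transport ({0..m} - {k}) {0..m - 1} id = id"
      using k by (intro transport_eqI) (auto simp: permutes_id)
    moreover have "restr ({0..m} - {k}) (replicate m h) = replicate (m - 1) h"
      using restr_remove[of k "replicate m h"] k by (auto simp: min_def simp flip: replicate_add)
    ultimately show ?thesis by (simp only: field_power_def)
  qed
  then have "annih q h (field_power h m) = (\<Sum>k\<in>{1..m}. of_real (inner h h) *\<^sub>C field_power h (m - 1))"
    unfolding field_power_def[of h m] annih_elem length_replicate
    by (intro sum.cong refl) (auto simp: nth_replicate)
  then show ?thesis by (simp add: sum_scaleC_const scaleC_scaleC)
qed

lemma T_raw_one: "T_raw q (field_power h 0) = field_power h 0"
proof -
  have "P12 0 = {id}" by (auto simp: P12_def)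
  then show ?thesis
    using trivial_contraction[of id "[] :: 'a list", OF id_S0]
    by (simp add: field_power_def T_raw_elem scaleC_one del: id_apply)
qed

lemma Tmap_field: "q \<noteq> 0 \<Longrightarrow> Tmap q (field_power h 1) = field_power h 1"
proof -
  assume q: "q \<noteq> 0"
  have "T_raw q (field_power h 1) = creat h (T_raw q (field_power h 0)) + annih q h (T_raw q (field_power h 0))"
    using T_raw_creat[OF q field_power_perm_tens[of h 0], of h] by (simp add: creat_field_power)
  then have "T_raw q (field_power h 1) = field_power h 1"
    by (simp add: T_raw_one creat_field_power annih_field_power)
  then show ?thesis by (simp add: Tmap_T_raw Wmap_field_power)
qed

lemma T_inv_field:
  assumes "q \<noteq> 0"
  shows "T_inv q (field_power h 1) = field_power h 1"
  using T_inv_Tmap[OF field_power_TP, of q h 1] by (simp only: Tmap_field[OF assms])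

lemma cup_tens_field: "cup_tens \<xi> (field_power h 1) = creat h \<xi>"
proof -
  have "multilinear (\<lambda>\<beta> gs. elem (perm_cup (length hs) \<alpha> \<beta>) (hs @ gs))" for \<alpha> and hs :: "'a list"
    unfolding multilinear_def
  proof (intro allI)
    fix \<beta> u v a b and xs ys :: "'a list"
    show "elem (perm_cup (length hs) \<alpha> \<beta>) (hs @ xs @ (a *\<^sub>R u + b *\<^sub>R v) # ys) =
        of_real a *\<^sub>C elem (perm_cup (length hs) \<alpha> \<beta>) (hs @ xs @ u # ys) +
        of_real b *\<^sub>C elem (perm_cup (length hs) \<alpha> \<beta>) (hs @ xs @ v # ys)"
      using multilinear_elem[unfolded multilinear_def, rule_format,
          of "perm_cup (length hs) \<alpha> \<beta>" "hs @ xs" a u b v ys] by simp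
  qed
  moreover have "perm_cup n \<alpha> id = \<alpha>" for n \<alpha>
    by (auto simp: perm_cup_def perm_shift_def Let_def fun_eq_iff)
  ultimately show ?thesis
    by (simp add: cup_tens_def field_power_def lin_ext_elem creat_def del: id_apply)
qed

text \<open>The product is concatenation in the coordinates given by \<open>T\<close>, and concatenation with the field
  operator is creation; \<open>T_raw_creat\<close> moves the creation past \<open>T\<close>.\<close>

lemma tmult_field:
  assumes q: "q \<noteq> 0" and \<xi>: "\<xi> \<in> TP"
  shows "tmult q \<xi> (field_power h 1) = Tmap q (creat h (T_inv q \<xi>))"
    "tmult q \<xi> (field_power h 1) =
      Wmap (creat h (T_raw q (T_inv q \<xi>))) + Wmap (annih q h (T_raw q (T_inv q \<xi>)))"
proof -
  have P: "T_inv q \<xi> \<in> perm_tens" using T_inv_TP[OF \<xi>] by (rule TP_perm_tens)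
  show eq: "tmult q \<xi> (field_power h 1) = Tmap q (creat h (T_inv q \<xi>))"
    unfolding tmult_def T_inv_field[OF q] cup_tens_field using P by (intro Tmap_Wmap creat_perm_tens)
  show "tmult q \<xi> (field_power h 1) =
      Wmap (creat h (T_raw q (T_inv q \<xi>))) + Wmap (annih q h (T_raw q (T_inv q \<xi>)))"
    unfolding eq Tmap_T_raw T_raw_creat[OF q P] by (rule clinear_add[OF clinear_Wmap])
qed

lemma tadj_field:
  assumes q: "q \<noteq> 0"
  shows "tadj q (field_power h 1) = field_power h 1"
proof -
  have "antilin_ext (\<lambda>\<alpha> hs. elem (inv \<alpha>) hs) (field_power h 1) = field_power h 1"
    unfolding field_power_def
    by (subst antilin_ext_elem[OF multilinear_relabel[OF multilinear_elem, where r = "\<lambda>\<alpha> _. inv \<alpha>"]])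
      (simp del: id_apply)
  then show ?thesis by (simp only: tadj_def T_inv_field[OF q] Wmap_field_power Tmap_field[OF q])
qed

lemma tpow_field:
  assumes q: "q \<noteq> 0"
  shows "tpow q (field_power h 1) m = Tmap q (field_power h m)"
proof (induction m)
  case 0
  have "Tmap q (field_power h 0) = field_power h 0"
    by (simp only: Tmap_T_raw T_raw_one Wmap_field_power)
  moreover have "tpow q (field_power h 1) 0 = Wmap (field_power h 0)" by (simp add: field_power_def)
  ultimately show ?case by (simp only: Wmap_field_power)
next
  case (Suc m)
  have "tpow q (field_power h 1) (Suc m) = tmult q (Tmap q (field_power h m)) (field_power h 1)"
    using Suc by simp
  also have "\<dots> = Tmap q (creat h (field_power h m))"
    by (subst tmult_field(1)[OF q Tmap_TP[OF field_power_perm_tens]])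
      (simp only: T_inv_Tmap[OF field_power_TP])
  finally show ?case by (simp only: creat_field_power)
qed

section \<open>Moments\<close>

text \<open>The coefficient of \<open>He\<^sub>j\<close> in the expansion of \<open>x\<^sup>m\<close> in Hermite polynomials of variance \<open>r\<close>. For
  \<open>j = 0\<close> this is the moment of order \<open>m\<close> of the Gaussian law.\<close>

definition hermite_coeff :: "real \<Rightarrow> nat \<Rightarrow> nat \<Rightarrow> real" where
  "hermite_coeff r m j = (if j \<le> m \<and> even (m - j)
     then fact m * r ^ ((m - j) div 2) / (fact ((m - j) div 2) * fact j * 2 ^ ((m - j) div 2)) else 0)"

lemma hermite_coeff_eq:
  "hermite_coeff r (j + 2 * i) j = fact (j + 2 * i) * r ^ i / (fact i * fact j * 2 ^ i)"
  by (simp add: hermite_coeff_def)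

text \<open>Coefficientwise, this is the three-term recurrence \<open>x He\<^sub>j = He\<^bsub>j+1\<^esub> + j r He\<^bsub>j-1\<^esub>\<close>.\<close>

lemma hermite_coeff_Suc:
  "hermite_coeff r (Suc m) j =
    (if j = 0 then 0 else hermite_coeff r m (j - 1)) + real (Suc j) * r * hermite_coeff r m (Suc j)"
proof (cases "j \<le> Suc m \<and> even (Suc m - j)")
  case True
  then have "even (Suc m - j)" by blast
  then obtain i where "Suc m - j = 2 * i" by (elim evenE)
  then have i: "Suc m = j + 2 * i" using True by simp
  show ?thesis
  proof (cases i)
    case 0
    then have "j = Suc m" using i by simp
    then show ?thesis by (simp add: hermite_coeff_def)
  next
    case (Suc k)
    then have m: "m = Suc j + 2 * k" using i by simp
    have S: "hermite_coeff r (Suc m) j = fact (Suc m) * r ^ i / (fact i * fact j * 2 ^ i)"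
      unfolding i by (rule hermite_coeff_eq)
    have U: "real (Suc j) * r * hermite_coeff r m (Suc j) = 2 * real i * (fact m * r ^ i / (fact i * fact j * 2 ^ i))"
      unfolding m hermite_coeff_eq Suc by (simp add: field_simps del: fact_Suc) (simp add: field_simps)
    show ?thesis
    proof (cases j)
      case 0
      then have "Suc m = 2 * i" using i by simp
      then have "real (Suc m) = 2 * real i" by (metis of_nat_mult of_nat_numeral)
      then show ?thesis unfolding S U using 0 by (simp add: fact_Suc)
    next
      case (Suc j')
      then have "hermite_coeff r m (j - 1) = fact m * r ^ i / (fact i * fact j' * 2 ^ i)"
        using i hermite_coeff_eq[of r j' i] by simp
      also have "\<dots> = real j * (fact m * r ^ i / (fact i * fact j * 2 ^ i))"
      proof -
        have "fact j = real j * fact j'" "real j \<noteq> 0" using Suc by simp_all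
        then show ?thesis by simp
      qed
      finally have D: "hermite_coeff r m (j - 1) = real j * (fact m * r ^ i / (fact i * fact j * 2 ^ i))" .
      have "real (Suc m) = real j + 2 * real i" using i by simp
      then have "hermite_coeff r (Suc m) j = (real j + 2 * real i) * (fact m * r ^ i / (fact i * fact j * 2 ^ i))"
        unfolding S by (simp add: fact_Suc)
      then show ?thesis unfolding U using D Suc by (simp only: distrib_right) simp
    qed
  qed
next
  case False
  then have "hermite_coeff r (Suc m) j = 0" by (auto simp: hermite_coeff_def)
  moreover have "hermite_coeff r m (Suc j) = 0"
    using False by (auto simp: hermite_coeff_def Suc_diff_Suc Suc_diff_le)
  moreover have "hermite_coeff r m (j - 1) = 0" if "j \<noteq> 0"
    using False that by (cases j) (auto simp: hermite_coeff_def)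
  ultimately show ?thesis by simp
qed

lemma hermite_coeff_above: "m < j \<Longrightarrow> hermite_coeff r m j = 0"
  by (simp add: hermite_coeff_def)

text \<open>Creation and annihilation act on the tensors \<open>id \<otimes> h\<^sup>j\<close> as the two terms of the recurrence act on the
  Hermite polynomials of variance \<open>\<parallel>h\<parallel>\<^sup>2\<close>.\<close>

lemma T_raw_field_power:
  assumes q: "q \<noteq> 0"
  shows "T_raw q (field_power h m) =
    (\<Sum>j\<le>m. of_real (hermite_coeff (inner h h) m j) *\<^sub>C field_power h j)"
proof (induction m)
  case 0
  show ?case by (simp add: T_raw_one hermite_coeff_def scaleC_one)
next
  case (Suc m)
  let ?r = "inner h h" and ?v = "field_power h"
  let ?c = "hermite_coeff ?r m"
  have "T_raw q (?v (Suc m)) = creat h (T_raw q (?v m)) + annih q h (T_raw q (?v m))"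
    using T_raw_creat[OF q field_power_perm_tens[of h m], of h] by (simp only: creat_field_power)
  also have "creat h (T_raw q (?v m)) = (\<Sum>j\<le>m. of_real (?c j) *\<^sub>C ?v (Suc j))"
    unfolding Suc.IH by (simp add: clinear_sum[OF clinear_creat] clinear_scale[OF clinear_creat] creat_field_power)
  also have "\<dots> = (\<Sum>j\<le>Suc m. of_real (if j = 0 then 0 else ?c (j - 1)) *\<^sub>C ?v j)"
    by (subst sum.atMost_Suc_shift) simp
  also have "annih q h (T_raw q (?v m)) = (\<Sum>j\<le>m. of_real (?c j * (real j * ?r)) *\<^sub>C ?v (j - 1))"
    unfolding Suc.IH
    by (simp add: clinear_sum[OF clinear_annih] clinear_scale[OF clinear_annih] annih_field_power scaleC_scaleC)
  also have "\<dots> = (\<Sum>j\<le>Suc (Suc m). of_real (?c j * (real j * ?r)) *\<^sub>C ?v (j - 1))"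
    by (simp add: hermite_coeff_above)
  also have "\<dots> = (\<Sum>j\<le>Suc m. of_real (real (Suc j) * ?r * ?c (Suc j)) *\<^sub>C ?v j)"
    by (subst sum.atMost_Suc_shift) (simp add: mult_ac)
  finally show ?case
    by (simp only: hermite_coeff_Suc of_real_add scaleC_add_left sum.distrib)
qed

lemma multilinear_phi: "multilinear (\<lambda>\<alpha> hs. if hs = [] then 1 else (0::complex))"
  by (simp add: multilinear_def)

lemma phi_elem: "phi (elem \<alpha> hs) = (if hs = [] then 1 else 0)"
  unfolding phi_def by (rule lin_ext_elem[OF multilinear_phi])

lemma clinear_phi: "clinear phi"
  unfolding phi_def by (rule clinear_lin_ext[OF multilinear_phi])

lemma phi_Wmap: "phi (Wmap \<xi>) = phi \<xi>"
proof (rule clinear_eqI[OF clinear_compose[OF clinear_phi clinear_Wmap] clinear_phi])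
  fix \<alpha> and hs :: "'a list"
  have "perm_list \<sigma> hs = [] \<longleftrightarrow> hs = []" for \<sigma> by (metis length_0_conv length_perm_list)
  then show "phi (Wmap (elem \<alpha> hs)) = phi (elem \<alpha> hs)"
    by (simp add: Wmap_elem clinear_scale[OF clinear_phi] clinear_sum[OF clinear_phi] phi_elem card_Sn
        scaleC_complex_def)
qed

lemma phi_tpow_field:
  assumes "q \<noteq> 0"
  shows "phi (tpow q (field_power h 1) m) = of_real (hermite_coeff (inner h h) m 0)"
proof -
  have "phi (field_power h j) = (if j = 0 then 1 else 0)" for j
    by (simp add: field_power_def phi_elem)
  then have "phi (tpow q (field_power h 1) m) =
      (\<Sum>j\<le>m. if j = 0 then of_real (hermite_coeff (inner h h) m j) else 0)"
    unfolding tpow_field[OF assms] Tmap_T_raw phi_Wmap T_raw_field_power[OF assms]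
    unfolding clinear_sum[OF clinear_phi] clinear_scale[OF clinear_phi]
    by (intro sum.cong refl) (simp add: scaleC_complex_def)
  then show ?thesis by simp
qed

lemma gaussian_prob: "0 \<le> \<sigma> \<Longrightarrow> prob_space (gaussian \<mu> \<sigma>)" "sets (gaussian \<mu> \<sigma>) = sets borel"
  by (auto simp: gaussian_def prob_space_return intro: prob_space_normal_density)

lemma gaussian_moments:
  assumes "0 \<le> \<sigma>"
  shows "integrable (gaussian 0 \<sigma>) (\<lambda>x. x ^ m)"
    "(\<integral>x. x ^ m \<partial>gaussian 0 \<sigma>) = hermite_coeff (\<sigma>\<^sup>2) m 0"
proof -
  have "has_bochner_integral (gaussian 0 \<sigma>) (\<lambda>x. x ^ m) (hermite_coeff (\<sigma>\<^sup>2) m 0)"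
  proof (cases "\<sigma> = 0")
    case True
    have "hermite_coeff (\<sigma>\<^sup>2) m 0 = 0 ^ m" using True by (cases m) (auto simp: hermite_coeff_def elim!: oddE evenE)
    moreover have "has_bochner_integral (return borel 0) (\<lambda>x::real. x ^ m) (0 ^ m)"
      by (auto simp: has_bochner_integral_iff integral_return integrable_iff_bounded nn_integral_return)
    ultimately show ?thesis using True by (simp add: gaussian_def)
  next
    case False
    then have \<sigma>: "0 < \<sigma>" using assms by simp
    have "has_bochner_integral lborel (\<lambda>x. normal_density 0 \<sigma> x * x ^ m) (hermite_coeff (\<sigma>\<^sup>2) m 0)"
    proof (cases "even m")
      case True
      then obtain k where k: "m = 2 * k" by (elim evenE)
      have "fact (2 * k) / ((2 / \<sigma>\<^sup>2) ^ k * fact k) = hermite_coeff (\<sigma>\<^sup>2) m 0"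
        using \<sigma> by (simp add: k hermite_coeff_def power_divide field_simps)
      then show ?thesis using normal_moment_even[OF \<sigma>, of 0 k] by (simp add: k)
    next
      case False
      then obtain k where k: "m = 2 * k + 1" by (elim oddE)
      have "hermite_coeff (\<sigma>\<^sup>2) m 0 = 0" by (simp add: k hermite_coeff_def)
      then show ?thesis using normal_moment_odd[OF \<sigma>, of 0 k] by (simp add: k)
    qed
    then show ?thesis
      using False by (auto simp: gaussian_def intro!: has_bochner_integral_density)
  qed
  then show "integrable (gaussian 0 \<sigma>) (\<lambda>x. x ^ m)"
    "(\<integral>x. x ^ m \<partial>gaussian 0 \<sigma>) = hermite_coeff (\<sigma>\<^sup>2) m 0"
    by (simp_all add: has_bochner_integral_iff)
qed

lemma has_distribution_field:
  assumes "q \<noteq> 0"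
  shows "has_distribution q (field_power h 1) (gaussian 0 (norm h))"
  unfolding has_distribution_def
  using gaussian_prob(1)[of "norm h" 0] gaussian_moments[of "norm h"]
  by (simp add: gaussian_prob(2) field_power_TP tadj_field[OF assms, simplified] phi_tpow_field[OF assms, simplified]
      power2_norm_eq_inner)

lemma annih_ot:
  assumes "F \<in> tensor_power n"
  shows "annih q h (ot \<alpha> F) =
    (\<Sum>k\<in>{k\<in>{1..n}. \<alpha> k = k}. ot (transport ({0..n} - {k}) {0..n-1} (perm_del {k} \<alpha>)) (r_minus k h F)) +
    of_real q *\<^sub>C
    (\<Sum>k\<in>{k\<in>{1..n}. \<alpha> k \<noteq> k}. ot (transport ({0..n} - {k}) {0..n-1} (perm_del {k} \<alpha>)) (r_minus k h F))"
  using assms clinear_compose[OF clinear_annih clinear_ot]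
proof (rule tensor_power_eqI)
  show "clinear (\<lambda>F. (\<Sum>k\<in>{k\<in>{1..n}. \<alpha> k = k}. ot (transport ({0..n} - {k}) {0..n-1} (perm_del {k} \<alpha>)) (r_minus k h F)) +
    of_real q *\<^sub>C
    (\<Sum>k\<in>{k\<in>{1..n}. \<alpha> k \<noteq> k}. ot (transport ({0..n} - {k}) {0..n-1} (perm_del {k} \<alpha>)) (r_minus k h F)))"
    by (intro clinear_plus clinear_scaleC clinear_sum_fun clinear_compose[OF clinear_ot clinear_r_minus]) auto
  fix hs :: "'a list" assume n: "length hs = n"
  let ?g = "\<lambda>k. ot (transport ({0..n} - {k}) {0..n-1} (perm_del {k} \<alpha>)) (r_minus k h (elem () hs))"
  have "annih q h (ot \<alpha> (elem () hs)) = (\<Sum>k\<in>{1..n}. if \<alpha> k = k then ?g k else of_real q *\<^sub>C ?g k)"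
    unfolding ot_elem annih_elem_r_minus n by (intro sum.cong refl) (simp add: scaleC_one)
  also have "\<dots> = (\<Sum>k\<in>{k\<in>{1..n}. \<alpha> k = k}. ?g k) + of_real q *\<^sub>C (\<Sum>k\<in>{k\<in>{1..n}. \<alpha> k \<noteq> k}. ?g k)"
    by (simp add: sum.If_cases complex_vector.scale_sum_right Int_def)
  finally show "annih q h (ot \<alpha> (elem () hs)) =
    (\<Sum>k\<in>{k\<in>{1..n}. \<alpha> k = k}. ?g k) + of_real q *\<^sub>C (\<Sum>k\<in>{k\<in>{1..n}. \<alpha> k \<noteq> k}. ?g k)" .
qed

lemma creat_ot: "F \<in> tensor_power n \<Longrightarrow> creat h (ot \<alpha> F) = ot \<alpha> (r_plus h F)"
  by (erule tensor_power_eqI[OF _ clinear_compose[OF clinear_creat clinear_ot]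
        clinear_compose[OF clinear_ot clinear_r_plus]])
    (simp add: creat_elem r_plus_elem)

theorem theoremV24:
  fixes q :: real and h :: "'a::{real_inner, complete_space}" and A :: "'a ptens"
  assumes q: "q \<in> Z_set - {0}"
    and A_def: "A = Wmap (ot id (elem () [h]))"
  shows "A = Tmap q (ot id (elem () [h])) \<and>
    (\<exists>a_plus a_minus.
       dense_operator q a_plus \<and> dense_operator q a_minus \<and>
       (\<forall>n. \<forall>\<alpha>\<in>S0 n. \<forall>F\<in>tensor_power n.
          a_plus (fvec q (Wmap (ot \<alpha> F))) = fvec q (Wmap (ot \<alpha> (r_plus h F)))) \<and>
       (\<forall>n. \<forall>\<alpha>\<in>S0 n. \<forall>F\<in>tensor_power n.
          a_minus (fvec q (Wmap (ot \<alpha> F))) =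
            fvec q (Wmap (
              (\<Sum>k\<in>{k\<in>{1..n}. \<alpha> k = k}.
                 ot (transport ({0..n} - {k}) {0..n-1} (perm_del {k} \<alpha>)) (r_minus k h F)) +
              of_real q *\<^sub>C
              (\<Sum>k\<in>{k\<in>{1..n}. \<alpha> k \<noteq> k}.
                 ot (transport ({0..n} - {k}) {0..n-1} (perm_del {k} \<alpha>)) (r_minus k h F))))) \<and>
       (\<forall>\<xi>\<in>TP. fvec q (tmult q \<xi> A) = fock_add q (a_plus (fvec q \<xi>)) (a_minus (fvec q \<xi>))) \<and>
       adjoint_operators q a_plus a_minus) \<and>
    has_distribution q A (gaussian 0 (norm h))"
proof -
  interpret q_fock q by standard (rule q)
  have q0: "q \<noteq> 0" using q by simp
  have field: "ot id (elem () [h]) = field_power h 1" by (simp add: field_power_def)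
  have A: "A = field_power h 1" unfolding A_def field by (rule Wmap_field_power)
  note adj = adjoint_creat_annih[of h]
  note adj' = adjoint_maps_swap[OF adj]
  have sum: "fvec q (tmult q \<xi> A) = fock_add q (lift_op (creat h) (fvec q \<xi>)) (lift_op (annih q h) (fvec q \<xi>))"
    if \<xi>: "\<xi> \<in> TP" for \<xi>
  proof -
    let ?\<rho> = "T_raw q (T_inv q \<xi>)"
    have \<rho>: "?\<rho> \<in> perm_tens" using T_inv_TP[OF \<xi>] by (intro T_raw_perm_tens TP_perm_tens)
    have W: "Wmap ?\<rho> = \<xi>" using Tmap_T_inv[OF \<xi>] by (simp add: Tmap_T_raw)
    have "fvec q (tmult q \<xi> A) = fock_add q (fvec q (Wmap (creat h ?\<rho>))) (fvec q (Wmap (annih q h ?\<rho>)))"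
      unfolding A tmult_field(2)[OF q0 \<xi>]
      using \<rho> by (simp add: fock_add_fvec Wmap_TP creat_perm_tens annih_perm_tens)
    then show ?thesis
      using lift_op_Wmap[OF adj \<rho>] lift_op_Wmap[OF adj' \<rho>] by (simp only: W)
  qed
  show ?thesis
  proof (intro conjI; (rule exI[of _ "lift_op (creat h)"], rule exI[of _ "lift_op (annih q h)"], intro conjI)?)
    show "A = Tmap q (ot id (elem () [h]))" unfolding A field by (rule Tmap_field[OF q0, symmetric])
    show "dense_operator q (lift_op (creat h))" by (rule dense_operator_lift_op[OF adj])
    show "dense_operator q (lift_op (annih q h))" by (rule dense_operator_lift_op[OF adj'])
    show "adjoint_operators q (lift_op (creat h)) (lift_op (annih q h))"
      by (rule adjoint_operators_lift_op[OF adj])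
    show "has_distribution q A (gaussian 0 (norm h))" unfolding A by (rule has_distribution_field[OF q0])
  qed (simp_all add: sum lift_op_Wmap[OF adj] lift_op_Wmap[OF adj'] ot_perm_tens creat_ot annih_ot)
qed

end
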